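(* Let $\Lambda$ be a Gorenstein Artin algebra and let $\Delta_{(\phi,\phi)}=\begin{pmatrix}\Lambda&\Lambda\\ \Lambda&\Lambda\end{pmatrix}$ be a Morita ring all of whose entries are $\Lambda$. Then a $\Delta_{(\phi,\phi)}$-module $(X,Y,f,g)$ is Gorenstein-projective if and only if $X$ and $Y$ are Gorenstein-projective $\Lambda$-modules.
   Context: $\Delta_{(\phi,\phi)}$ denotes the following ring: $\phi:\Lambda\otimes_\Lambda\Lambda\to\Lambda$ is a $\Lambda$-$\Lambda$-bimodule homomorphism such that $\phi(m\otimes n)m'=m\phi(n\otimes m')$ for all $m,n,m'\in\Lambda$, and $\Delta_{(\phi,\phi)}$ is the set of $2\times2$ matrices over $\Lambda$ with componentwise addition and multiplication $\begin{pmatrix} a & n\\ m & b\end{pmatrix}\begin{pmatrix} a' & n'\\ m' & b'\end{pmatrix}=\begin{pmatrix} aa'+\phi(n\otimes m') & an'+nb'\\ ma'+bm' & bb'+\phi(m\otimes n')\end{pmatrix}$. Modules are finitely generated left modules. $\Delta_{(\phi,\phi)}$-modules are identified with tuples $(X,Y,f,g)$, where $X,Y$ are left $\Lambda$-modules and $f:\Lambda\otimes_\Lambda X\to Y$, $g:\Lambda\otimes_\Lambda Y\to X$ are $\Lambda$-linear maps with $g(n\otimes f(m\otimes x))=\phi(n\otimes m)x$ and $f(m\otimes g(n\otimes y))=\phi(m\otimes n)y$; the corresponding module is $X\oplus Y$ with $\begin{pmatrix} a & n\\ m & b\end{pmatrix}(x,y)=(ax+g(n\otimes y),by+f(m\otimes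 x))$. An Artin algebra $\Gamma$ is Gorenstein if $\Gamma$ has finite injective dimension both as a left and as a right $\Gamma$-module. An acyclic complex $P^\bullet$ of projective $\Gamma$-modules is totally acyclic if $\mathrm{Hom}_\Gamma(P^\bullet,\Gamma)$ is acyclic; a $\Gamma$-module is Gorenstein-projective if it is isomorphic to $\mathrm{Coker}(P^{-1}\to P^0)$ for some totally acyclic complex $P^\bullet$ of projective $\Gamma$-modules. *)

theory Defs
  imports "HOL-Algebra.Free_Abelian_Groups" "HOL-Algebra.Module" "HOL-Algebra.Ideal"
begin

section \<open>Modules over rings that need not be commutative\<close>

text \<open>
  The locale \<^locale>\<open>module\<close> of HOL-Algebra requires a commutative ring of scalars.  Its axioms are
  repeated here over an arbitrary ring; records of type \<open>('a, 'b) module\<close> and the locale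
  \<^locale>\<open>submodule\<close>, which does not mention commutativity, are reused.  As in HOL-Algebra, the
  multiplicative fields of a module record carry no meaning.
\<close>

locale left_module = R?: ring R + M?: abelian_group M
  for R :: "('a, 'e) ring_scheme" (structure) and M :: "('a, 'b, 'm) module_scheme" (structure) +
  assumes smult_closed [simp, intro]:
      "\<lbrakk>a \<in> carrier R; x \<in> carrier M\<rbrakk> \<Longrightarrow> a \<odot>\<^bsub>M\<^esub> x \<in> carrier M"
    and smult_l_distr:
      "\<lbrakk>a \<in> carrier R; b \<in> carrier R; x \<in> carrier M\<rbrakk> \<Longrightarrow>
        (a \<oplus> b) \<odot>\<^bsub>M\<^esub> x = a \<odot>\<^bsub>M\<^esub> x \<oplus>\<^bsub>M\<^esub> b \<odot>\<^bsub>M\<^esub> x"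
    and smult_r_distr:
      "\<lbrakk>a \<in> carrier R; x \<in> carrier M; y \<in> carrier M\<rbrakk> \<Longrightarrow>
        a \<odot>\<^bsub>M\<^esub> (x \<oplus>\<^bsub>M\<^esub> y) = a \<odot>\<^bsub>M\<^esub> x \<oplus>\<^bsub>M\<^esub> a \<odot>\<^bsub>M\<^esub> y"
    and smult_assoc1:
      "\<lbrakk>a \<in> carrier R; b \<in> carrier R; x \<in> carrier M\<rbrakk> \<Longrightarrow>
        (a \<otimes> b) \<odot>\<^bsub>M\<^esub> x = a \<odot>\<^bsub>M\<^esub> (b \<odot>\<^bsub>M\<^esub> x)"
    and smult_one [simp]: "x \<in> carrier M \<Longrightarrow> \<one> \<odot>\<^bsub>M\<^esub> x = x"

text \<open>A right \<open>R\<close>-module is a left module over \<open>opposite_ring R\<close>, so its action \<open>x \<cdot> r\<close> is the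
  record field \<open>r \<odot> x\<close>.\<close>

definition opposite_ring :: "('a, 'e) ring_scheme \<Rightarrow> 'a ring" where
  "opposite_ring R =
     \<lparr>carrier = carrier R, mult = (\<lambda>x y. y \<otimes>\<^bsub>R\<^esub> x), one = \<one>\<^bsub>R\<^esub>, zero = \<zero>\<^bsub>R\<^esub>, add = add R\<rparr>"

definition regular_module :: "('a, 'e) ring_scheme \<Rightarrow> ('a, 'a) module" where
  "regular_module R =
     \<lparr>carrier = carrier R, mult = mult R, one = \<one>\<^bsub>R\<^esub>, zero = \<zero>\<^bsub>R\<^esub>, add = add R, smult = mult R\<rparr>"

abbreviation right_regular_module :: "('a, 'e) ring_scheme \<Rightarrow> ('a, 'a) module" where
  "right_regular_module R \<equiv> regular_module (opposite_ring R)"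

definition finitely_generated ::
    "('a, 'e) ring_scheme \<Rightarrow> ('a, 'b, 'm) module_scheme \<Rightarrow> bool" where
  "finitely_generated R M \<longleftrightarrow>
     (\<exists>A. finite A \<and> A \<subseteq> carrier M \<and> (\<forall>N. submodule N R M \<and> A \<subseteq> N \<longrightarrow> N = carrier M))"

definition fg_module :: "('a, 'e) ring_scheme \<Rightarrow> ('a, 'b, 'm) module_scheme \<Rightarrow> bool" where
  "fg_module R M \<longleftrightarrow> left_module R M \<and> finitely_generated R M"

definition linear_maps ::
    "('a, 'e) ring_scheme \<Rightarrow> ('a, 'b, 'm) module_scheme \<Rightarrow> ('a, 'c, 'n) module_scheme \<Rightarrow> ('b \<Rightarrow> 'c) set"
  where
  "linear_maps R M N = {h \<in> carrier M \<rightarrow> carrier N.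
     (\<forall>x\<in>carrier M. \<forall>y\<in>carrier M. h (x \<oplus>\<^bsub>M\<^esub> y) = h x \<oplus>\<^bsub>N\<^esub> h y) \<and>
     (\<forall>r\<in>carrier R. \<forall>x\<in>carrier M. h (r \<odot>\<^bsub>M\<^esub> x) = r \<odot>\<^bsub>N\<^esub> h x)}"

text \<open>Members of \<^term>\<open>linear_maps R M N\<close> are unconstrained outside \<^term>\<open>carrier M\<close>; the group
  \<open>Hom\<close> consists of the extensional ones, so that equality in it is equality of homomorphisms.\<close>

definition Hom ::
    "('a, 'e) ring_scheme \<Rightarrow> ('a, 'b, 'm) module_scheme \<Rightarrow> ('a, 'c, 'n) module_scheme \<Rightarrow> ('b \<Rightarrow> 'c) set"
  where
  "Hom R M N = linear_maps R M N \<inter> extensional (carrier M)"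

definition module_iso ::
    "('a, 'e) ring_scheme \<Rightarrow> ('a, 'b, 'm) module_scheme \<Rightarrow> ('a, 'c, 'n) module_scheme \<Rightarrow> bool" where
  "module_iso R M N \<longleftrightarrow> (\<exists>h\<in>linear_maps R M N. bij_betw h (carrier M) (carrier N))"

definition map_kernel ::
    "('a, 'b, 'm) module_scheme \<Rightarrow> ('a, 'c, 'n) module_scheme \<Rightarrow> ('b \<Rightarrow> 'c) \<Rightarrow> 'b set" where
  "map_kernel M N h = {x \<in> carrier M. h x = \<zero>\<^bsub>N\<^esub>}"

definition quotient_module :: "('a, 'b, 'm) module_scheme \<Rightarrow> 'b set \<Rightarrow> ('a, 'b set) module" where
  "quotient_module M N =
     \<lparr>carrier = a_rcosets\<^bsub>M\<^esub> N, mult = undefined, one = undefined,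
      zero = N, add = set_add M,
      smult = (\<lambda>r C. \<Union>x\<in>C. N +>\<^bsub>M\<^esub> (r \<odot>\<^bsub>M\<^esub> x))\<rparr>"

definition cokernel ::
    "('a, 'b, 'm) module_scheme \<Rightarrow> ('a, 'c, 'n) module_scheme \<Rightarrow> ('b \<Rightarrow> 'c) \<Rightarrow> ('a, 'c set) module" where
  "cokernel M N h = quotient_module N (h ` carrier M)"


section \<open>Finitely generated modules up to isomorphism\<close>

lemma (in left_module) smult_r_null [simp]: "r \<in> carrier R \<Longrightarrow> r \<odot>\<^bsub>M\<^esub> \<zero>\<^bsub>M\<^esub> = \<zero>\<^bsub>M\<^esub>"
  using smult_r_distr[of r "\<zero>\<^bsub>M\<^esub>" "\<zero>\<^bsub>M\<^esub>"] smult_closed[of r "\<zero>\<^bsub>M\<^esub>"]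
  by (metis M.add.r_cancel_one' M.zero_closed M.l_zero)

lemma (in left_module) smult_l_null [simp]: "x \<in> carrier M \<Longrightarrow> \<zero> \<odot>\<^bsub>M\<^esub> x = \<zero>\<^bsub>M\<^esub>"
  using smult_l_distr[of \<zero> \<zero> x] smult_closed[of \<zero> x]
  by (metis M.add.r_cancel_one' R.zero_closed R.l_zero)

lemma (in left_module) smult_minus_one: "x \<in> carrier M \<Longrightarrow> (\<ominus> \<one>) \<odot>\<^bsub>M\<^esub> x = \<ominus>\<^bsub>M\<^esub> x"
  using smult_l_distr[of "\<ominus> \<one>" \<one> x] smult_closed[of "\<ominus> \<one>" x]
  by (metis M.minus_equality R.a_inv_closed R.l_neg R.one_closed smult_l_null smult_one)

lemma (in left_module) submodule_closureI:
  assumes "N \<subseteq> carrier M" "\<zero>\<^bsub>M\<^esub> \<in> N"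
    and "\<And>x y. x \<in> N \<Longrightarrow> y \<in> N \<Longrightarrow> x \<oplus>\<^bsub>M\<^esub> y \<in> N"
    and "\<And>r x. r \<in> carrier R \<Longrightarrow> x \<in> N \<Longrightarrow> r \<odot>\<^bsub>M\<^esub> x \<in> N"
  shows "submodule N R M"
proof -
  have inv: "inv\<^bsub>add_monoid M\<^esub> x \<in> N" if "x \<in> N" for x
    using assms(4)[of "\<ominus> \<one>" x] that assms(1) smult_minus_one[of x]
    by (auto simp: a_inv_def)
  show ?thesis
    by (intro submodule.intro subgroup.intro submodule_axioms.intro) (use assms inv in auto)
qed

lemma left_module_transport:
  assumes M: "left_module R M" and inj: "inj_on t (carrier M)"
  defines "s \<equiv> inv_into (carrier M) t"
  defines "N \<equiv> \<lparr>carrier = t ` carrier M, mult = undefined, one = undefined,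
      zero = t \<zero>\<^bsub>M\<^esub>, add = (\<lambda>x y. t (s x \<oplus>\<^bsub>M\<^esub> s y)), smult = (\<lambda>r x. t (r \<odot>\<^bsub>M\<^esub> s x))\<rparr>"
  shows "left_module R N" and "t \<in> linear_maps R M N" and "bij_betw t (carrier M) (carrier N)"
proof -
  interpret left_module R M by fact
  have s [simp]: "s (t x) = x" if "x \<in> carrier M" for x
    using that inj by (simp add: s_def)
  have ab: "abelian_group N"
    by (rule abelian_groupI)
       (auto simp: N_def M.a_ac M.r_neg intro!: bexI[of _ "\<ominus>\<^bsub>M\<^esub> _"])
  show "left_module R N"
    by (intro left_module.intro left_module_axioms.intro ab R.ring_axioms)
       (auto simp: N_def smult_l_distr smult_r_distr smult_assoc1)
  show "t \<in> linear_maps R M N" by (auto simp: linear_maps_def N_def)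
  show "bij_betw t (carrier M) (carrier N)" using inj by (simp add: bij_betw_def N_def)
qed

lemma finitely_generated_image:
  assumes M: "left_module R M" and N: "left_module R N" and h: "h \<in> linear_maps R M N"
    and surj: "h ` carrier M = carrier N" and fg: "finitely_generated R M"
  shows "finitely_generated R N"
proof -
  interpret M: left_module R M by fact
  interpret N: left_module R N by fact
  have hc: "h x \<in> carrier N" if "x \<in> carrier M" for x using h that by (auto simp: linear_maps_def)
  have ha: "h (x \<oplus>\<^bsub>M\<^esub> y) = h x \<oplus>\<^bsub>N\<^esub> h y" if "x \<in> carrier M" "y \<in> carrier M" for x y
    using h that by (auto simp: linear_maps_def)
  have hs: "h (r \<odot>\<^bsub>M\<^esub> x) = r \<odot>\<^bsub>N\<^esub> h x" if "r \<in> carrier R" "x \<in> carrier M" for r x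
    using h that by (auto simp: linear_maps_def)
  have h0: "h \<zero>\<^bsub>M\<^esub> = \<zero>\<^bsub>N\<^esub>"
    by (metis hs M.zero_closed M.R.zero_closed M.smult_l_null N.smult_l_null hc)
  obtain A where A: "finite A" "A \<subseteq> carrier M"
    and gen: "\<And>L. submodule L R M \<Longrightarrow> A \<subseteq> L \<Longrightarrow> L = carrier M"
    using fg by (auto simp: finitely_generated_def)
  have "L = carrier N" if L: "submodule L R N" "h ` A \<subseteq> L" for L
  proof -
    interpret L: submodule L R N by fact
    have "submodule {x \<in> carrier M. h x \<in> L} R M"
      by (rule M.submodule_closureI)
         (use L.one_closed L.m_closed L.smult_closed in \<open>auto simp: h0 ha hs\<close>)
    from gen[OF this] L A have "{x \<in> carrier M. h x \<in> L} = carrier M" by auto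
    then have "h ` carrier M \<subseteq> L" by blast
    then show ?thesis using surj L.subset by simp
  qed
  then show ?thesis
    unfolding finitely_generated_def
    by (intro exI[of _ "h ` A"]) (use A hc in auto)
qed

lemma (in left_module) fg_combinations:
  assumes "finitely_generated R M"
  obtains n and x :: "nat \<Rightarrow> 'b" where "x \<in> {..<n} \<rightarrow> carrier M"
    and "\<And>y. y \<in> carrier M \<Longrightarrow>
      \<exists>c\<in>{..<n} \<rightarrow>\<^sub>E carrier R. y = (\<Oplus>\<^bsub>M\<^esub>i\<in>{..<n}. c i \<odot>\<^bsub>M\<^esub> x i)"
proof -
  obtain A where A: "finite A" "A \<subseteq> carrier M"
    and gen: "\<And>L. submodule L R M \<Longrightarrow> A \<subseteq> L \<Longrightarrow> L = carrier M"
    using assms by (auto simp: finitely_generated_def)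
  obtain x where x: "bij_betw x {..<card A} A"
    using A(1) bij_betw_from_nat_into_finite by blast
  define n where "n = card A"
  define comb where "comb c = (\<Oplus>\<^bsub>M\<^esub>i\<in>{..<n}. c i \<odot>\<^bsub>M\<^esub> x i)" for c
  have xc: "x i \<in> carrier M" if "i < n" for i
    using x A(2) that by (auto simp: bij_betw_def n_def)
  have res: "comb (restrict c {..<n}) = comb c" if "c \<in> {..<n} \<rightarrow> carrier R" for c
    unfolding comb_def by (rule M.finsum_cong') (use that xc in auto)
  define L where "L = comb ` ({..<n} \<rightarrow> carrier R)"
  have "submodule L R M"
  proof (rule submodule_closureI)
    show "L \<subseteq> carrier M" by (auto simp: L_def comb_def xc intro!: M.finsum_closed)
    have "comb (\<lambda>_. \<zero>) = \<zero>\<^bsub>M\<^esub>"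
      unfolding comb_def by (intro M.add.finprod_one_eqI) (auto simp: xc)
    then show "\<zero>\<^bsub>M\<^esub> \<in> L" unfolding L_def by (intro image_eqI[of _ _ "\<lambda>_. \<zero>"]) auto
  next
    fix a b assume "a \<in> L" "b \<in> L"
    then obtain c d where c: "c \<in> {..<n} \<rightarrow> carrier R" "a = comb c"
      and d: "d \<in> {..<n} \<rightarrow> carrier R" "b = comb d" by (auto simp: L_def)
    have "comb (\<lambda>i. c i \<oplus> d i) = (\<Oplus>\<^bsub>M\<^esub>i\<in>{..<n}. c i \<odot>\<^bsub>M\<^esub> x i \<oplus>\<^bsub>M\<^esub> d i \<odot>\<^bsub>M\<^esub> x i)"
      unfolding comb_def
      by (rule M.finsum_cong') (use c d xc in \<open>auto simp: smult_l_distr Pi_def\<close>)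
    also have "\<dots> = a \<oplus>\<^bsub>M\<^esub> b"
      unfolding c d comb_def by (rule M.finsum_addf) (use c d xc in auto)
    finally show "a \<oplus>\<^bsub>M\<^esub> b \<in> L"
      unfolding L_def by (intro image_eqI[of _ _ "\<lambda>i. c i \<oplus> d i"]) (use c d in auto)
  next
    fix r a assume r: "r \<in> carrier R" and "a \<in> L"
    then obtain c where c: "c \<in> {..<n} \<rightarrow> carrier R" "a = comb c" by (auto simp: L_def)
    have dist: "r \<odot>\<^bsub>M\<^esub> (\<Oplus>\<^bsub>M\<^esub>i\<in>I. u i) = (\<Oplus>\<^bsub>M\<^esub>i\<in>I. r \<odot>\<^bsub>M\<^esub> u i)"
      if "finite I" "u \<in> I \<rightarrow> carrier M" for I :: "nat set" and u
      using that by (induction I rule: finite_induct) (use r in \<open>auto simp: smult_r_distr Pi_def\<close>)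
    have "r \<odot>\<^bsub>M\<^esub> a = (\<Oplus>\<^bsub>M\<^esub>i\<in>{..<n}. r \<odot>\<^bsub>M\<^esub> (c i \<odot>\<^bsub>M\<^esub> x i))"
      unfolding c comb_def by (rule dist) (use c xc in auto)
    also have "\<dots> = comb (\<lambda>i. r \<otimes> c i)"
      unfolding comb_def
      by (rule M.finsum_cong') (use c xc r in \<open>auto simp: smult_assoc1 Pi_def\<close>)
    finally show "r \<odot>\<^bsub>M\<^esub> a \<in> L"
      unfolding L_def by (intro image_eqI[of _ _ "\<lambda>i. r \<otimes> c i"]) (use c r in auto)
  qed
  moreover have "A \<subseteq> L"
  proof
    fix a assume "a \<in> A"
    then obtain j where j: "j < n" "a = x j" using x by (auto simp: bij_betw_def n_def)
    have "comb (\<lambda>i. if i = j then \<one> else \<zero>) = (\<Oplus>\<^bsub>M\<^esub>i\<in>{..<n}. if j = i then x i else \<zero>\<^bsub>M\<^esub>)"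
      unfolding comb_def by (rule M.finsum_cong') (auto simp: xc)
    also have "\<dots> = a"
      using M.finsum_singleton[of j "{..<n}" x] j xc by auto
    finally show "a \<in> L"
      unfolding L_def by (intro image_eqI[of _ _ "\<lambda>i. if i = j then \<one> else \<zero>"]) auto
  qed
  ultimately have L: "L = carrier M" by (rule gen)
  show ?thesis
  proof
    show "x \<in> {..<n} \<rightarrow> carrier M" using xc by auto
    fix y assume "y \<in> carrier M"
    then obtain c where c: "c \<in> {..<n} \<rightarrow> carrier R" "y = comb c" using L by (auto simp: L_def)
    then show "\<exists>c\<in>{..<n} \<rightarrow>\<^sub>E carrier R. y = (\<Oplus>\<^bsub>M\<^esub>i\<in>{..<n}. c i \<odot>\<^bsub>M\<^esub> x i)"
      using res[of c] by (intro bexI[of _ "restrict c {..<n}"]) (auto simp: comb_def)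
  qed
qed

text \<open>Every finitely generated \<open>R\<close>-module, whatever the type of its elements, is isomorphic to one
  whose elements are sets of coefficient tuples, namely to a quotient of a power of \<open>R\<close>.\<close>

lemma fg_module_small:
  fixes M :: "('a, 'b, 'm) module_scheme"
  assumes "fg_module R M"
  shows "\<exists>N :: ('a, (nat \<Rightarrow> 'a) set) module. fg_module R N \<and> module_iso R M N"
proof -
  interpret left_module R M using assms by (simp add: fg_module_def)
  obtain n and x :: "nat \<Rightarrow> 'b" where x: "x \<in> {..<n} \<rightarrow> carrier M"
    and gen: "\<And>y. y \<in> carrier M \<Longrightarrow>
      \<exists>c\<in>{..<n} \<rightarrow>\<^sub>E carrier R. y = (\<Oplus>\<^bsub>M\<^esub>i\<in>{..<n}. c i \<odot>\<^bsub>M\<^esub> x i)"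
    using assms unfolding fg_module_def by (elim conjE fg_combinations) blast
  define t where
    "t y = {c \<in> {..<n} \<rightarrow>\<^sub>E carrier R. y = (\<Oplus>\<^bsub>M\<^esub>i\<in>{..<n}. c i \<odot>\<^bsub>M\<^esub> x i)}" for y
  have "inj_on t (carrier M)"
  proof (rule inj_onI)
    fix y z assume "y \<in> carrier M" "t y = t z"
    with gen[of y] show "y = z" by (auto simp: t_def)
  qed
  from left_module_transport[OF left_module_axioms this] obtain N :: "('a, (nat \<Rightarrow> 'a) set) module"
    where N: "left_module R N" "t \<in> linear_maps R M N" "bij_betw t (carrier M) (carrier N)"
    by blast
  with assms finitely_generated_image[of R M N t] show ?thesis
    unfolding fg_module_def module_iso_def by (intro exI[of _ N]) (auto simp: bij_betw_def)
qed


section \<open>Tensor products\<close>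

text \<open>
  For a right \<open>R\<close>-module \<open>M\<close> and a left \<open>R\<close>-module \<open>N\<close>, the group \<open>M \<otimes>\<^sub>R N\<close> is the free abelian group
  on \<open>M \<times> N\<close> modulo the subgroup generated by the usual relations.
\<close>

definition tensor_relations ::
    "('a, 'e) ring_scheme \<Rightarrow> ('a, 'b, 'm) module_scheme \<Rightarrow> ('a, 'c, 'n) module_scheme
      \<Rightarrow> ('b \<times> 'c \<Rightarrow>\<^sub>0 int) set" where
  "tensor_relations R M N =
     {frag_of (x \<oplus>\<^bsub>M\<^esub> x', y) - frag_of (x, y) - frag_of (x', y) | x x' y.
        x \<in> carrier M \<and> x' \<in> carrier M \<and> y \<in> carrier N} \<union>
     {frag_of (x, y \<oplus>\<^bsub>N\<^esub> y') - frag_of (x, y) - frag_of (x, y') | x y y'.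
        x \<in> carrier M \<and> y \<in> carrier N \<and> y' \<in> carrier N} \<union>
     {frag_of (r \<odot>\<^bsub>M\<^esub> x, y) - frag_of (x, r \<odot>\<^bsub>N\<^esub> y) | r x y.
        r \<in> carrier R \<and> x \<in> carrier M \<and> y \<in> carrier N}"

definition tensor_null ::
    "('a, 'e) ring_scheme \<Rightarrow> ('a, 'b, 'm) module_scheme \<Rightarrow> ('a, 'c, 'n) module_scheme
      \<Rightarrow> ('b \<times> 'c \<Rightarrow>\<^sub>0 int) set" where
  "tensor_null R M N =
     generate (free_Abelian_group (carrier M \<times> carrier N)) (tensor_relations R M N)"

definition tensor_class ::
    "('a, 'e) ring_scheme \<Rightarrow> ('a, 'b, 'm) module_scheme \<Rightarrow> ('a, 'c, 'n) module_scheme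
      \<Rightarrow> ('b \<times> 'c \<Rightarrow>\<^sub>0 int) \<Rightarrow> ('b \<times> 'c \<Rightarrow>\<^sub>0 int) set" where
  "tensor_class R M N u =
     tensor_null R M N #>\<^bsub>free_Abelian_group (carrier M \<times> carrier N)\<^esub> u"

definition tensor_group ::
    "('a, 'e) ring_scheme \<Rightarrow> ('a, 'b, 'm) module_scheme \<Rightarrow> ('a, 'c, 'n) module_scheme
      \<Rightarrow> ('b \<times> 'c \<Rightarrow>\<^sub>0 int) set monoid" where
  "tensor_group R M N = free_Abelian_group (carrier M \<times> carrier N) Mod tensor_null R M N"

definition tensor ::
    "('a, 'e) ring_scheme \<Rightarrow> ('a, 'b, 'm) module_scheme \<Rightarrow> ('a, 'c, 'n) module_scheme
      \<Rightarrow> 'b \<Rightarrow> 'c \<Rightarrow> ('b \<times> 'c \<Rightarrow>\<^sub>0 int) set" where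
  "tensor R M N x y = tensor_class R M N (frag_of (x, y))"

text \<open>The endomorphism \<open>u \<otimes> v\<close> of \<open>M \<otimes>\<^sub>R N\<close> induced by endomorphisms \<open>u\<close> of \<open>M\<close> and \<open>v\<close> of \<open>N\<close>.
  The classes in the union coincide.\<close>

definition tensor_endo ::
    "('a, 'e) ring_scheme \<Rightarrow> ('a, 'b, 'm) module_scheme \<Rightarrow> ('a, 'c, 'n) module_scheme
      \<Rightarrow> ('b \<Rightarrow> 'b) \<Rightarrow> ('c \<Rightarrow> 'c) \<Rightarrow> ('b \<times> 'c \<Rightarrow>\<^sub>0 int) set \<Rightarrow> ('b \<times> 'c \<Rightarrow>\<^sub>0 int) set" where
  "tensor_endo R M N u v C =
     (\<Union>w\<in>C. tensor_class R M N (frag_extend (\<lambda>(x, y). frag_of (u x, v y)) w))"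

definition tensor_module ::
    "('a, 'e) ring_scheme \<Rightarrow> ('a, 'b, 'm) module_scheme \<Rightarrow> ('a, 'c, 'n) module_scheme
      \<Rightarrow> ('s \<Rightarrow> ('b \<times> 'c \<Rightarrow>\<^sub>0 int) set \<Rightarrow> ('b \<times> 'c \<Rightarrow>\<^sub>0 int) set)
      \<Rightarrow> ('s, ('b \<times> 'c \<Rightarrow>\<^sub>0 int) set) module" where
  "tensor_module R M N act =
     \<lparr>carrier = carrier (tensor_group R M N), mult = undefined, one = undefined,
      zero = one (tensor_group R M N), add = mult (tensor_group R M N), smult = act\<rparr>"

text \<open>\<open>R \<otimes>\<^sub>R N\<close> as a left \<open>R\<close>-module, \<open>r (s \<otimes> y) = (r s) \<otimes> y\<close>, and \<open>R \<otimes>\<^sub>R R\<close> as a right \<open>R\<close>-module,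
  \<open>(s \<otimes> t) r = s \<otimes> (t r)\<close>.\<close>

definition regular_tensor ::
    "('a, 'e) ring_scheme \<Rightarrow> ('a, 'c, 'n) module_scheme \<Rightarrow> ('a, ('a \<times> 'c \<Rightarrow>\<^sub>0 int) set) module" where
  "regular_tensor R N =
     tensor_module R (right_regular_module R) N
       (\<lambda>r. tensor_endo R (right_regular_module R) N (\<lambda>s. r \<otimes>\<^bsub>R\<^esub> s) (\<lambda>y. y))"

definition regular_tensor_right ::
    "('a, 'e) ring_scheme \<Rightarrow> ('a, ('a \<times> 'a \<Rightarrow>\<^sub>0 int) set) module" where
  "regular_tensor_right R =
     tensor_module R (right_regular_module R) (regular_module R)
       (\<lambda>r. tensor_endo R (right_regular_module R) (regular_module R) (\<lambda>s. s) (\<lambda>t. t \<otimes>\<^bsub>R\<^esub> r))"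

abbreviation rtensor ::
    "('a, 'e) ring_scheme \<Rightarrow> ('a, 'c, 'n) module_scheme \<Rightarrow> 'a \<Rightarrow> 'c \<Rightarrow> ('a \<times> 'c \<Rightarrow>\<^sub>0 int) set" where
  "rtensor R N s y \<equiv> tensor R (right_regular_module R) N s y"


section \<open>Homological notions\<close>

text \<open>
  All modules are finitely generated.  HOL cannot quantify over types inside a formula, so
  quantification over modules ranges over records whose elements have type \<open>(nat \<Rightarrow> 'a) set\<close>, where
  \<open>'a\<close> is the type of scalars.  By \<open>fg_module_small\<close> this loses nothing: up to isomorphism these are
  all finitely generated modules.  Projectivity and injectivity are the lifting and extension
  properties in the category of finitely generated modules; for finitely generated modules over an
  Artin algebra they agree with those in the category of all modules (free covers, Baer's criterion).
\<close>

type_synonym 'a small_module = "('a, (nat \<Rightarrow> 'a) set) module"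

definition projective_module :: "('a, 'e) ring_scheme \<Rightarrow> ('a, 'b, 'm) module_scheme \<Rightarrow> bool" where
  "projective_module R P \<longleftrightarrow> fg_module R P \<and>
     (\<forall>(A :: 'a small_module) (B :: 'a small_module) p h.
        fg_module R A \<and> fg_module R B \<and>
        p \<in> linear_maps R A B \<and> p ` carrier A = carrier B \<and> h \<in> linear_maps R P B \<longrightarrow>
        (\<exists>k\<in>linear_maps R P A. \<forall>x\<in>carrier P. p (k x) = h x))"

definition injective_module :: "('a, 'e) ring_scheme \<Rightarrow> ('a, 'b, 'm) module_scheme \<Rightarrow> bool" where
  "injective_module R I \<longleftrightarrow> fg_module R I \<and>
     (\<forall>(A :: 'a small_module) (B :: 'a small_module) i h.
        fg_module R A \<and> fg_module R B \<and>
        i \<in> linear_maps R A B \<and> inj_on i (carrier A) \<and> h \<in> linear_maps R A I \<longrightarrow>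
        (\<exists>k\<in>linear_maps R B I. \<forall>x\<in>carrier A. k (i x) = h x))"

text \<open>An exact sequence \<open>0 \<rightarrow> M \<rightarrow> I\<^sup>0 \<rightarrow> \<dots> \<rightarrow> I\<^sup>n \<rightarrow> 0\<close> with injective terms, extended by zero modules.\<close>

definition finite_injective_dimension ::
    "('a, 'e) ring_scheme \<Rightarrow> ('a, 'b, 'm) module_scheme \<Rightarrow> bool" where
  "finite_injective_dimension R M \<longleftrightarrow>
     (\<exists>n (I :: nat \<Rightarrow> 'a small_module) \<epsilon> d.
        (\<forall>j. injective_module R (I j)) \<and>
        (\<forall>j>n. carrier (I j) = {\<zero>\<^bsub>I j\<^esub>}) \<and>
        \<epsilon> \<in> linear_maps R M (I 0) \<and> inj_on \<epsilon> (carrier M) \<and>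
        (\<forall>j. d j \<in> linear_maps R (I j) (I (Suc j))) \<and>
        \<epsilon> ` carrier M = map_kernel (I 0) (I 1) (d 0) \<and>
        (\<forall>j. d j ` carrier (I j) = map_kernel (I (Suc j)) (I (Suc (Suc j))) (d (Suc j))))"

definition acyclic_complex ::
    "('a, 'e) ring_scheme \<Rightarrow> (int \<Rightarrow> ('a, 'b) module) \<Rightarrow> (int \<Rightarrow> 'b \<Rightarrow> 'b) \<Rightarrow> bool" where
  "acyclic_complex R P d \<longleftrightarrow>
     (\<forall>i. d i \<in> linear_maps R (P i) (P (i + 1))) \<and>
     (\<forall>i. d i ` carrier (P i) = map_kernel (P (i + 1)) (P (i + 2)) (d (i + 1)))"

definition hom_pullback ::
    "('a, 'b, 'm) module_scheme \<Rightarrow> ('b \<Rightarrow> 'c) \<Rightarrow> ('c \<Rightarrow> 'd) \<Rightarrow> 'b \<Rightarrow> 'd" where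
  "hom_pullback M d h = compose (carrier M) h d"

text \<open>Exactness of \<open>Hom(P\<^sup>i\<^sup>+\<^sup>1, R) \<rightarrow> Hom(P\<^sup>i, R) \<rightarrow> Hom(P\<^sup>i\<^sup>-\<^sup>1, R)\<close> at the middle term, for every \<open>i\<close>.\<close>

definition acyclic_dual ::
    "('a, 'e) ring_scheme \<Rightarrow> (int \<Rightarrow> ('a, 'b) module) \<Rightarrow> (int \<Rightarrow> 'b \<Rightarrow> 'b) \<Rightarrow> bool" where
  "acyclic_dual R P d \<longleftrightarrow>
     (\<forall>i. hom_pullback (P i) (d i) ` Hom R (P (i + 1)) (regular_module R) =
          {h \<in> Hom R (P i) (regular_module R).
             hom_pullback (P (i - 1)) (d (i - 1)) h = (\<lambda>x\<in>carrier (P (i - 1)). \<zero>\<^bsub>R\<^esub>)})"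

definition totally_acyclic ::
    "('a, 'e) ring_scheme \<Rightarrow> (int \<Rightarrow> ('a, 'b) module) \<Rightarrow> (int \<Rightarrow> 'b \<Rightarrow> 'b) \<Rightarrow> bool" where
  "totally_acyclic R P d \<longleftrightarrow>
     (\<forall>i. projective_module R (P i)) \<and> acyclic_complex R P d \<and> acyclic_dual R P d"

definition gorenstein_projective ::
    "('a, 'e) ring_scheme \<Rightarrow> ('a, 'b, 'm) module_scheme \<Rightarrow> bool" where
  "gorenstein_projective R M \<longleftrightarrow> fg_module R M \<and>
     (\<exists>(P :: int \<Rightarrow> 'a small_module) d.
        totally_acyclic R P d \<and> module_iso R M (cokernel (P (-1)) (P 0) (d (-1))))"


section \<open>Gorenstein Artin algebras\<close>

definition artinian_cring :: "('k, 'e) ring_scheme \<Rightarrow> bool" where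
  "artinian_cring K \<longleftrightarrow> cring K \<and>
     (\<forall>I :: nat \<Rightarrow> 'k set. (\<forall>n. ideal (I n) K \<and> I (Suc n) \<subseteq> I n) \<longrightarrow>
        (\<exists>N. \<forall>n\<ge>N. I n = I N))"

text \<open>The locale \<^locale>\<open>algebra\<close> of HOL-Algebra covers commutative algebras only.\<close>

definition artin_algebra :: "('k, 'e) ring_scheme \<Rightarrow> ('k, 'a, 'm) module_scheme \<Rightarrow> bool" where
  "artin_algebra K \<Lambda> \<longleftrightarrow> artinian_cring K \<and> ring \<Lambda> \<and> module K \<Lambda> \<and>
     (\<forall>c\<in>carrier K. \<forall>x\<in>carrier \<Lambda>. \<forall>y\<in>carrier \<Lambda>.
        (c \<odot>\<^bsub>\<Lambda>\<^esub> x) \<otimes>\<^bsub>\<Lambda>\<^esub> y = c \<odot>\<^bsub>\<Lambda>\<^esub> (x \<otimes>\<^bsub>\<Lambda>\<^esub> y) \<and>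
        x \<otimes>\<^bsub>\<Lambda>\<^esub> (c \<odot>\<^bsub>\<Lambda>\<^esub> y) = c \<odot>\<^bsub>\<Lambda>\<^esub> (x \<otimes>\<^bsub>\<Lambda>\<^esub> y)) \<and>
     finitely_generated K \<Lambda>"

definition gorenstein_ring :: "('a, 'e) ring_scheme \<Rightarrow> bool" where
  "gorenstein_ring R \<longleftrightarrow>
     finite_injective_dimension R (regular_module R) \<and>
     finite_injective_dimension (opposite_ring R) (right_regular_module R)"


section \<open>The Morita ring with all entries equal to the base ring, and its modules\<close>

definition bimodule_maps ::
    "('a, 'e) ring_scheme \<Rightarrow> (('a \<times> 'a \<Rightarrow>\<^sub>0 int) set \<Rightarrow> 'a) set" where
  "bimodule_maps R =
     linear_maps R (regular_tensor R (regular_module R)) (regular_module R) \<inter>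
     linear_maps (opposite_ring R) (regular_tensor_right R) (right_regular_module R)"

definition morita_datum ::
    "('a, 'e) ring_scheme \<Rightarrow> (('a \<times> 'a \<Rightarrow>\<^sub>0 int) set \<Rightarrow> 'a) \<Rightarrow> bool" where
  "morita_datum R \<phi> \<longleftrightarrow> \<phi> \<in> bimodule_maps R \<and>
     (\<forall>m\<in>carrier R. \<forall>n\<in>carrier R. \<forall>m'\<in>carrier R.
        \<phi> (rtensor R (regular_module R) m n) \<otimes>\<^bsub>R\<^esub> m' =
        m \<otimes>\<^bsub>R\<^esub> \<phi> (rtensor R (regular_module R) n m'))"

datatype 'a matrix2 = Matrix2 'a 'a 'a 'a

text \<open>\<open>Matrix2 a n m b\<close> has first row \<open>a, n\<close> and second row \<open>m, b\<close>.\<close>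

definition morita_ring ::
    "('a, 'e) ring_scheme \<Rightarrow> (('a \<times> 'a \<Rightarrow>\<^sub>0 int) set \<Rightarrow> 'a) \<Rightarrow> 'a matrix2 ring" where
  "morita_ring R \<phi> =
     \<lparr>carrier = {Matrix2 a n m b | a n m b.
        a \<in> carrier R \<and> n \<in> carrier R \<and> m \<in> carrier R \<and> b \<in> carrier R},
      mult = (\<lambda>A A'. case A of Matrix2 a n m b \<Rightarrow> case A' of Matrix2 a' n' m' b' \<Rightarrow>
        Matrix2 (a \<otimes>\<^bsub>R\<^esub> a' \<oplus>\<^bsub>R\<^esub> \<phi> (rtensor R (regular_module R) n m'))
                (a \<otimes>\<^bsub>R\<^esub> n' \<oplus>\<^bsub>R\<^esub> n \<otimes>\<^bsub>R\<^esub> b')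
                (m \<otimes>\<^bsub>R\<^esub> a' \<oplus>\<^bsub>R\<^esub> b \<otimes>\<^bsub>R\<^esub> m')
                (b \<otimes>\<^bsub>R\<^esub> b' \<oplus>\<^bsub>R\<^esub> \<phi> (rtensor R (regular_module R) m n'))),
      one = Matrix2 \<one>\<^bsub>R\<^esub> \<zero>\<^bsub>R\<^esub> \<zero>\<^bsub>R\<^esub> \<one>\<^bsub>R\<^esub>,
      zero = Matrix2 \<zero>\<^bsub>R\<^esub> \<zero>\<^bsub>R\<^esub> \<zero>\<^bsub>R\<^esub> \<zero>\<^bsub>R\<^esub>,
      add = (\<lambda>A A'. case A of Matrix2 a n m b \<Rightarrow> case A' of Matrix2 a' n' m' b' \<Rightarrow>
        Matrix2 (a \<oplus>\<^bsub>R\<^esub> a') (n \<oplus>\<^bsub>R\<^esub> n') (m \<oplus>\<^bsub>R\<^esub> m') (b \<oplus>\<^bsub>R\<^esub> b'))\<rparr>"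

definition morita_tuple ::
    "('a, 'e) ring_scheme \<Rightarrow> (('a \<times> 'a \<Rightarrow>\<^sub>0 int) set \<Rightarrow> 'a)
      \<Rightarrow> ('a, 'x, 'm) module_scheme \<Rightarrow> ('a, 'y, 'n) module_scheme
      \<Rightarrow> (('a \<times> 'x \<Rightarrow>\<^sub>0 int) set \<Rightarrow> 'y) \<Rightarrow> (('a \<times> 'y \<Rightarrow>\<^sub>0 int) set \<Rightarrow> 'x) \<Rightarrow> bool" where
  "morita_tuple R \<phi> X Y f g \<longleftrightarrow>
     fg_module R X \<and> fg_module R Y \<and>
     f \<in> linear_maps R (regular_tensor R X) Y \<and>
     g \<in> linear_maps R (regular_tensor R Y) X \<and>
     (\<forall>n\<in>carrier R. \<forall>m\<in>carrier R. \<forall>x\<in>carrier X.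
        g (rtensor R Y n (f (rtensor R X m x))) =
        \<phi> (rtensor R (regular_module R) n m) \<odot>\<^bsub>X\<^esub> x) \<and>
     (\<forall>m\<in>carrier R. \<forall>n\<in>carrier R. \<forall>y\<in>carrier Y.
        f (rtensor R X m (g (rtensor R Y n y))) =
        \<phi> (rtensor R (regular_module R) m n) \<odot>\<^bsub>Y\<^esub> y)"

definition morita_module ::
    "('a, 'e) ring_scheme \<Rightarrow> ('a, 'x, 'm) module_scheme \<Rightarrow> ('a, 'y, 'n) module_scheme
      \<Rightarrow> (('a \<times> 'x \<Rightarrow>\<^sub>0 int) set \<Rightarrow> 'y) \<Rightarrow> (('a \<times> 'y \<Rightarrow>\<^sub>0 int) set \<Rightarrow> 'x)
      \<Rightarrow> ('a matrix2, 'x \<times> 'y) module" where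
  "morita_module R X Y f g =
     \<lparr>carrier = carrier X \<times> carrier Y, mult = undefined, one = undefined,
      zero = (\<zero>\<^bsub>X\<^esub>, \<zero>\<^bsub>Y\<^esub>),
      add = (\<lambda>(x, y) (x', y'). (x \<oplus>\<^bsub>X\<^esub> x', y \<oplus>\<^bsub>Y\<^esub> y')),
      smult = (\<lambda>A (x, y). case A of Matrix2 a n m b \<Rightarrow>
        (a \<odot>\<^bsub>X\<^esub> x \<oplus>\<^bsub>X\<^esub> g (rtensor R Y n y), b \<odot>\<^bsub>Y\<^esub> y \<oplus>\<^bsub>Y\<^esub> f (rtensor R X m x)))\<rparr>"

end

theory Submission
  imports Defs
begin

text \<open>
  Put \<open>z = \<phi>(1 \<otimes> 1)\<close>.  Linearity and the associativity condition on \<open>\<phi>\<close> make \<open>z\<close> central in \<open>\<Lambda>\<close>, with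
  \<open>\<phi>(m \<otimes> n) = z m n\<close>, and a map out of \<open>\<Lambda> \<otimes> X\<close> is a map out of \<open>X\<close>.  Thus a module over the Morita
  ring \<open>\<Delta>\<close> is a pair of \<open>\<Lambda>\<close>-modules \<open>X\<close>, \<open>Y\<close> with maps \<open>f : X \<rightarrow> Y\<close> and \<open>g : Y \<rightarrow> X\<close> such that both
  \<open>g f\<close> and \<open>f g\<close> are multiplication by \<open>z\<close> (\<open>module_as_pair\<close>, \<open>morita_tuple_pair\<close>).

  The ring \<open>\<Delta>\<close> is free over \<open>\<Lambda>\<close> on the four matrix units, and the sum of the off-diagonal entries is
  a Frobenius form: a \<open>\<Delta>\<close>-linear map from \<open>(X, Y, f, g)\<close> to \<open>\<Delta>\<close> is the same as a \<open>\<Lambda>\<close>-linear map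
  \<open>X \<rightarrow> \<Lambda>\<close> together with a \<open>\<Lambda>\<close>-linear map \<open>Y \<rightarrow> \<Lambda>\<close> (\<open>pair_module_dualI\<close>, \<open>pair_module_dualE\<close>).
  Hence \<open>Hom(-, \<Delta>)\<close> keeps an exact sequence of pairs exact as soon as \<open>Hom(-, \<Lambda>)\<close> keeps both
  component sequences exact, and conversely.

  Totally acyclic complexes are splices of short exact sequences \<open>0 \<rightarrow> N \<rightarrow> P \<rightarrow> M \<rightarrow> 0\<close> with \<open>P\<close>
  projective that remain exact after dualising (\<open>dual_exact\<close>).  So the modules of a class are
  Gorenstein-projective once each of them is both the right end and the left end of such a sequence
  whose other end lies in the class (\<open>gorenstein_projective_coinduct\<close>).

  If \<open>(X, Y, f, g)\<close> is Gorenstein-projective, the components of the sequences around it are sequences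
  of the required kind over \<open>\<Lambda>\<close>, because components of projective \<open>\<Delta>\<close>-modules are projective
  (\<open>gorenstein_projective_components\<close>).  In the other direction, let \<open>X\<close> and \<open>Y\<close> be
  Gorenstein-projective with sequences \<open>N \<rightarrow> P \<rightarrow> X\<close> and \<open>N' \<rightarrow> Q \<rightarrow> Y\<close>.  The \<open>\<Delta>\<close>-module induced
  from \<open>P\<close> and \<open>Q\<close> is projective, has both components \<open>P \<oplus> Q\<close>, and maps onto the pair.  A shear of
  \<open>P \<oplus> Q\<close> splits \<open>Q\<close>, respectively \<open>P\<close>, off the kernel, whose components are therefore \<open>N \<oplus> Q\<close> and
  \<open>N' \<oplus> P\<close> and again Gorenstein-projective (\<open>pair_module_syzygy\<close>).  The dual construction embeds the
  pair into an induced module (\<open>pair_module_cosyzygy\<close>), and coinduction applies to the class of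
  pairs with Gorenstein-projective components.
\<close>

section \<open>Linear maps and isomorphisms\<close>

lemma fg_moduleD: "fg_module R M \<Longrightarrow> left_module R M"
  by (simp add: fg_module_def)

lemma linear_mapsI:
  assumes "\<And>x. x \<in> carrier M \<Longrightarrow> h x \<in> carrier N"
    and "\<And>x y. x \<in> carrier M \<Longrightarrow> y \<in> carrier M \<Longrightarrow> h (x \<oplus>\<^bsub>M\<^esub> y) = h x \<oplus>\<^bsub>N\<^esub> h y"
    and "\<And>r x. r \<in> carrier R \<Longrightarrow> x \<in> carrier M \<Longrightarrow> h (r \<odot>\<^bsub>M\<^esub> x) = r \<odot>\<^bsub>N\<^esub> h x"
  shows "h \<in> linear_maps R M N"
  using assms by (auto simp: linear_maps_def)

lemma linear_mapsD:
  assumes "h \<in> linear_maps R M N"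
  shows "x \<in> carrier M \<Longrightarrow> h x \<in> carrier N"
    and "x \<in> carrier M \<Longrightarrow> y \<in> carrier M \<Longrightarrow> h (x \<oplus>\<^bsub>M\<^esub> y) = h x \<oplus>\<^bsub>N\<^esub> h y"
    and "r \<in> carrier R \<Longrightarrow> x \<in> carrier M \<Longrightarrow> h (r \<odot>\<^bsub>M\<^esub> x) = r \<odot>\<^bsub>N\<^esub> h x"
  using assms by (auto simp: linear_maps_def)

lemma linear_maps_zero:
  assumes "left_module R M" "left_module R N" "h \<in> linear_maps R M N"
  shows "h \<zero>\<^bsub>M\<^esub> = \<zero>\<^bsub>N\<^esub>"
proof -
  interpret M: left_module R M by fact
  interpret N: left_module R N by fact
  show ?thesis
    by (metis linear_mapsD(1,3)[OF assms(3)] M.zero_closed M.R.zero_closed M.smult_l_null N.smult_l_null)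
qed

lemma linear_maps_minus:
  assumes "left_module R M" "left_module R N" "h \<in> linear_maps R M N" "x \<in> carrier M"
  shows "h (\<ominus>\<^bsub>M\<^esub> x) = \<ominus>\<^bsub>N\<^esub> h x"
proof -
  interpret M: left_module R M by fact
  interpret N: left_module R N by fact
  show ?thesis
    by (metis linear_mapsD(1,3)[OF assms(3)] M.R.a_inv_closed M.R.one_closed
        M.smult_minus_one N.smult_minus_one assms(4))
qed

lemma linear_maps_inj_iff:
  assumes "left_module R M" "left_module R N" "h \<in> linear_maps R M N"
  shows "inj_on h (carrier M) \<longleftrightarrow> (\<forall>x\<in>carrier M. h x = \<zero>\<^bsub>N\<^esub> \<longrightarrow> x = \<zero>\<^bsub>M\<^esub>)"
proof -
  interpret M: left_module R M by fact
  interpret N: left_module R N by fact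
  note h = linear_mapsD[OF assms(3)] linear_maps_zero[OF assms] linear_maps_minus[OF assms]
  show ?thesis
  proof
    assume "inj_on h (carrier M)"
    then show "\<forall>x\<in>carrier M. h x = \<zero>\<^bsub>N\<^esub> \<longrightarrow> x = \<zero>\<^bsub>M\<^esub>"
      using h(4) by (metis M.zero_closed inj_onD)
  next
    assume ker: "\<forall>x\<in>carrier M. h x = \<zero>\<^bsub>N\<^esub> \<longrightarrow> x = \<zero>\<^bsub>M\<^esub>"
    show "inj_on h (carrier M)"
    proof (rule inj_onI)
      fix x y assume xy: "x \<in> carrier M" "y \<in> carrier M" "h x = h y"
      then have "h (x \<oplus>\<^bsub>M\<^esub> \<ominus>\<^bsub>M\<^esub> y) = \<zero>\<^bsub>N\<^esub>" using h by (simp add: N.r_neg)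
      then have "x \<oplus>\<^bsub>M\<^esub> \<ominus>\<^bsub>M\<^esub> y = \<zero>\<^bsub>M\<^esub>" using ker xy by auto
      then show "x = y" using xy by (metis M.minus_minus M.minus_equality M.a_inv_closed)
    qed
  qed
qed

lemma linear_maps_id [simp]: "(\<lambda>x. x) \<in> linear_maps R M M"
  by (auto simp: linear_maps_def)

lemma linear_maps_compose:
  "h \<in> linear_maps R M N \<Longrightarrow> k \<in> linear_maps R N L \<Longrightarrow> (\<lambda>x. k (h x)) \<in> linear_maps R M L"
  by (auto simp: linear_maps_def Pi_def)

lemma linear_maps_add:
  assumes "left_module R N" "h \<in> linear_maps R M N" "k \<in> linear_maps R M N"
  shows "(\<lambda>x. h x \<oplus>\<^bsub>N\<^esub> k x) \<in> linear_maps R M N"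
proof -
  interpret N: left_module R N by fact
  note h = linear_mapsD[OF assms(2)] and k = linear_mapsD[OF assms(3)]
  show ?thesis
    by (rule linear_mapsI) (use h k in \<open>auto simp: N.smult_r_distr N.a_ac\<close>)
qed

lemma linear_maps_uminus:
  assumes "left_module R N" "h \<in> linear_maps R M N"
  shows "(\<lambda>x. \<ominus>\<^bsub>N\<^esub> h x) \<in> linear_maps R M N"
proof -
  interpret N: left_module R N by fact
  note h = linear_mapsD[OF assms(2)]
  have "r \<odot>\<^bsub>N\<^esub> (\<ominus>\<^bsub>N\<^esub> y) = \<ominus>\<^bsub>N\<^esub> (r \<odot>\<^bsub>N\<^esub> y)" if "r \<in> carrier R" "y \<in> carrier N" for r y
    using that N.smult_r_distr[of r y "\<ominus>\<^bsub>N\<^esub> y"]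
    by (metis N.M.a_inv_closed N.M.minus_equality N.M.r_neg N.M.a_comm N.smult_closed N.smult_r_null)
  then show ?thesis
    by (intro linear_mapsI) (use h in \<open>auto simp: N.minus_add\<close>)
qed

text \<open>Maps between quotients, kernels and isomorphic copies are all produced by the next two
  factorisations, through a surjection and through an injection.\<close>

lemma linear_maps_factor_surj:
  assumes "left_module R M" "left_module R N" "left_module R L"
    and s: "s \<in> linear_maps R M N" "s ` carrier M = carrier N"
    and h: "h \<in> linear_maps R M L"
    and ker: "\<And>x. x \<in> carrier M \<Longrightarrow> s x = \<zero>\<^bsub>N\<^esub> \<Longrightarrow> h x = \<zero>\<^bsub>L\<^esub>"
  shows "\<exists>k\<in>linear_maps R N L. \<forall>x\<in>carrier M. k (s x) = h x"
proof -
  interpret M: left_module R M by fact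
  interpret N: left_module R N by fact
  interpret L: left_module R L by fact
  note sD = linear_mapsD[OF s(1)] linear_maps_minus[OF assms(1,2) s(1)]
  note hD = linear_mapsD[OF h] linear_maps_minus[OF assms(1,3) h]
  define t where "t = inv_into (carrier M) s"
  have t: "t y \<in> carrier M" "s (t y) = y" if "y \<in> carrier N" for y
    using that s(2) by (auto simp: t_def inv_into_into f_inv_into_f)
  have eq: "h x = h y" if "x \<in> carrier M" "y \<in> carrier M" "s x = s y" for x y
  proof -
    have "s (x \<oplus>\<^bsub>M\<^esub> \<ominus>\<^bsub>M\<^esub> y) = \<zero>\<^bsub>N\<^esub>" using that sD by (simp add: N.r_neg)
    then have "h x \<oplus>\<^bsub>L\<^esub> \<ominus>\<^bsub>L\<^esub> h y = \<zero>\<^bsub>L\<^esub>" using ker[of "x \<oplus>\<^bsub>M\<^esub> \<ominus>\<^bsub>M\<^esub> y"] that hD by auto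
    then show ?thesis using that hD(1)
      by (metis L.minus_minus L.minus_equality L.a_inv_closed)
  qed
  have kt: "h (t (s x)) = h x" if "x \<in> carrier M" for x
    by (rule eq) (use that t sD in auto)
  have "(\<lambda>y. h (t y)) \<in> linear_maps R N L"
  proof (rule linear_mapsI)
    show "h (t y) \<in> carrier L" if "y \<in> carrier N" for y using that t hD by auto
    show "h (t (x \<oplus>\<^bsub>N\<^esub> y)) = h (t x) \<oplus>\<^bsub>L\<^esub> h (t y)" if "x \<in> carrier N" "y \<in> carrier N" for x y
      using kt[of "t x \<oplus>\<^bsub>M\<^esub> t y"] that t sD hD by simp
    show "h (t (r \<odot>\<^bsub>N\<^esub> y)) = r \<odot>\<^bsub>L\<^esub> h (t y)" if "r \<in> carrier R" "y \<in> carrier N" for r y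
      using kt[of "r \<odot>\<^bsub>M\<^esub> t y"] that t sD hD by simp
  qed
  then show ?thesis using kt by (intro bexI[of _ "\<lambda>y. h (t y)"]) auto
qed

lemma linear_maps_factor_inj:
  assumes "left_module R N" "left_module R L"
    and i: "i \<in> linear_maps R N P" "inj_on i (carrier N)"
    and h: "h \<in> linear_maps R L P" and im: "h ` carrier L \<subseteq> i ` carrier N"
  shows "\<exists>k\<in>linear_maps R L N. \<forall>x\<in>carrier L. i (k x) = h x"
proof -
  interpret N: left_module R N by fact
  interpret L: left_module R L by fact
  note iD = linear_mapsD[OF i(1)] and hD = linear_mapsD[OF h]
  define t where "t = inv_into (carrier N) i"
  have t: "t (h x) \<in> carrier N" "i (t (h x)) = h x" if "x \<in> carrier L" for x
    using that im by (auto simp: t_def image_subset_iff inv_into_into f_inv_into_f)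
  have ti: "t (i x) = x" if "x \<in> carrier N" for x using that i(2) by (simp add: t_def)
  have "(\<lambda>x. t (h x)) \<in> linear_maps R L N"
  proof (rule linear_mapsI)
    show "t (h x) \<in> carrier N" if "x \<in> carrier L" for x using that t by auto
    show "t (h (x \<oplus>\<^bsub>L\<^esub> y)) = t (h x) \<oplus>\<^bsub>N\<^esub> t (h y)" if "x \<in> carrier L" "y \<in> carrier L" for x y
      using ti[of "t (h x) \<oplus>\<^bsub>N\<^esub> t (h y)"] that t iD hD by simp
    show "t (h (r \<odot>\<^bsub>L\<^esub> x)) = r \<odot>\<^bsub>N\<^esub> t (h x)" if "r \<in> carrier R" "x \<in> carrier L" for r x
      using ti[of "r \<odot>\<^bsub>N\<^esub> t (h x)"] that t iD hD by simp
  qed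
  then show ?thesis using t by (intro bexI[of _ "\<lambda>x. t (h x)"]) auto
qed

lemma module_isoE:
  assumes "module_iso R M N" "left_module R M" "left_module R N"
  obtains h k where "h \<in> linear_maps R M N" "k \<in> linear_maps R N M"
    "\<And>x. x \<in> carrier M \<Longrightarrow> k (h x) = x" "\<And>y. y \<in> carrier N \<Longrightarrow> h (k y) = y"
proof -
  obtain h where h: "h \<in> linear_maps R M N" "bij_betw h (carrier M) (carrier N)"
    using assms by (auto simp: module_iso_def)
  then obtain k where k: "k \<in> linear_maps R N M" "\<forall>y\<in>carrier N. h (k y) = y"
    using linear_maps_factor_inj[OF assms(2,3) h(1) _ linear_maps_id]
    by (auto simp: bij_betw_def)
  have "k (h x) = x" if "x \<in> carrier M" for x
    by (rule inj_onD[OF bij_betw_imp_inj_on[OF h(2)]])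
       (use that k linear_mapsD(1)[OF h(1)] linear_mapsD(1)[OF k(1)] in auto)
  with h k that show ?thesis by blast
qed

lemma module_isoI:
  assumes "h \<in> linear_maps R M N" "k \<in> carrier N \<rightarrow> carrier M"
    "\<And>x. x \<in> carrier M \<Longrightarrow> k (h x) = x" "\<And>y. y \<in> carrier N \<Longrightarrow> h (k y) = y"
  shows "module_iso R M N"
  unfolding module_iso_def
  by (intro bexI[OF _ assms(1)] bij_betwI[where g = k])
     (use assms linear_mapsD(1)[OF assms(1)] in auto)

lemma module_iso_refl [simp]: "module_iso R M M"
  by (rule module_isoI[of "\<lambda>x. x" _ _ _ "\<lambda>x. x"]) auto

lemma module_iso_sym:
  assumes "module_iso R M N" "left_module R M" "left_module R N"
  shows "module_iso R N M"
proof -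
  obtain h k where "h \<in> linear_maps R M N" "k \<in> linear_maps R N M"
    "\<And>x. x \<in> carrier M \<Longrightarrow> k (h x) = x" "\<And>y. y \<in> carrier N \<Longrightarrow> h (k y) = y"
    by (rule module_isoE[OF assms]) (rule that)
  then show ?thesis by (intro module_isoI[of k _ _ _ h]) (auto dest: linear_mapsD(1))
qed

lemma module_iso_trans:
  assumes "module_iso R M N" "module_iso R N L"
  shows "module_iso R M L"
proof -
  obtain h k where "h \<in> linear_maps R M N" "bij_betw h (carrier M) (carrier N)"
    "k \<in> linear_maps R N L" "bij_betw k (carrier N) (carrier L)"
    using assms by (auto simp: module_iso_def)
  then have "(\<lambda>x. k (h x)) \<in> linear_maps R M L" "bij_betw (\<lambda>x. k (h x)) (carrier M) (carrier L)"
    using bij_betw_trans[of h _ _ k] linear_maps_compose[of h R M N k L] by (simp_all add: comp_def)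
  then show ?thesis unfolding module_iso_def by (intro bexI)
qed

lemma fg_module_image:
  assumes "fg_module R M" "left_module R N" "h \<in> linear_maps R M N" "h ` carrier M = carrier N"
  shows "fg_module R N"
  using assms finitely_generated_image[of R M N h] by (auto simp: fg_module_def)

lemma fg_module_iso:
  assumes "fg_module R M" "left_module R N" "module_iso R M N"
  shows "fg_module R N"
  using assms fg_module_image[of R M N] by (auto simp: module_iso_def bij_betw_def)


section \<open>Projective modules\<close>

lemma projective_moduleD: "projective_module R P \<Longrightarrow> fg_module R P"
  by (simp add: projective_module_def)

text \<open>The definition tests lifting only against modules whose elements are sets of coefficient
  tuples; transport to such copies gives lifting against all finitely generated modules.\<close>

lemma projective_module_lift:
  assumes P: "projective_module R P" and A: "fg_module R A" and B: "fg_module R B"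
    and p: "p \<in> linear_maps R A B" "p ` carrier A = carrier B" and h: "h \<in> linear_maps R P B"
  shows "\<exists>k\<in>linear_maps R P A. \<forall>x\<in>carrier P. p (k x) = h x"
proof -
  obtain A' :: "'a small_module" where A': "fg_module R A'" "module_iso R A A'"
    using fg_module_small[OF A] by blast
  obtain B' :: "'a small_module" where B': "fg_module R B'" "module_iso R B B'"
    using fg_module_small[OF B] by blast
  obtain a a' where a: "a \<in> linear_maps R A A'" "a' \<in> linear_maps R A' A"
    "\<And>x. x \<in> carrier A \<Longrightarrow> a' (a x) = x" "\<And>x. x \<in> carrier A' \<Longrightarrow> a (a' x) = x"
    by (rule module_isoE[OF A'(2) A[THEN fg_moduleD] A'(1)[THEN fg_moduleD]]) (rule that)
  obtain b b' where b: "b \<in> linear_maps R B B'" "b' \<in> linear_maps R B' B"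
    "\<And>x. x \<in> carrier B \<Longrightarrow> b' (b x) = x" "\<And>x. x \<in> carrier B' \<Longrightarrow> b (b' x) = x"
    by (rule module_isoE[OF B'(2) B[THEN fg_moduleD] B'(1)[THEN fg_moduleD]]) (rule that)
  have lin: "(\<lambda>x. b (p (a' x))) \<in> linear_maps R A' B'" "(\<lambda>x. b (h x)) \<in> linear_maps R P B'"
    by (rule linear_maps_compose[OF a(2) linear_maps_compose[OF p(1) b(1)]],
        rule linear_maps_compose[OF h b(1)])
  have surj: "(\<lambda>x. b (p (a' x))) ` carrier A' = carrier B'"
  proof (intro equalityI subsetI)
    fix y assume y: "y \<in> carrier B'"
    then have "b' y \<in> p ` carrier A" using p(2) linear_mapsD(1)[OF b(2)] by auto
    then obtain x where x: "x \<in> carrier A" "p x = b' y" by auto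
    then show "y \<in> (\<lambda>x. b (p (a' x))) ` carrier A'"
      using linear_mapsD(1)[OF a(1)] by (intro image_eqI[of _ _ "a x"]) (simp_all add: a(3) b(4) y)
  qed (use linear_mapsD(1)[OF lin(1)] in auto)
  have small: "\<exists>k\<in>linear_maps R P A'. \<forall>x\<in>carrier P. q (k x) = l x"
    if "q \<in> linear_maps R A' B'" "q ` carrier A' = carrier B'" "l \<in> linear_maps R P B'" for q l
    using P A'(1) B'(1) that unfolding projective_module_def by simp
  obtain k where k: "k \<in> linear_maps R P A'" "\<And>x. x \<in> carrier P \<Longrightarrow> b (p (a' (k x))) = b (h x)"
    using small[OF lin(1) surj lin(2)] by auto
  have "p (a' (k x)) = h x" if "x \<in> carrier P" for x
    using arg_cong[OF k(2)[OF that], of b'] that linear_mapsD(1)[OF k(1)] linear_mapsD(1)[OF a(2)]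
      linear_mapsD(1)[OF p(1)] linear_mapsD(1)[OF h]
    by (simp add: b(3))
  then show ?thesis by (intro bexI[OF _ linear_maps_compose[OF k(1) a(2)]]) auto
qed

lemma projective_module_iso:
  assumes P: "projective_module R P" and Q: "left_module R Q" and iso: "module_iso R P Q"
  shows "projective_module R Q"
  unfolding projective_module_def
proof (intro conjI allI impI)
  show "fg_module R Q" using fg_module_iso[OF projective_moduleD[OF P] Q iso] .
  fix A B :: "'a small_module" and p h
  assume *: "fg_module R A \<and> fg_module R B \<and> p \<in> linear_maps R A B \<and> p ` carrier A = carrier B
    \<and> h \<in> linear_maps R Q B"
  obtain s t where st: "s \<in> linear_maps R P Q" "t \<in> linear_maps R Q P"
    "\<And>y. y \<in> carrier Q \<Longrightarrow> s (t y) = y"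
    by (rule module_isoE[OF iso fg_moduleD[OF projective_moduleD[OF P]] Q]) (rule that)
  obtain k where k: "k \<in> linear_maps R P A" "\<forall>x\<in>carrier P. p (k x) = h (s x)"
    using projective_module_lift[OF P, of A B p "\<lambda>x. h (s x)"] * linear_maps_compose[OF st(1)] by blast
  show "\<exists>k\<in>linear_maps R Q A. \<forall>x\<in>carrier Q. p (k x) = h x"
    by (rule bexI[OF _ linear_maps_compose[OF st(2) k(1)]])
       (use k(2) st(3) linear_mapsD(1)[OF st(2)] in auto)
qed


section \<open>Direct sums\<close>

definition direct_sum ::
    "('a, 'b, 'm) module_scheme \<Rightarrow> ('a, 'c, 'n) module_scheme \<Rightarrow> ('a, 'b \<times> 'c) module" where
  "direct_sum A B =
     \<lparr>carrier = carrier A \<times> carrier B, mult = undefined, one = undefined,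
      zero = (\<zero>\<^bsub>A\<^esub>, \<zero>\<^bsub>B\<^esub>), add = (\<lambda>(x, y) (x', y'). (x \<oplus>\<^bsub>A\<^esub> x', y \<oplus>\<^bsub>B\<^esub> y')),
      smult = (\<lambda>r (x, y). (r \<odot>\<^bsub>A\<^esub> x, r \<odot>\<^bsub>B\<^esub> y))\<rparr>"

lemma direct_sum_simps [simp]:
  "carrier (direct_sum A B) = carrier A \<times> carrier B"
  "\<zero>\<^bsub>direct_sum A B\<^esub> = (\<zero>\<^bsub>A\<^esub>, \<zero>\<^bsub>B\<^esub>)"
  "(x, y) \<oplus>\<^bsub>direct_sum A B\<^esub> (x', y') = (x \<oplus>\<^bsub>A\<^esub> x', y \<oplus>\<^bsub>B\<^esub> y')"
  "r \<odot>\<^bsub>direct_sum A B\<^esub> (x, y) = (r \<odot>\<^bsub>A\<^esub> x, r \<odot>\<^bsub>B\<^esub> y)"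
  by (simp_all add: direct_sum_def)

lemma left_module_direct_sum:
  assumes "left_module R A" "left_module R B"
  shows "left_module R (direct_sum A B)"
proof -
  interpret A: left_module R A by fact
  interpret B: left_module R B by fact
  have "abelian_group (direct_sum A B)"
    by (rule abelian_groupI)
       (auto simp: A.M.a_ac B.M.a_ac A.M.l_neg B.M.l_neg intro!: bexI[of _ "(\<ominus>\<^bsub>A\<^esub> _, \<ominus>\<^bsub>B\<^esub> _)"])
  then show ?thesis
    by (intro left_module.intro left_module_axioms.intro A.R.ring_axioms)
       (auto simp: A.smult_l_distr B.smult_l_distr A.smult_r_distr B.smult_r_distr
          A.smult_assoc1 B.smult_assoc1)
qed

lemma direct_sum_linear_maps:
  assumes "left_module R A" "left_module R B"
  shows direct_sum_fst: "fst \<in> linear_maps R (direct_sum A B) A"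
    and direct_sum_snd: "snd \<in> linear_maps R (direct_sum A B) B"
    and direct_sum_inl: "(\<lambda>x. (x, \<zero>\<^bsub>B\<^esub>)) \<in> linear_maps R A (direct_sum A B)"
    and direct_sum_inr: "(\<lambda>y. (\<zero>\<^bsub>A\<^esub>, y)) \<in> linear_maps R B (direct_sum A B)"
proof -
  interpret A: left_module R A by fact
  interpret B: left_module R B by fact
  show "fst \<in> linear_maps R (direct_sum A B) A" "snd \<in> linear_maps R (direct_sum A B) B"
    "(\<lambda>x. (x, \<zero>\<^bsub>B\<^esub>)) \<in> linear_maps R A (direct_sum A B)"
    "(\<lambda>y. (\<zero>\<^bsub>A\<^esub>, y)) \<in> linear_maps R B (direct_sum A B)"
    by (auto intro!: linear_mapsI)
qed

lemma linear_maps_pair: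
  "h \<in> linear_maps R M A \<Longrightarrow> k \<in> linear_maps R M B \<Longrightarrow>
    (\<lambda>x. (h x, k x)) \<in> linear_maps R M (direct_sum A B)"
  by (auto simp: linear_maps_def)

text \<open>If the scalars \<open>T\<close> act on a product so that a submodule meets each axis in an
  \<open>R\<close>-submodule, generators of the axes generate the product.  Besides direct sums, this covers
  modules over the Morita ring.\<close>

lemma finitely_generated_product:
  assumes A: "left_module R A" "finitely_generated R A"
    and B: "left_module R B" "finitely_generated R B"
    and M: "carrier M = carrier A \<times> carrier B"
      "\<And>x y. x \<in> carrier A \<Longrightarrow> y \<in> carrier B \<Longrightarrow>
        (x, \<zero>\<^bsub>B\<^esub>) \<oplus>\<^bsub>M\<^esub> (\<zero>\<^bsub>A\<^esub>, y) = (x, y)"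
    and sub: "\<And>L. submodule L T M \<Longrightarrow> submodule {x \<in> carrier A. (x, \<zero>\<^bsub>B\<^esub>) \<in> L} R A"
      "\<And>L. submodule L T M \<Longrightarrow> submodule {y \<in> carrier B. (\<zero>\<^bsub>A\<^esub>, y) \<in> L} R B"
  shows "finitely_generated T M"
proof -
  interpret A: left_module R A by fact
  interpret B: left_module R B by fact
  obtain S where S: "finite S" "S \<subseteq> carrier A"
    "\<And>L. submodule L R A \<Longrightarrow> S \<subseteq> L \<Longrightarrow> L = carrier A"
    using A(2) by (auto simp: finitely_generated_def)
  obtain S' where S': "finite S'" "S' \<subseteq> carrier B"
    "\<And>L. submodule L R B \<Longrightarrow> S' \<subseteq> L \<Longrightarrow> L = carrier B"
    using B(2) by (auto simp: finitely_generated_def)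
  have "L = carrier M"
    if L: "submodule L T M" "(\<lambda>x. (x, \<zero>\<^bsub>B\<^esub>)) ` S \<union> (\<lambda>y. (\<zero>\<^bsub>A\<^esub>, y)) ` S' \<subseteq> L" for L
  proof -
    have 1: "{x \<in> carrier A. (x, \<zero>\<^bsub>B\<^esub>) \<in> L} = carrier A"
      by (rule S(3)[OF sub(1)[OF L(1)]]) (use L(2) S(2) in auto)
    have 2: "{y \<in> carrier B. (\<zero>\<^bsub>A\<^esub>, y) \<in> L} = carrier B"
      by (rule S'(3)[OF sub(2)[OF L(1)]]) (use L(2) S'(2) in auto)
    have "(x, y) \<in> L" if "x \<in> carrier A" "y \<in> carrier B" for x y
    proof -
      have "(x, \<zero>\<^bsub>B\<^esub>) \<in> L" "(\<zero>\<^bsub>A\<^esub>, y) \<in> L" using 1 2 that by auto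
      moreover have "subgroup L (add_monoid M)" using L(1) by (rule submodule.axioms)
      ultimately show ?thesis using subgroup.m_closed[of L "add_monoid M" "(x, \<zero>\<^bsub>B\<^esub>)" "(\<zero>\<^bsub>A\<^esub>, y)"] M(2)[OF that]
        by simp
    qed
    moreover have "L \<subseteq> carrier M"
      using subgroup.subset[OF submodule.axioms(1)[OF L(1)]] by simp
    ultimately show ?thesis using M(1) by auto
  qed
  then show ?thesis unfolding finitely_generated_def
    by (intro exI[of _ "(\<lambda>x. (x, \<zero>\<^bsub>B\<^esub>)) ` S \<union> (\<lambda>y. (\<zero>\<^bsub>A\<^esub>, y)) ` S'"]) (use S S' M(1) in auto)
qed

lemma submodule_vimage:
  assumes "left_module R M" "left_module R N" "h \<in> linear_maps R M N" "submodule L R N"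
  shows "submodule {x \<in> carrier M. h x \<in> L} R M"
proof -
  interpret M: left_module R M by fact
  interpret L: submodule L R N by fact
  show ?thesis
    by (rule M.submodule_closureI)
       (use L.one_closed L.m_closed L.smult_closed linear_mapsD[OF assms(3)]
          linear_maps_zero[OF assms(1-3)] in auto)
qed

lemma fg_module_direct_sum:
  assumes "fg_module R A" "fg_module R B"
  shows "fg_module R (direct_sum A B)"
proof -
  have mod: "left_module R A" "left_module R B" using assms by (auto simp: fg_module_def)
  interpret A: left_module R A by fact
  interpret B: left_module R B by fact
  have "finitely_generated R (direct_sum A B)"
  proof (rule finitely_generated_product[of R A B])
    fix L assume L: "submodule L R (direct_sum A B)"
    show "submodule {x \<in> carrier A. (x, \<zero>\<^bsub>B\<^esub>) \<in> L} R A"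
      using submodule_vimage[OF mod(1) left_module_direct_sum[OF mod] direct_sum_inl[OF mod] L] .
    show "submodule {y \<in> carrier B. (\<zero>\<^bsub>A\<^esub>, y) \<in> L} R B"
      using submodule_vimage[OF mod(2) left_module_direct_sum[OF mod] direct_sum_inr[OF mod] L] .
  qed (use assms in \<open>auto simp: fg_module_def\<close>)
  with left_module_direct_sum[OF mod] show ?thesis by (simp add: fg_module_def)
qed

lemma projective_module_direct_sum:
  assumes P: "projective_module R P" and Q: "projective_module R Q"
  shows "projective_module R (direct_sum P Q)"
  unfolding projective_module_def
proof (intro conjI allI impI)
  have fg: "fg_module R P" "fg_module R Q" using P Q by (auto dest: projective_moduleD)
  then show "fg_module R (direct_sum P Q)" by (rule fg_module_direct_sum)
  note mod = fg[THEN fg_moduleD]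
  interpret P: left_module R P by (rule mod)
  interpret Q: left_module R Q by (rule mod)
  fix A B :: "'a small_module" and p h
  assume *: "fg_module R A \<and> fg_module R B \<and> p \<in> linear_maps R A B \<and> p ` carrier A = carrier B
    \<and> h \<in> linear_maps R (direct_sum P Q) B"
  then have h: "h \<in> linear_maps R (direct_sum P Q) B" and p: "p \<in> linear_maps R A B"
    and A: "left_module R A" by (auto simp: fg_module_def)
  obtain k where k: "k \<in> linear_maps R P A" "\<forall>x\<in>carrier P. p (k x) = h (x, \<zero>\<^bsub>Q\<^esub>)"
    using projective_module_lift[OF P _ _ p _ linear_maps_compose[OF direct_sum_inl[OF mod] h]] * by auto
  obtain l where l: "l \<in> linear_maps R Q A" "\<forall>x\<in>carrier Q. p (l x) = h (\<zero>\<^bsub>P\<^esub>, x)"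
    using projective_module_lift[OF Q _ _ p _ linear_maps_compose[OF direct_sum_inr[OF mod] h]] * by auto
  have "p (k x \<oplus>\<^bsub>A\<^esub> l y) = h (x, y)" if "x \<in> carrier P" "y \<in> carrier Q" for x y
    using that k(2) l(2) linear_mapsD(2)[OF p] linear_mapsD(1)[OF k(1)] linear_mapsD(1)[OF l(1)]
      linear_mapsD(2)[OF h, of "(x, \<zero>\<^bsub>Q\<^esub>)" "(\<zero>\<^bsub>P\<^esub>, y)"] by auto
  then show "\<exists>k\<in>linear_maps R (direct_sum P Q) A. \<forall>x\<in>carrier (direct_sum P Q). p (k x) = h x"
    by (intro bexI[of _ "\<lambda>x. k (fst x) \<oplus>\<^bsub>A\<^esub> l (snd x)"] linear_maps_add[OF A]
        linear_maps_compose[OF direct_sum_fst[OF mod] k(1)]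
        linear_maps_compose[OF direct_sum_snd[OF mod] l(1)]) auto
qed

section \<open>The regular module\<close>

lemma regular_module_simps [simp]:
  "carrier (regular_module R) = carrier R" "\<zero>\<^bsub>regular_module R\<^esub> = \<zero>\<^bsub>R\<^esub>"
  "x \<oplus>\<^bsub>regular_module R\<^esub> y = x \<oplus>\<^bsub>R\<^esub> y" "r \<odot>\<^bsub>regular_module R\<^esub> x = r \<otimes>\<^bsub>R\<^esub> x"
  by (simp_all add: regular_module_def)

lemma left_module_regular:
  assumes "ring R" shows "left_module R (regular_module R)"
proof -
  interpret ring R by fact
  have "abelian_group (regular_module R)"
    by (rule abelian_groupI) (auto simp: a_ac l_neg intro!: bexI[of _ "\<ominus>\<^bsub>R\<^esub> _"])
  then show ?thesis
    by (intro left_module.intro left_module_axioms.intro assms)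
       (auto simp: l_distr r_distr m_assoc)
qed

abbreviation functionals ::
    "('a, 'e) ring_scheme \<Rightarrow> ('a, 'b, 'm) module_scheme \<Rightarrow> ('b \<Rightarrow> 'a) set" where
  "functionals R M \<equiv> linear_maps R M (regular_module R)"

lemma fg_module_regular:
  assumes "ring R" shows "fg_module R (regular_module R)"
proof -
  interpret ring R by fact
  interpret left_module R "regular_module R" by (rule left_module_regular[OF assms])
  have "L = carrier R" if L: "submodule L R (regular_module R)" "\<one>\<^bsub>R\<^esub> \<in> L" for L
  proof -
    interpret L: submodule L R "regular_module R" by fact
    have "r \<in> L" if "r \<in> carrier R" for r using L.smult_closed[OF that L(2)] that by simp
    then show ?thesis using L.subset by auto
  qed
  then show ?thesis
    unfolding fg_module_def finitely_generated_def
    by (intro conjI left_module_axioms exI[of _ "{\<one>\<^bsub>R\<^esub>}"]) auto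
qed

section \<open>Short exact sequences that stay exact under dualisation\<close>

text \<open>Exact sequences \<open>0 \<rightarrow> N \<rightarrow> P \<rightarrow> M \<rightarrow> 0\<close> with \<open>P\<close> projective that \<open>Hom(-, R)\<close> keeps exact.
  Totally acyclic complexes are precisely the bi-infinite splices of such sequences.\<close>

definition dual_exact ::
    "('a, 'e) ring_scheme \<Rightarrow> ('a, 'b, 'm) module_scheme \<Rightarrow> ('a, 'c, 'n) module_scheme
      \<Rightarrow> ('a, 'd, 'p) module_scheme \<Rightarrow> ('b \<Rightarrow> 'c) \<Rightarrow> ('c \<Rightarrow> 'd) \<Rightarrow> bool" where
  "dual_exact R N P M i p \<longleftrightarrow>
     fg_module R N \<and> projective_module R P \<and> fg_module R M \<and>
     i \<in> linear_maps R N P \<and> p \<in> linear_maps R P M \<and>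
     inj_on i (carrier N) \<and> i ` carrier N = map_kernel P M p \<and> p ` carrier P = carrier M \<and>
     (\<forall>h\<in>functionals R N.
        \<exists>k\<in>functionals R P. \<forall>x\<in>carrier N. k (i x) = h x)"

lemma dual_exactD:
  assumes "dual_exact R N P M i p"
  shows "fg_module R N" "projective_module R P" "fg_module R M"
    "left_module R N" "left_module R P" "left_module R M"
    "i \<in> linear_maps R N P" "p \<in> linear_maps R P M"
    "inj_on i (carrier N)" "i ` carrier N = map_kernel P M p" "p ` carrier P = carrier M"
    "h \<in> functionals R N \<Longrightarrow>
      \<exists>k\<in>functionals R P. \<forall>x\<in>carrier N. k (i x) = h x"
  using assms by (auto simp: dual_exact_def projective_module_def fg_module_def)

lemma dual_exact_comp_zero:
  assumes "dual_exact R N P M i p" "x \<in> carrier N"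
  shows "p (i x) = \<zero>\<^bsub>M\<^esub>"
proof -
  have "i x \<in> map_kernel P M p" using assms(2) dual_exactD(10)[OF assms(1)] by blast
  then show ?thesis by (simp add: map_kernel_def)
qed

text \<open>Maps into \<open>R\<close> extend along \<open>N \<rightarrow> P\<close> by assumption, hence so do maps into finite powers of \<open>R\<close>
  and into their direct summands, which are the finitely generated projective modules.  The power
  of \<open>R\<close> is built one generator of \<open>Q\<close> at a time.\<close>

lemma dual_exact_extend:
  assumes ses: "dual_exact R N P M i p" and Q: "projective_module R Q"
    and h: "h \<in> linear_maps R N Q"
  shows "\<exists>k\<in>linear_maps R P Q. \<forall>x\<in>carrier N. k (i x) = h x"
proof -
  note D = dual_exactD[OF ses] and fgQ = projective_moduleD[OF Q]
  interpret Q: left_module R Q using fgQ by (rule fg_moduleD)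
  note ring = Q.R.ring_axioms
  define extends where "extends S \<longleftrightarrow> (\<forall>h\<in>linear_maps R N S. \<exists>k\<in>linear_maps R P S. \<forall>x\<in>carrier N. k (i x) = h x)"
    for S :: "'a small_module"
  have cover: "\<exists>(S :: 'a small_module) \<sigma>. fg_module R S \<and> extends S \<and> \<sigma> \<in> linear_maps R S Q \<and> A \<subseteq> \<sigma> ` carrier S"
    if "finite A" "A \<subseteq> carrier Q" for A
    using that
  proof (induction A rule: finite_induct)
    \<comment> \<open>One superfluous copy of \<open>R\<close>, mapped to zero, stands in for the zero module.\<close>
    case empty
    obtain S :: "'a small_module" where S: "fg_module R S" "module_iso R (regular_module R) S"
      using fg_module_small[OF fg_module_regular[OF ring]] by blast
    obtain s s' where s: "s \<in> linear_maps R (regular_module R) S" "s' \<in> linear_maps R S (regular_module R)"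
      "\<And>y. y \<in> carrier S \<Longrightarrow> s (s' y) = y"
      by (rule module_isoE[OF S(2) left_module_regular[OF ring] fg_moduleD[OF S(1)]]) (rule that)
    have "extends S"
      unfolding extends_def
    proof
      fix h assume h: "h \<in> linear_maps R N S"
      obtain k where "k \<in> functionals R P" "\<forall>x\<in>carrier N. k (i x) = s' (h x)"
        using D(12)[OF linear_maps_compose[OF h s(2)]] by auto
      then show "\<exists>k\<in>linear_maps R P S. \<forall>x\<in>carrier N. k (i x) = h x"
        using linear_mapsD(1)[OF h] by (intro bexI[OF _ linear_maps_compose[OF _ s(1)]]) (auto simp: s(3))
    qed
    moreover have "(\<lambda>_. \<zero>\<^bsub>Q\<^esub>) \<in> linear_maps R S Q" by (rule linear_mapsI) auto
    ultimately show ?case using S(1) by blast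
  next
    case (insert a A)
    then obtain S :: "'a small_module" and \<sigma> where S: "fg_module R S" "extends S"
      "\<sigma> \<in> linear_maps R S Q" "A \<subseteq> \<sigma> ` carrier S" by auto
    let ?D = "direct_sum S (regular_module R)"
    have mod: "left_module R S" "left_module R (regular_module R)"
      using fg_moduleD[OF S(1)] left_module_regular[OF ring] .
    interpret S: left_module R S by (rule mod)
    obtain T :: "'a small_module" where T: "fg_module R T" "module_iso R ?D T"
      using fg_module_small[OF fg_module_direct_sum[OF S(1) fg_module_regular[OF ring]]] by blast
    obtain t t' where t: "t \<in> linear_maps R ?D T" "t' \<in> linear_maps R T ?D"
      "\<And>x. x \<in> carrier ?D \<Longrightarrow> t' (t x) = x" "\<And>y. y \<in> carrier T \<Longrightarrow> t (t' y) = y"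
      by (rule module_isoE[OF T(2) left_module_direct_sum[OF mod] fg_moduleD[OF T(1)]]) (rule that)
    have a: "a \<in> carrier Q" using insert.prems by simp
    have "extends T"
      unfolding extends_def
    proof
      fix h assume h: "h \<in> linear_maps R N T"
      note t'h = linear_maps_compose[OF h t(2)]
      obtain k where k: "k \<in> linear_maps R P S" "\<forall>x\<in>carrier N. k (i x) = fst (t' (h x))"
        using S(2)[unfolded extends_def, THEN bspec, OF linear_maps_compose[OF t'h direct_sum_fst[OF mod]]] by auto
      obtain l where l: "l \<in> functionals R P" "\<forall>x\<in>carrier N. l (i x) = snd (t' (h x))"
        using D(12)[OF linear_maps_compose[OF t'h direct_sum_snd[OF mod]]] by auto
      show "\<exists>k\<in>linear_maps R P T. \<forall>x\<in>carrier N. k (i x) = h x"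
        using k(2) l(2) linear_mapsD(1)[OF h]
        by (intro bexI[OF _ linear_maps_compose[OF linear_maps_pair[OF k(1) l(1)] t(1)]]) (simp add: t(4))
    qed
    moreover
    define \<tau> where "\<tau> v = \<sigma> (fst v) \<oplus>\<^bsub>Q\<^esub> snd v \<odot>\<^bsub>Q\<^esub> a" for v
    have "(\<lambda>r. r \<odot>\<^bsub>Q\<^esub> a) \<in> linear_maps R (regular_module R) Q"
      by (rule linear_mapsI) (use a in \<open>auto simp: Q.smult_l_distr Q.smult_assoc1\<close>)
    then have \<tau>: "\<tau> \<in> linear_maps R ?D Q"
      unfolding \<tau>_def
      by (rule linear_maps_add[OF Q.left_module_axioms linear_maps_compose[OF direct_sum_fst[OF mod] S(3)]
          linear_maps_compose[OF direct_sum_snd[OF mod]]])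
    have \<tau>t: "y \<in> (\<lambda>v. \<tau> (t' v)) ` carrier T" if "v \<in> carrier ?D" "\<tau> v = y" for v y
      using that linear_mapsD(1)[OF t(1) that(1)] by (intro image_eqI[of _ _ "t v"]) (simp_all add: t(3))
    have "insert a A \<subseteq> (\<lambda>v. \<tau> (t' v)) ` carrier T"
    proof (intro insert_subsetI subsetI)
      show "a \<in> (\<lambda>v. \<tau> (t' v)) ` carrier T"
        using a linear_maps_zero[OF mod(1) Q.left_module_axioms S(3)]
        by (intro \<tau>t[of "(\<zero>\<^bsub>S\<^esub>, \<one>\<^bsub>R\<^esub>)"]) (simp_all add: \<tau>_def)
      fix y assume "y \<in> A"
      then obtain x where "x \<in> carrier S" "y = \<sigma> x" using S(4) by blast
      then show "y \<in> (\<lambda>v. \<tau> (t' v)) ` carrier T"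
        using a linear_mapsD(1)[OF S(3)] by (intro \<tau>t[of "(x, \<zero>\<^bsub>R\<^esub>)"]) (simp_all add: \<tau>_def)
    qed
    ultimately show ?case using T(1) linear_maps_compose[OF t(2) \<tau>] by blast
  qed
  obtain A where A: "finite A" "A \<subseteq> carrier Q" "\<And>L. submodule L R Q \<Longrightarrow> A \<subseteq> L \<Longrightarrow> L = carrier Q"
    using fgQ by (auto simp: fg_module_def finitely_generated_def)
  obtain S :: "'a small_module" and \<sigma> where S: "fg_module R S" "extends S"
    "\<sigma> \<in> linear_maps R S Q" "A \<subseteq> \<sigma> ` carrier S" using cover[OF A(1,2)] by auto
  interpret S: left_module R S using S(1) by (rule fg_moduleD)
  note \<sigma>D = linear_mapsD[OF S(3)] linear_maps_zero[OF S.left_module_axioms Q.left_module_axioms S(3)]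
  have "submodule (\<sigma> ` carrier S) R Q"
  proof (rule Q.submodule_closureI)
    show "\<zero>\<^bsub>Q\<^esub> \<in> \<sigma> ` carrier S" using \<sigma>D(4) by (metis S.zero_closed imageI)
  qed (auto simp: \<sigma>D(1) \<sigma>D(2,3)[symmetric])
  then have "\<sigma> ` carrier S = carrier Q" using S(4) by (rule A(3))
  then obtain k where k: "k \<in> linear_maps R Q S" "\<forall>y\<in>carrier Q. \<sigma> (k y) = y"
    using projective_module_lift[OF Q S(1) fgQ S(3) _ linear_maps_id] by auto
  obtain l where l: "l \<in> linear_maps R P S" "\<forall>x\<in>carrier N. l (i x) = k (h x)"
    using S(2)[unfolded extends_def, THEN bspec, OF linear_maps_compose[OF h k(1)]] by auto
  show ?thesis
    using k(2) l(2) linear_mapsD(1)[OF h] by (intro bexI[OF _ linear_maps_compose[OF l(1) S(3)]]) simp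
qed

lemma dual_exact_transport:
  assumes ses: "dual_exact R N P M i p"
    and N': "left_module R N'" and P': "left_module R P'" and M': "left_module R M'"
    and n: "n \<in> linear_maps R N N'" "n' \<in> linear_maps R N' N"
      "\<And>x. x \<in> carrier N \<Longrightarrow> n' (n x) = x" "\<And>y. y \<in> carrier N' \<Longrightarrow> n (n' y) = y"
    and a: "a \<in> linear_maps R P P'" "a' \<in> linear_maps R P' P"
      "\<And>x. x \<in> carrier P \<Longrightarrow> a' (a x) = x" "\<And>y. y \<in> carrier P' \<Longrightarrow> a (a' y) = y"
    and m: "m \<in> linear_maps R M M'" "m' \<in> linear_maps R M' M"
      "\<And>x. x \<in> carrier M \<Longrightarrow> m' (m x) = x" "\<And>y. y \<in> carrier M' \<Longrightarrow> m (m' y) = y"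
  shows "dual_exact R N' P' M' (\<lambda>x. a (i (n' x))) (\<lambda>x. m (p (a' x)))"
proof -
  note D = dual_exactD[OF ses]
  have iso: "module_iso R N N'" "module_iso R P P'" "module_iso R M M'"
    using module_isoI[OF n(1), of n'] module_isoI[OF a(1), of a'] module_isoI[OF m(1), of m'] n a m
    by (auto simp: linear_maps_def)
  note c = linear_mapsD(1)[OF n(1)] linear_mapsD(1)[OF n(2)] linear_mapsD(1)[OF a(1)]
    linear_mapsD(1)[OF a(2)] linear_mapsD(1)[OF m(1)] linear_mapsD(1)[OF m(2)]
    linear_mapsD(1)[OF D(7)] linear_mapsD(1)[OF D(8)]
  have m0: "m x = \<zero>\<^bsub>M'\<^esub> \<longleftrightarrow> x = \<zero>\<^bsub>M\<^esub>" if "x \<in> carrier M" for x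
    using m(3)[OF that] linear_maps_zero[OF D(6) M' m(1)] linear_maps_zero[OF M' D(6) m(2)] by metis
  show ?thesis
    unfolding dual_exact_def
  proof (intro conjI ballI)
    show "fg_module R N'" "fg_module R M'" "projective_module R P'"
      using fg_module_iso[OF D(1) N' iso(1)] fg_module_iso[OF D(3) M' iso(3)]
        projective_module_iso[OF D(2) P' iso(2)] by auto
    show "(\<lambda>x. a (i (n' x))) \<in> linear_maps R N' P'"
      by (rule linear_maps_compose[OF n(2) linear_maps_compose[OF D(7) a(1)]])
    show "(\<lambda>x. m (p (a' x))) \<in> linear_maps R P' M'"
      by (rule linear_maps_compose[OF a(2) linear_maps_compose[OF D(8) m(1)]])
    show "inj_on (\<lambda>x. a (i (n' x))) (carrier N')"
    proof (rule inj_onI)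
      fix x y assume xy: "x \<in> carrier N'" "y \<in> carrier N'" "a (i (n' x)) = a (i (n' y))"
      then have "i (n' x) = i (n' y)" using a(3) c by metis
      then have "n' x = n' y" using D(9) c xy by (meson inj_onD)
      then show "x = y" using n(4) xy by metis
    qed
    have "x \<in> (\<lambda>x. a (i (n' x))) ` carrier N' \<longleftrightarrow> a' x \<in> i ` carrier N" if "x \<in> carrier P'" for x
    proof
      assume "x \<in> (\<lambda>x. a (i (n' x))) ` carrier N'"
      then show "a' x \<in> i ` carrier N" using c a(3) by auto
    next
      assume "a' x \<in> i ` carrier N"
      then obtain y where y: "y \<in> carrier N" "a' x = i y" by auto
      have "x = a (i (n' (n y)))" using y a(4)[OF that] n(3) by simp
      then show "x \<in> (\<lambda>x. a (i (n' x))) ` carrier N'" using c y by blast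
    qed
    moreover have "a' x \<in> i ` carrier N \<longleftrightarrow> m (p (a' x)) = \<zero>\<^bsub>M'\<^esub>" if "x \<in> carrier P'" for x
      using that c by (simp add: D(10) map_kernel_def m0)
    ultimately have mem: "x \<in> (\<lambda>x. a (i (n' x))) ` carrier N' \<longleftrightarrow> m (p (a' x)) = \<zero>\<^bsub>M'\<^esub>" if "x \<in> carrier P'" for x
      using that by simp
    have "(\<lambda>x. a (i (n' x))) ` carrier N' = {x \<in> carrier P'. x \<in> (\<lambda>x. a (i (n' x))) ` carrier N'}"
      by (auto simp: c)
    also have "\<dots> = map_kernel P' M' (\<lambda>x. m (p (a' x)))"
      unfolding map_kernel_def by (intro Collect_cong conj_cong refl mem)
    finally show "(\<lambda>x. a (i (n' x))) ` carrier N' = map_kernel P' M' (\<lambda>x. m (p (a' x)))" .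
    show "(\<lambda>x. m (p (a' x))) ` carrier P' = carrier M'"
    proof (intro equalityI subsetI)
      fix y assume y: "y \<in> carrier M'"
      then have "m' y \<in> p ` carrier P" by (simp add: c D(11))
      then obtain x where x: "x \<in> carrier P" "m' y = p x" by auto
      then have "y = m (p (a' (a x)))" using m(4)[OF y] by (simp add: a(3))
      then show "y \<in> (\<lambda>x. m (p (a' x))) ` carrier P'" by (rule image_eqI) (rule c(3)[OF x(1)])
    qed (auto simp: c)
    fix h assume h: "h \<in> functionals R N'"
    obtain k where k: "k \<in> functionals R P" "\<forall>x\<in>carrier N. k (i x) = h (n x)"
      using D(12)[OF linear_maps_compose[OF n(1) h]] by auto
    show "\<exists>k\<in>functionals R P'. \<forall>x\<in>carrier N'. k (a (i (n' x))) = h x"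
      by (rule bexI[OF _ linear_maps_compose[OF a(2) k(1)]]) (simp add: k(2) c a(3) n(4))
  qed
qed

lemma dual_exact_iso:
  assumes ses: "dual_exact R N P M i p"
    and N': "module_iso R N N'" "left_module R N'"
    and P': "module_iso R P P'" "left_module R P'"
    and M': "module_iso R M M'" "left_module R M'"
  obtains i' p' where "dual_exact R N' P' M' i' p'"
proof -
  note D = dual_exactD[OF ses]
  obtain n n' where n: "n \<in> linear_maps R N N'" "n' \<in> linear_maps R N' N"
    "\<And>x. x \<in> carrier N \<Longrightarrow> n' (n x) = x" "\<And>y. y \<in> carrier N' \<Longrightarrow> n (n' y) = y"
    by (rule module_isoE[OF N'(1) D(4) N'(2)]) (rule that)
  obtain a a' where a: "a \<in> linear_maps R P P'" "a' \<in> linear_maps R P' P"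
    "\<And>x. x \<in> carrier P \<Longrightarrow> a' (a x) = x" "\<And>y. y \<in> carrier P' \<Longrightarrow> a (a' y) = y"
    by (rule module_isoE[OF P'(1) D(5) P'(2)]) (rule that)
  obtain m m' where m: "m \<in> linear_maps R M M'" "m' \<in> linear_maps R M' M"
    "\<And>x. x \<in> carrier M \<Longrightarrow> m' (m x) = x" "\<And>y. y \<in> carrier M' \<Longrightarrow> m (m' y) = y"
    by (rule module_isoE[OF M'(1) D(6) M'(2)]) (rule that)
  show ?thesis
    by (rule that[OF dual_exact_transport[OF ses N'(2) P'(2) M'(2) n a m]])
qed

lemma dual_exact_small:
  fixes P :: "('a, 'c, 'n) module_scheme"
  assumes ses: "dual_exact R N P M i p"
    and N': "module_iso R N N'" "left_module R N'" and M': "module_iso R M M'" "left_module R M'"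
  obtains P' :: "'a small_module" and i' p' where "dual_exact R N' P' M' i' p'"
proof -
  obtain P' :: "'a small_module" where P': "fg_module R P'" "module_iso R P P'"
    using fg_module_small[OF projective_moduleD[OF dual_exactD(2)[OF ses]]] by blast
  show ?thesis by (rule dual_exact_iso[OF ses N' P'(2) fg_moduleD[OF P'(1)] M']) (rule that)
qed


section \<open>Gorenstein-projectivity as a property of classes of modules\<close>

text \<open>Applied with a cokernel as \<open>C\<close>, to compare a module with the cycles of a complex that presents
  it.\<close>

lemma module_iso_via_common_target:
  assumes M: "left_module R M" "module_iso R M C" and Z: "left_module R Z" "module_iso R Z C"
  shows "module_iso R M Z"
proof -
  obtain h where h: "h \<in> linear_maps R M C" "bij_betw h (carrier M) (carrier C)"
    using M(2) by (auto simp: module_iso_def)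
  obtain t where t: "t \<in> linear_maps R Z C" "bij_betw t (carrier Z) (carrier C)"
    using Z(2) by (auto simp: module_iso_def)
  obtain k where k: "k \<in> linear_maps R M Z" "\<forall>x\<in>carrier M. t (k x) = h x"
    using linear_maps_factor_inj[OF Z(1) M(1) t(1) _ h(1)] h(2) t(2) by (auto simp: bij_betw_def)
  have "bij_betw k (carrier M) (carrier Z)"
    unfolding bij_betw_def
  proof
    show "inj_on k (carrier M)" using bij_betw_imp_inj_on[OF h(2)] k(2) by (metis inj_on_def)
    show "k ` carrier M = carrier Z"
    proof (intro equalityI subsetI)
      fix z assume z: "z \<in> carrier Z"
      then have "t z \<in> h ` carrier M" using h(2) linear_mapsD(1)[OF t(1)] by (auto simp: bij_betw_def)
      then obtain x where x: "x \<in> carrier M" "t z = h x" by auto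
      then have "t z = t (k x)" using k(2) by simp
      then have "z = k x"
        by (rule inj_onD[OF bij_betw_imp_inj_on[OF t(2)] _ z linear_mapsD(1)[OF k(1) x(1)]])
      then show "z \<in> k ` carrier M" using x(1) by (rule image_eqI)
    qed (use linear_mapsD(1)[OF k(1)] in auto)
  qed
  with k(1) show ?thesis by (auto simp: module_iso_def)
qed

lemma cokernel_iso:
  assumes P: "left_module R P" and Z: "left_module R Z"
    and p: "p \<in> linear_maps R P Z" "p ` carrier P = carrier Z"
    and im: "d ` carrier Q = map_kernel P Z p"
  shows "module_iso R Z (cokernel Q P d)"
proof -
  interpret P: left_module R P by fact
  interpret Z: left_module R Z by fact
  note pD = linear_mapsD[OF p(1)] linear_maps_zero[OF P Z p(1)] linear_maps_minus[OF P Z p(1)]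
  define t where "t z = {x \<in> carrier P. p x = z}" for z
  have split: "\<exists>n\<in>map_kernel P Z p. y = n \<oplus>\<^bsub>P\<^esub> x"
    if "x \<in> carrier P" "y \<in> carrier P" "p y = p x" for x y
    using that pD
    by (intro bexI[of _ "y \<oplus>\<^bsub>P\<^esub> \<ominus>\<^bsub>P\<^esub> x"]) (auto simp: map_kernel_def P.a_assoc P.l_neg Z.r_neg)
  have coset: "map_kernel P Z p +>\<^bsub>P\<^esub> x = t (p x)" if "x \<in> carrier P" for x
    using that pD split[OF that] by (auto simp: a_r_coset_def' t_def map_kernel_def)
  have lift: "\<exists>x\<in>carrier P. p x = z" if "z \<in> carrier Z" for z
    using that p(2) by (metis imageE)
  have carr: "carrier (cokernel Q P d) = t ` carrier Z"
  proof -
    have "carrier (cokernel Q P d) = (\<Union>x\<in>carrier P. {t (p x)})"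
      by (simp add: cokernel_def quotient_module_def A_RCOSETS_def' im coset)
    also have "\<dots> = t ` carrier Z" unfolding p(2)[symmetric] by auto
    finally show ?thesis .
  qed
  have "t \<in> linear_maps R Z (cokernel Q P d)"
  proof (rule linear_mapsI)
    fix z z' assume z: "z \<in> carrier Z" "z' \<in> carrier Z"
    have "t (z \<oplus>\<^bsub>Z\<^esub> z') = set_add P (t z) (t z')"
    proof (intro equalityI subsetI)
      fix w assume w: "w \<in> t (z \<oplus>\<^bsub>Z\<^esub> z')"
      then have wc: "w \<in> carrier P" "p w = z \<oplus>\<^bsub>Z\<^esub> z'" by (auto simp: t_def)
      obtain x' where x': "x' \<in> carrier P" "p x' = z'" using lift z by blast
      have "w = (w \<oplus>\<^bsub>P\<^esub> \<ominus>\<^bsub>P\<^esub> x') \<oplus>\<^bsub>P\<^esub> x'" using wc x' by (simp add: P.a_assoc P.l_neg)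
      moreover have "p (w \<oplus>\<^bsub>P\<^esub> \<ominus>\<^bsub>P\<^esub> x') = z"
        using wc x' z by (simp add: pD Z.a_assoc Z.r_neg)
      moreover have "w \<oplus>\<^bsub>P\<^esub> \<ominus>\<^bsub>P\<^esub> x' \<in> carrier P" using wc x' by simp
      ultimately show "w \<in> set_add P (t z) (t z')"
        unfolding set_add_def' t_def using x'
        by (intro UN_I[of "w \<oplus>\<^bsub>P\<^esub> \<ominus>\<^bsub>P\<^esub> x'"] UN_I[of x']) blast+
    qed (use pD in \<open>auto simp: set_add_def' t_def\<close>)
    then show "t (z \<oplus>\<^bsub>Z\<^esub> z') = t z \<oplus>\<^bsub>cokernel Q P d\<^esub> t z'"
      by (simp add: cokernel_def quotient_module_def)
  next
    fix r z assume r: "r \<in> carrier R" and z: "z \<in> carrier Z"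
    have "map_kernel P Z p +>\<^bsub>P\<^esub> (r \<odot>\<^bsub>P\<^esub> x) = t (r \<odot>\<^bsub>Z\<^esub> z)" if "x \<in> t z" for x
      using that coset[of "r \<odot>\<^bsub>P\<^esub> x"] r by (auto simp: t_def pD)
    moreover have "t z \<noteq> {}" using lift[OF z] by (auto simp: t_def)
    ultimately show "t (r \<odot>\<^bsub>Z\<^esub> z) = r \<odot>\<^bsub>cokernel Q P d\<^esub> t z"
      by (simp add: cokernel_def quotient_module_def im)
  qed (simp add: carr)
  moreover have "inj_on t (carrier Z)"
  proof (rule inj_onI)
    fix z z' assume "z \<in> carrier Z" "t z = t z'"
    moreover then obtain x where "x \<in> t z" using lift[of z] by (auto simp: t_def)
    ultimately show "z = z'" by (auto simp: t_def)
  qed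
  ultimately show ?thesis by (auto simp: module_iso_def bij_betw_def carr)
qed

lemma left_module_image:
  assumes L: "left_module R L" and M: "left_module R M" and h: "h \<in> linear_maps R L M"
  shows "left_module R (M\<lparr>carrier := h ` carrier L\<rparr>)"
proof -
  interpret L: left_module R L by fact
  interpret M: left_module R M by fact
  note hD = linear_mapsD[OF h] linear_maps_zero[OF L M h] linear_maps_minus[OF L M h]
  have add: "h x \<oplus>\<^bsub>M\<^esub> h y \<in> h ` carrier L" if "x \<in> carrier L" "y \<in> carrier L" for x y
    using that hD(2)[symmetric] by auto
  have smult: "r \<odot>\<^bsub>M\<^esub> h x \<in> h ` carrier L" if "r \<in> carrier R" "x \<in> carrier L" for r x
    using that hD(3)[symmetric] by auto
  have zero: "\<zero>\<^bsub>M\<^esub> \<in> h ` carrier L" using hD(4) by (metis L.zero_closed imageI)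
  have neg: "\<exists>y\<in>carrier L. h x \<oplus>\<^bsub>M\<^esub> h y = \<zero>\<^bsub>M\<^esub>" if "x \<in> carrier L" for x
    using that by (intro bexI[of _ "\<ominus>\<^bsub>L\<^esub> x"]) (auto simp: hD M.r_neg)
  have "abelian_group (M\<lparr>carrier := h ` carrier L\<rparr>)"
    by (rule abelian_groupI) (auto simp: add zero neg hD(1) M.a_ac)
  then show ?thesis
    by (intro left_module.intro left_module_axioms.intro L.R.ring_axioms)
       (auto simp: smult hD(1) M.smult_l_distr M.smult_r_distr M.smult_assoc1)
qed

text \<open>A map \<open>Z\<^sup>i \<rightarrow> R\<close> pulls back along \<open>P\<^sup>i\<^sup>-\<^sup>1 \<rightarrow> Z\<^sup>i\<close> to a cocycle of the dual complex; that
  it is a coboundary says exactly that the original map extends to \<open>P\<^sup>i\<close>.\<close>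

lemma totally_acyclic_cycles:
  fixes P :: "int \<Rightarrow> ('a, 'b) module"
  assumes "totally_acyclic R P d"
  defines "Z \<equiv> \<lambda>i. (P i)\<lparr>carrier := d (i - 1) ` carrier (P (i - 1))\<rparr>"
  shows "dual_exact R (Z i) (P i) (Z (i + 1)) (\<lambda>x. x) (d i)"
    and "module_iso R (Z 1) (cokernel (P (- 1)) (P 0) (d (- 1)))"
proof -
  have proj: "projective_module R (P i)" for i using assms(1) by (simp add: totally_acyclic_def)
  note fg = projective_moduleD[OF proj] and mod = fg_moduleD[OF projective_moduleD[OF proj]]
  have d: "d i \<in> linear_maps R (P i) (P (i + 1))" for i
    using assms(1) by (simp add: totally_acyclic_def acyclic_complex_def)
  have dm: "d (i - 1) \<in> linear_maps R (P (i - 1)) (P i)" for i using d[of "i - 1"] by simp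
  have exact: "d i ` carrier (P i) = map_kernel (P (i + 1)) (P (i + 2)) (d (i + 1))" for i
    using assms(1) by (simp add: totally_acyclic_def acyclic_complex_def)
  have exactm: "d (i - 1) ` carrier (P (i - 1)) = map_kernel (P i) (P (i + 1)) (d i)" for i
    using exact[of "i - 1"] by (simp add: add.commute)
  have modZ: "left_module R (Z i)" for i
    unfolding Z_def using left_module_image[OF mod mod dm] .
  have ZZ: "carrier (Z (i + 1)) = d i ` carrier (P i)" for i by (simp add: Z_def)
  have linZ: "d i \<in> linear_maps R (P i) (Z (i + 1))" for i
    using linear_mapsD[OF d[of i]] by (intro linear_mapsI) (auto simp: Z_def)
  have linZm: "d (i - 1) \<in> linear_maps R (P (i - 1)) (Z i)" for i using linZ[of "i - 1"] by simp
  have fgZ: "fg_module R (Z (i + 1))" for i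
    by (rule fg_module_image[OF fg modZ linZ]) (simp add: ZZ)
  have fgZm: "fg_module R (Z i)" for i using fgZ[of "i - 1"] by simp
  have incl: "(\<lambda>x. x) \<in> linear_maps R (Z i) (P i)" for i
    using linear_mapsD(1)[OF dm] by (intro linear_mapsI) (auto simp: Z_def)
  have kerZ: "map_kernel (P i) (Z (i + 1)) (d i) = carrier (Z i)" for i
    by (simp add: Z_def exactm map_kernel_def)
  have ext: "\<exists>k\<in>functionals R (P i). \<forall>x\<in>carrier (Z i). k x = h x"
    if h: "h \<in> functionals R (Z i)" for h i
  proof -
    have ring: "ring R" using modZ[of i] by (simp add: left_module_def)
    note reg = left_module_regular[OF ring]
    define H where "H = (\<lambda>x\<in>carrier (P (i - 1)). h (d (i - 1) x))"
    have "(\<lambda>x. h (d (i - 1) x)) \<in> functionals R (P (i - 1))"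
      by (rule linear_maps_compose[OF linZm h])
    then have HH: "H \<in> Hom R (P (i - 1)) (regular_module R)"
      using left_module.smult_closed[OF mod] abelian_monoid.a_closed[of "P (i - 1)"]
        abelian_group.axioms(1)[OF left_module.axioms(2)[OF mod[of "i - 1"]]]
      by (auto simp: Hom_def H_def linear_maps_def)
    have "H (d (i - 2) x) = \<zero>\<^bsub>R\<^esub>" if x: "x \<in> carrier (P (i - 2))" for x
    proof -
      have "d (i - 2) x \<in> map_kernel (P (i - 1)) (P i) (d (i - 1))"
        using exactm[of "i - 1"] x by auto
      then show ?thesis
        using linear_maps_zero[OF modZ reg h] by (simp add: map_kernel_def H_def Z_def)
    qed
    then have "hom_pullback (P (i - 2)) (d (i - 2)) H = (\<lambda>x\<in>carrier (P (i - 2)). \<zero>\<^bsub>R\<^esub>)"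
      by (auto simp: hom_pullback_def compose_def)
    with HH have "H \<in> {h \<in> Hom R (P (i - 1)) (regular_module R).
        hom_pullback (P (i - 1 - 1)) (d (i - 1 - 1)) h = (\<lambda>x\<in>carrier (P (i - 1 - 1)). \<zero>\<^bsub>R\<^esub>)}"
      by simp
    also have "\<dots> = hom_pullback (P (i - 1)) (d (i - 1)) ` Hom R (P (i - 1 + 1)) (regular_module R)"
      using assms(1) unfolding totally_acyclic_def acyclic_dual_def by metis
    finally obtain k where k: "k \<in> Hom R (P i) (regular_module R)"
      "H = hom_pullback (P (i - 1)) (d (i - 1)) k" by auto
    have "k (d (i - 1) x) = h (d (i - 1) x)" if "x \<in> carrier (P (i - 1))" for x
      using fun_cong[OF k(2), of x] that by (simp add: H_def hom_pullback_def compose_def)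
    with k(1) show ?thesis by (auto simp: Hom_def Z_def intro!: bexI[of _ k])
  qed
  show "dual_exact R (Z i) (P i) (Z (i + 1)) (\<lambda>x. x) (d i)"
    unfolding dual_exact_def using fgZm proj incl linZ kerZ ZZ ext by auto
  show "module_iso R (Z 1) (cokernel (P (- 1)) (P 0) (d (- 1)))"
    using linZ[of 0] ZZ[of 0] kerZ[of 0] modZ[of 1]
    by (intro cokernel_iso[OF mod, where p = "d 0"]) (simp_all add: Z_def)
qed

text \<open>A cocycle on \<open>P\<^sup>i\<close> kills the kernel of \<open>P\<^sup>i \<rightarrow> Z\<^sup>i\<^sup>+\<^sup>1\<close>, so it comes from \<open>Z\<^sup>i\<^sup>+\<^sup>1\<close>; extending that
  map to \<open>P\<^sup>i\<^sup>+\<^sup>1\<close> exhibits it as a coboundary.\<close>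

lemma totally_acyclic_splice:
  fixes P :: "int \<Rightarrow> ('a, 'b) module"
  assumes ses: "\<And>i. dual_exact R (Z i) (P i) (Z (i + 1)) (\<iota> i) (\<pi> i)"
  defines "d \<equiv> \<lambda>i x. \<iota> (i + 1) (\<pi> i x)"
  shows "totally_acyclic R P d"
    and "module_iso R (Z 1) (cokernel (P (- 1)) (P 0) (d (- 1)))"
proof -
  note D = dual_exactD[OF ses]
  have ker: "map_kernel (P i) (P (i + 1)) (d i) = map_kernel (P i) (Z (i + 1)) (\<pi> i)" for i
  proof -
    have "\<iota> (i + 1) z = \<zero>\<^bsub>P (i + 1)\<^esub> \<longleftrightarrow> z = \<zero>\<^bsub>Z (i + 1)\<^esub>" if "z \<in> carrier (Z (i + 1))" for z
      using D(9)[of "i + 1"] linear_maps_inj_iff[OF D(4) D(5) D(7), of "i + 1"] that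
        linear_maps_zero[OF D(4) D(5) D(7), of "i + 1"] by auto
    then show ?thesis using linear_mapsD(1)[OF D(8)] by (auto simp: map_kernel_def d_def)
  qed
  have img: "d i ` carrier (P i) = \<iota> (i + 1) ` carrier (Z (i + 1))" for i
    unfolding D(11)[symmetric] by (simp add: d_def image_image)
  have imgm: "d (i - 1) ` carrier (P (i - 1)) = map_kernel (P i) (Z (i + 1)) (\<pi> i)" for i
    using img[of "i - 1"] D(10)[of i] by simp
  have lin: "d i \<in> linear_maps R (P i) (P (i + 1))" for i
    unfolding d_def by (rule linear_maps_compose[OF D(8) D(7)])
  have ac: "acyclic_complex R P d"
    unfolding acyclic_complex_def
  proof (intro conjI allI)
    fix i show "d i ` carrier (P i) = map_kernel (P (i + 1)) (P (i + 2)) (d (i + 1))"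
      using imgm[of "i + 1"] ker[of "i + 1"] by (simp add: add.commute)
  qed (rule lin)
  have "acyclic_dual R P d"
    unfolding acyclic_dual_def
  proof (intro allI equalityI subsetI)
    fix i h
    assume "h \<in> hom_pullback (P i) (d i) ` Hom R (P (i + 1)) (regular_module R)"
    then obtain k where k: "k \<in> Hom R (P (i + 1)) (regular_module R)" "h = hom_pullback (P i) (d i) k"
      by auto
    have kl: "k \<in> functionals R (P (i + 1))" using k(1) by (simp add: Hom_def)
    have ring: "ring R" using D(4)[of i] by (simp add: left_module_def)
    interpret Pi: left_module R "P i" by (rule D(5))
    have "h \<in> Hom R (P i) (regular_module R)"
      using linear_maps_compose[OF lin kl] unfolding k(2)
      by (auto simp: Hom_def hom_pullback_def compose_def linear_maps_def)
    moreover have "h (d (i - 1) x) = \<zero>\<^bsub>R\<^esub>" if "x \<in> carrier (P (i - 1))" for x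
    proof -
      have "d (i - 1) x \<in> map_kernel (P i) (P (i + 1)) (d i)" using that imgm[of i] ker[of i] by auto
      then show ?thesis
        using linear_maps_zero[OF D(5) left_module_regular[OF ring] kl]
        by (simp add: k(2) hom_pullback_def compose_def map_kernel_def)
    qed
    ultimately show "h \<in> {h \<in> Hom R (P i) (regular_module R).
        hom_pullback (P (i - 1)) (d (i - 1)) h = (\<lambda>x\<in>carrier (P (i - 1)). \<zero>\<^bsub>R\<^esub>)}"
      by (auto simp: hom_pullback_def compose_def)
  next
    fix i h
    assume "h \<in> {h \<in> Hom R (P i) (regular_module R).
        hom_pullback (P (i - 1)) (d (i - 1)) h = (\<lambda>x\<in>carrier (P (i - 1)). \<zero>\<^bsub>R\<^esub>)}"
    then have h: "h \<in> functionals R (P i)" "h \<in> extensional (carrier (P i))"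
      and h0: "hom_pullback (P (i - 1)) (d (i - 1)) h = (\<lambda>x\<in>carrier (P (i - 1)). \<zero>\<^bsub>R\<^esub>)"
      by (auto simp: Hom_def)
    have ring: "ring R" using D(4)[of i] by (simp add: left_module_def)
    interpret Pj: left_module R "P (i + 1)" by (rule D(5))
    have van: "h x = \<zero>\<^bsub>R\<^esub>" if "x \<in> carrier (P i)" "\<pi> i x = \<zero>\<^bsub>Z (i + 1)\<^esub>" for x
    proof -
      have "x \<in> d (i - 1) ` carrier (P (i - 1))" using that imgm[of i] by (simp add: map_kernel_def)
      then obtain y where "y \<in> carrier (P (i - 1))" "x = d (i - 1) y" by auto
      then show ?thesis using fun_cong[OF h0, of y] by (simp add: hom_pullback_def compose_def)
    qed
    obtain g where g: "g \<in> functionals R (Z (i + 1))"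
      "\<forall>x\<in>carrier (P i). g (\<pi> i x) = h x"
      using linear_maps_factor_surj[OF D(5) D(4) left_module_regular[OF ring] D(8) D(11) h(1)] van
      by auto
    obtain k where k: "k \<in> functionals R (P (i + 1))"
      "\<forall>x\<in>carrier (Z (i + 1)). k (\<iota> (i + 1) x) = g x"
      using D(12)[OF g(1)] by auto
    have "restrict k (carrier (P (i + 1))) \<in> Hom R (P (i + 1)) (regular_module R)"
      using k(1) by (auto simp: Hom_def linear_maps_def)
    moreover have "h = hom_pullback (P i) (d i) (restrict k (carrier (P (i + 1))))"
    proof (rule extensionalityI[OF h(2)])
      fix x assume x: "x \<in> carrier (P i)"
      show "h x = hom_pullback (P i) (d i) (restrict k (carrier (P (i + 1)))) x"
        using x g(2) k(2) linear_mapsD(1)[OF D(8) x] linear_mapsD(1)[OF lin x]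
        by (simp add: hom_pullback_def compose_def) (simp add: d_def)
    qed (simp add: hom_pullback_def)
    ultimately show "h \<in> hom_pullback (P i) (d i) ` Hom R (P (i + 1)) (regular_module R)" by blast
  qed
  with ac D(2) show "totally_acyclic R P d" by (auto simp: totally_acyclic_def)
  show "module_iso R (Z 1) (cokernel (P (- 1)) (P 0) (d (- 1)))"
    using D(4)[of 1] D(5)[of 0] D(8)[of 0] D(11)[of 0] imgm[of 0]
    by (intro cokernel_iso[where p = "\<pi> 0"]) simp_all
qed

lemma gorenstein_projectiveD:
  "gorenstein_projective R M \<Longrightarrow> fg_module R M" "gorenstein_projective R M \<Longrightarrow> left_module R M"
  by (simp_all add: gorenstein_projective_def fg_module_def)

lemma gorenstein_projective_iso:
  assumes M: "gorenstein_projective R M" and M': "left_module R M'" "module_iso R M M'"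
  shows "gorenstein_projective R M'"
proof -
  have "module_iso R M' M" using module_iso_sym[OF M'(2) gorenstein_projectiveD(2)[OF M] M'(1)] .
  moreover have "fg_module R M'" using fg_module_iso[OF gorenstein_projectiveD(1)[OF M] M'] .
  ultimately show ?thesis
    using M unfolding gorenstein_projective_def by (meson module_iso_trans)
qed

text \<open>Splicing: a class closed under forming kernels and cokernels of suitable exact sequences
  yields, by dependent choice in both directions, a totally acyclic complex through each member.\<close>

lemma gorenstein_projective_coinduct:
  fixes C :: "('a, 'b) module \<Rightarrow> bool"
  assumes left: "\<And>M. C M \<Longrightarrow> \<exists>N (P :: ('a, 'c) module) i p. C N \<and> dual_exact R N P M i p"
    and right: "\<And>M. C M \<Longrightarrow> \<exists>N (P :: ('a, 'd) module) i p. C N \<and> dual_exact R M P N i p"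
    and M: "C M"
  shows "gorenstein_projective R M"
proof -
  have small: "\<exists>(P' :: 'a small_module) i p. dual_exact R N P' M i p"
    if "dual_exact R N P M i p" for N M :: "('a, 'b) module" and P :: "('a, 'q) module" and i p
    using dual_exact_small[OF that module_iso_refl dual_exactD(4)[OF that] module_iso_refl
        dual_exactD(6)[OF that]] by metis
  have "\<exists>N (P :: 'a small_module) i p. C N \<and> dual_exact R N P M i p" if "C M" for M
    using left[OF that] small by meson
  then obtain KL :: "('a, 'b) module \<Rightarrow> ('a, 'b) module" and PL :: "('a, 'b) module \<Rightarrow> 'a small_module"
    and iL pL where L: "\<And>M. C M \<Longrightarrow> C (KL M) \<and> dual_exact R (KL M) (PL M) M (iL M) (pL M)"
    by metis
  have "\<exists>N (P :: 'a small_module) i p. C N \<and> dual_exact R M P N i p" if "C M" for M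
    using right[OF that] small by meson
  then obtain KR :: "('a, 'b) module \<Rightarrow> ('a, 'b) module" and PR :: "('a, 'b) module \<Rightarrow> 'a small_module"
    and iR pR where R: "\<And>M. C M \<Longrightarrow> C (KR M) \<and> dual_exact R M (PR M) (KR M) (iR M) (pR M)"
    by metis
  have CL: "C ((KL ^^ n) M)" for n by (induction n) (use M L in auto)
  have CR: "C ((KR ^^ n) M)" for n by (induction n) (use M R in auto)
  \<comment> \<open>The cokernel of \<open>P\<^sup>-\<^sup>1 \<rightarrow> P\<^sup>0\<close> is the module of cycles in degree \<open>1\<close>, so \<open>M\<close> is placed there.\<close>
  define Z where "Z j = (if j \<ge> 1 then (KR ^^ nat (j - 1)) M else (KL ^^ nat (1 - j)) M)" for j :: int
  have CZ: "C (Z j)" for j by (simp add: Z_def CL CR)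
  have ZR: "Z (j + 1) = KR (Z j)" if "j \<ge> 1" for j
  proof -
    have "nat (j + 1 - 1) = Suc (nat (j - 1))" using that by simp
    then show ?thesis using that unfolding Z_def by (simp only: funpow.simps) simp
  qed
  have ZL: "Z j = KL (Z (j + 1))" if "\<not> j \<ge> 1" for j
  proof (cases "j = 0")
    case False
    then have "nat (1 - j) = Suc (nat (1 - (j + 1)))" using that by simp
    then show ?thesis using that False unfolding Z_def by (simp only: funpow.simps) simp
  qed (simp add: Z_def)
  define P where "P j = (if j \<ge> 1 then PR (Z j) else PL (Z (j + 1)))" for j
  define \<iota> where "\<iota> j = (if j \<ge> 1 then iR (Z j) else iL (Z (j + 1)))" for j
  define \<pi> where "\<pi> j = (if j \<ge> 1 then pR (Z j) else pL (Z (j + 1)))" for j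
  have ses: "dual_exact R (Z j) (P j) (Z (j + 1)) (\<iota> j) (\<pi> j)" for j
    using R[OF CZ[of j]] L[OF CZ[of "j + 1"]] ZR[of j] ZL[of j]
    by (cases "j \<ge> 1") (simp_all add: P_def \<iota>_def \<pi>_def)
  note splice = totally_acyclic_splice[where Z = Z and P = P and \<iota> = \<iota> and \<pi> = \<pi>, OF ses]
  have "Z 1 = M" by (simp add: Z_def)
  then have "module_iso R M (cokernel (P (- 1)) (P 0) (\<lambda>x. \<iota> (- 1 + 1) (\<pi> (- 1) x)))" and "fg_module R M"
    using splice(2) dual_exactD(1)[OF ses[of 1]] by simp_all
  then show ?thesis
    unfolding gorenstein_projective_def using splice(1) by blast
qed

text \<open>All cycles of a totally acyclic complex are Gorenstein-projective, since together they form a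
  class to which coinduction applies.\<close>

lemma gorenstein_projective_cycles:
  assumes "gorenstein_projective R (M :: ('a, 'b, 'm) module_scheme)"
  obtains Z P :: "int \<Rightarrow> 'a small_module" and \<iota> \<pi>
  where "\<And>i. dual_exact R (Z i) (P i) (Z (i + 1)) (\<iota> i) (\<pi> i)" "module_iso R (Z 1) M"
    "\<And>i. gorenstein_projective R (Z i)"
proof -
  obtain P :: "int \<Rightarrow> 'a small_module" and d
    where P: "totally_acyclic R P d" "module_iso R M (cokernel (P (-1)) (P 0) (d (-1)))"
    using assms by (auto simp: gorenstein_projective_def)
  define Z where "Z i = (P i)\<lparr>carrier := d (i - 1) ` carrier (P (i - 1))\<rparr>" for i
  note ses = totally_acyclic_cycles(1)[OF P(1), folded Z_def]
  have "module_iso R (Z 1) (cokernel (P (-1)) (P 0) (d (-1)))"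
    unfolding Z_def using totally_acyclic_cycles(2)[OF P(1)] .
  then have iso: "module_iso R (Z 1) M"
    using module_iso_via_common_target[OF dual_exactD(4)[OF ses] _ gorenstein_projectiveD(2)[OF assms] P(2)]
    by blast
  have "gorenstein_projective R (Z j)" for j
  proof (rule gorenstein_projective_coinduct[where C = "\<lambda>N. \<exists>i. N = Z i"])
    fix M' assume "\<exists>i. M' = Z i"
    then obtain i where i: "M' = Z i" by blast
    have "dual_exact R (Z (i - 1)) (P (i - 1)) M' (\<lambda>x. x) (d (i - 1))" using ses[of "i - 1"] i by simp
    then show "\<exists>N (P :: 'a small_module) i p. (\<exists>i. N = Z i) \<and> dual_exact R N P M' i p" by blast
    show "\<exists>N (P :: 'a small_module) i p. (\<exists>i. N = Z i) \<and> dual_exact R M' P N i p" using ses[of i] i by blast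
  qed blast
  from that[OF ses iso this] show ?thesis .
qed

lemma gorenstein_projective_syzygy:
  assumes M: "gorenstein_projective R (M :: ('a, 'b, 'm) module_scheme)"
  obtains N P :: "'a small_module" and i p
  where "gorenstein_projective R N" "dual_exact R N P M i p"
proof -
  obtain Z P :: "int \<Rightarrow> 'a small_module" and \<iota> \<pi>
    where Z: "\<And>i. dual_exact R (Z i) (P i) (Z (i + 1)) (\<iota> i) (\<pi> i)" "module_iso R (Z 1) M"
      "\<And>i. gorenstein_projective R (Z i)"
    by (rule gorenstein_projective_cycles[OF M]) (rule that)
  have ses: "dual_exact R (Z 0) (P 0) (Z 1) (\<iota> 0) (\<pi> 0)" using Z(1)[of 0] by simp
  obtain i' p' where "dual_exact R (Z 0) (P 0) M i' p'"
    by (rule dual_exact_iso[OF ses module_iso_refl dual_exactD(4)[OF ses] module_iso_refl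
        dual_exactD(5)[OF ses] Z(2) gorenstein_projectiveD(2)[OF M]]) (rule that)
  with Z(3) show ?thesis by (rule that)
qed

lemma gorenstein_projective_cosyzygy:
  assumes M: "gorenstein_projective R (M :: ('a, 'b, 'm) module_scheme)"
  obtains N P :: "'a small_module" and i p
  where "gorenstein_projective R N" "dual_exact R M P N i p"
proof -
  obtain Z P :: "int \<Rightarrow> 'a small_module" and \<iota> \<pi>
    where Z: "\<And>i. dual_exact R (Z i) (P i) (Z (i + 1)) (\<iota> i) (\<pi> i)" "module_iso R (Z 1) M"
      "\<And>i. gorenstein_projective R (Z i)"
    by (rule gorenstein_projective_cycles[OF M]) (rule that)
  have ses: "dual_exact R (Z 1) (P 1) (Z 2) (\<iota> 1) (\<pi> 1)" using Z(1)[of 1] by simp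
  obtain i' p' where "dual_exact R M (P 1) (Z 2) i' p'"
    by (rule dual_exact_iso[OF ses Z(2) gorenstein_projectiveD(2)[OF M] module_iso_refl
        dual_exactD(5)[OF ses] module_iso_refl dual_exactD(6)[OF ses]]) (rule that)
  with Z(3) show ?thesis by (rule that)
qed

text \<open>A projective summand can be added to the middle and to either end.\<close>

lemma dual_exact_add_right:
  assumes ses: "dual_exact R N P M i p" and B: "projective_module R B"
  shows "dual_exact R N (direct_sum P B) (direct_sum M B) (\<lambda>x. (i x, \<zero>\<^bsub>B\<^esub>)) (map_prod p (\<lambda>y. y))"
proof -
  note D = dual_exactD[OF ses] and Bm = fg_moduleD[OF projective_moduleD[OF B]]
  interpret B: left_module R B by (rule Bm)
  interpret P: left_module R P by (rule D)
  note pD = linear_mapsD[OF D(8)]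
  show ?thesis
    unfolding dual_exact_def
  proof (intro conjI ballI)
    show "fg_module R N" "projective_module R (direct_sum P B)" "fg_module R (direct_sum M B)"
      using D projective_moduleD[OF B]
      by (simp_all add: projective_module_direct_sum[OF _ B] fg_module_direct_sum)
    show "(\<lambda>x. (i x, \<zero>\<^bsub>B\<^esub>)) \<in> linear_maps R N (direct_sum P B)"
      by (rule linear_maps_compose[OF D(7) direct_sum_inl[OF D(5) Bm]])
    show "map_prod p (\<lambda>y. y) \<in> linear_maps R (direct_sum P B) (direct_sum M B)"
      by (intro linear_mapsI) (auto simp: pD)
    show "inj_on (\<lambda>x. (i x, \<zero>\<^bsub>B\<^esub>)) (carrier N)" using D(9) by (auto simp: inj_on_def)
    have "(\<lambda>x. (i x, \<zero>\<^bsub>B\<^esub>)) ` carrier N = (i ` carrier N) \<times> {\<zero>\<^bsub>B\<^esub>}" by auto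
    then show "(\<lambda>x. (i x, \<zero>\<^bsub>B\<^esub>)) ` carrier N =
        map_kernel (direct_sum P B) (direct_sum M B) (map_prod p (\<lambda>y. y))"
      unfolding D(10) by (auto simp: map_kernel_def)
    show "map_prod p (\<lambda>y. y) ` carrier (direct_sum P B) = carrier (direct_sum M B)"
      using D(11) by (auto simp: map_prod_surj_on)
    fix h assume "h \<in> functionals R N"
    then obtain k where k: "k \<in> functionals R P" "\<forall>x\<in>carrier N. k (i x) = h x"
      using D(12) by blast
    show "\<exists>k\<in>functionals R (direct_sum P B).
        \<forall>x\<in>carrier N. k (i x, \<zero>\<^bsub>B\<^esub>) = h x"
      by (rule bexI[OF _ linear_maps_compose[OF direct_sum_fst[OF D(5) Bm] k(1)]]) (simp add: k(2))
  qed
qed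

lemma dual_exact_add_left:
  assumes ses: "dual_exact R N P M i p" and B: "projective_module R B"
  shows "dual_exact R (direct_sum N B) (direct_sum P B) M (map_prod i (\<lambda>y. y)) (\<lambda>x. p (fst x))"
proof -
  note D = dual_exactD[OF ses] and Bm = fg_moduleD[OF projective_moduleD[OF B]]
  interpret B: left_module R B by (rule Bm)
  interpret P: left_module R P by (rule D)
  interpret N: left_module R N by (rule D)
  note iD = linear_mapsD[OF D(7)]
  note reg = left_module_regular[OF B.R.ring_axioms]
  show ?thesis
    unfolding dual_exact_def
  proof (intro conjI ballI)
    show "fg_module R (direct_sum N B)" "projective_module R (direct_sum P B)" "fg_module R M"
      using D projective_moduleD[OF B]
      by (simp_all add: projective_module_direct_sum[OF _ B] fg_module_direct_sum)
    show "map_prod i (\<lambda>y. y) \<in> linear_maps R (direct_sum N B) (direct_sum P B)"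
      by (intro linear_mapsI) (auto simp: iD)
    show "(\<lambda>x. p (fst x)) \<in> linear_maps R (direct_sum P B) M"
      by (rule linear_maps_compose[OF direct_sum_fst[OF D(5) Bm] D(8)])
    show "inj_on (map_prod i (\<lambda>y. y)) (carrier (direct_sum N B))"
      using D(9) by (auto simp: inj_on_def)
    have "map_prod i (\<lambda>y. y) ` carrier (direct_sum N B) = (i ` carrier N) \<times> carrier B"
      by (auto simp: map_prod_surj_on)
    then show "map_prod i (\<lambda>y. y) ` carrier (direct_sum N B) =
        map_kernel (direct_sum P B) M (\<lambda>x. p (fst x))"
      unfolding D(10) by (auto simp: map_kernel_def)
    have "fst ` carrier (direct_sum P B) = carrier P" by (auto simp: fst_image_times)
    then show "(\<lambda>x. p (fst x)) ` carrier (direct_sum P B) = carrier M"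
      using D(11) by (metis image_image)
    fix h assume h: "h \<in> functionals R (direct_sum N B)"
    obtain k where k: "k \<in> functionals R P" "\<forall>x\<in>carrier N. k (i x) = h (x, \<zero>\<^bsub>B\<^esub>)"
      using D(12)[OF linear_maps_compose[OF direct_sum_inl[OF D(4) Bm] h]] by auto
    define l where "l y = h (\<zero>\<^bsub>N\<^esub>, y)" for y
    have l: "l \<in> functionals R B"
      unfolding l_def by (rule linear_maps_compose[OF direct_sum_inr[OF D(4) Bm] h])
    have "k (i x) \<oplus>\<^bsub>R\<^esub> l y = h (x, y)" if "x \<in> carrier N" "y \<in> carrier B" for x y
      using linear_mapsD(2)[OF h, of "(x, \<zero>\<^bsub>B\<^esub>)" "(\<zero>\<^bsub>N\<^esub>, y)"] that k(2) by (simp add: l_def)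
    then show "\<exists>k\<in>functionals R (direct_sum P B).
        \<forall>x\<in>carrier (direct_sum N B). k (map_prod i (\<lambda>y. y) x) = h x"
      using linear_maps_add[OF reg linear_maps_compose[OF direct_sum_fst[OF D(5) Bm] k(1)]
          linear_maps_compose[OF direct_sum_snd[OF D(5) Bm] l]]
      by (intro bexI[of _ "\<lambda>x. k (fst x) \<oplus>\<^bsub>R\<^esub> l (snd x)"]) auto
  qed
qed

text \<open>Adding \<open>B\<close> to the middle of the sequences around \<open>A\<close> leaves their far ends unchanged, so
  enlarging the class of Gorenstein-projective modules by \<open>A \<oplus> B\<close> keeps it closed under the two steps
  of the coinduction.\<close>

lemma gorenstein_projective_direct_sum:
  fixes A :: "('a, 'b, 'm) module_scheme" and B :: "('a, 'c, 'n) module_scheme"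
  assumes A: "gorenstein_projective R A" and B: "projective_module R B"
  shows "gorenstein_projective R (direct_sum A B)"
proof -
  obtain S :: "'a small_module" where S: "fg_module R S" "module_iso R (direct_sum A B) S"
    using fg_module_small[OF fg_module_direct_sum[OF gorenstein_projectiveD(1)[OF A] projective_moduleD[OF B]]]
    by blast
  note mod = left_module_direct_sum[OF gorenstein_projectiveD(2)[OF A] fg_moduleD[OF projective_moduleD[OF B]]]
    fg_moduleD[OF S(1)]
  have "gorenstein_projective R S"
  proof (rule gorenstein_projective_coinduct[where C = "\<lambda>M. gorenstein_projective R M \<or>
        left_module R M \<and> module_iso R (direct_sum A B) M"])
    fix M :: "'a small_module"
    assume "gorenstein_projective R M \<or> left_module R M \<and> module_iso R (direct_sum A B) M"
    then show "\<exists>(N :: 'a small_module) (P :: 'a small_module) i p.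
        (gorenstein_projective R N \<or> left_module R N \<and> module_iso R (direct_sum A B) N) \<and>
        dual_exact R N P M i p"
    proof (elim disjE conjE)
      assume "gorenstein_projective R M"
      from gorenstein_projective_syzygy[OF this] show ?thesis by metis
    next
      assume M: "left_module R M" "module_iso R (direct_sum A B) M"
      obtain N P :: "'a small_module" and i p
        where N: "gorenstein_projective R N" "dual_exact R N P A i p"
        by (rule gorenstein_projective_syzygy[OF A]) (rule that)
      obtain P' :: "'a small_module" and i' p' where "dual_exact R N P' M i' p'"
        by (rule dual_exact_small[OF dual_exact_add_right[OF N(2) B] module_iso_refl
            gorenstein_projectiveD(2)[OF N(1)] M(2,1)]) (rule that)
      with N(1) show ?thesis by blast
    qed
  next
    fix M :: "'a small_module"
    assume "gorenstein_projective R M \<or> left_module R M \<and> module_iso R (direct_sum A B) M"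
    then show "\<exists>(N :: 'a small_module) (P :: 'a small_module) i p.
        (gorenstein_projective R N \<or> left_module R N \<and> module_iso R (direct_sum A B) N) \<and>
        dual_exact R M P N i p"
    proof (elim disjE conjE)
      assume "gorenstein_projective R M"
      from gorenstein_projective_cosyzygy[OF this] show ?thesis by metis
    next
      assume M: "left_module R M" "module_iso R (direct_sum A B) M"
      obtain N P :: "'a small_module" and i p
        where N: "gorenstein_projective R N" "dual_exact R A P N i p"
        by (rule gorenstein_projective_cosyzygy[OF A]) (rule that)
      obtain P' :: "'a small_module" and i' p' where "dual_exact R M P' N i' p'"
        by (rule dual_exact_small[OF dual_exact_add_left[OF N(2) B] M(2,1) module_iso_refl
            gorenstein_projectiveD(2)[OF N(1)]]) (rule that)
      with N(1) show ?thesis by blast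
    qed
  qed (use S mod in blast)
  then show ?thesis
    using gorenstein_projective_iso mod(1) module_iso_sym[OF S(2) mod] by blast
qed

section \<open>The Morita ring with bimodule map \<open>m \<otimes> n \<mapsto> z m n\<close>\<close>

text \<open>The Morita ring depends on \<open>\<phi>\<close> only through the central element \<open>z\<close>, and all computations in it
  use the formula for \<open>\<phi>\<close> on pure tensors instead of the tensor product.\<close>

locale central_morita = R?: ring R for R :: "('a, 'e) ring_scheme" (structure) +
  fixes \<phi> :: "('a \<times> 'a \<Rightarrow>\<^sub>0 int) set \<Rightarrow> 'a" and z :: 'a
  assumes z_closed [simp]: "z \<in> carrier R"
    and z_central: "r \<in> carrier R \<Longrightarrow> z \<otimes> r = r \<otimes> z"
    and phi_tensor: "m \<in> carrier R \<Longrightarrow> n \<in> carrier R \<Longrightarrow>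
      \<phi> (rtensor R (regular_module R) m n) = z \<otimes> (m \<otimes> n)"
begin

abbreviation \<Delta> :: "'a matrix2 ring" where "\<Delta> \<equiv> morita_ring R \<phi>"

lemma z_left_commute: "r \<in> carrier R \<Longrightarrow> s \<in> carrier R \<Longrightarrow> r \<otimes> (z \<otimes> s) = z \<otimes> (r \<otimes> s)"
  by (metis m_assoc z_central z_closed)

lemma carrier_Delta [simp]:
  "Matrix2 a n m b \<in> carrier \<Delta> \<longleftrightarrow>
    a \<in> carrier R \<and> n \<in> carrier R \<and> m \<in> carrier R \<and> b \<in> carrier R"
  by (simp add: morita_ring_def)

lemma carrier_DeltaE:
  assumes "A \<in> carrier \<Delta>"
  obtains a n m b where "A = Matrix2 a n m b"
    "a \<in> carrier R" "n \<in> carrier R" "m \<in> carrier R" "b \<in> carrier R"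
  using assms by (auto simp: morita_ring_def)

lemma Delta_simps [simp]:
  "Matrix2 a n m b \<oplus>\<^bsub>\<Delta>\<^esub> Matrix2 a' n' m' b' = Matrix2 (a \<oplus> a') (n \<oplus> n') (m \<oplus> m') (b \<oplus> b')"
  "\<zero>\<^bsub>\<Delta>\<^esub> = Matrix2 \<zero> \<zero> \<zero> \<zero>" "\<one>\<^bsub>\<Delta>\<^esub> = Matrix2 \<one> \<zero> \<zero> \<one>"
  by (simp_all add: morita_ring_def)

lemma Delta_mult [simp]:
  assumes "n \<in> carrier R" "m \<in> carrier R" "n' \<in> carrier R" "m' \<in> carrier R"
  shows "Matrix2 a n m b \<otimes>\<^bsub>\<Delta>\<^esub> Matrix2 a' n' m' b' =
    Matrix2 (a \<otimes> a' \<oplus> z \<otimes> (n \<otimes> m')) (a \<otimes> n' \<oplus> n \<otimes> b') (m \<otimes> a' \<oplus> b \<otimes> m') (b \<otimes> b' \<oplus> z \<otimes> (m \<otimes> n'))"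
  using assms by (simp add: morita_ring_def phi_tensor)

lemma ring_Delta: "ring \<Delta>"
proof (rule ringI)
  have neg: "\<exists>B\<in>carrier \<Delta>. B \<oplus>\<^bsub>\<Delta>\<^esub> A = \<zero>\<^bsub>\<Delta>\<^esub>" if "A \<in> carrier \<Delta>" for A
    using that
  proof (rule carrier_DeltaE)
    fix a n m b
    assume "A = Matrix2 a n m b" "a \<in> carrier R" "n \<in> carrier R" "m \<in> carrier R" "b \<in> carrier R"
    then show ?thesis
      by (intro bexI[of _ "Matrix2 (\<ominus> a) (\<ominus> n) (\<ominus> m) (\<ominus> b)"]) (auto simp: l_neg)
  qed
  show "abelian_group \<Delta>"
  proof (rule abelian_groupI)
    show "\<exists>B\<in>carrier \<Delta>. B \<oplus>\<^bsub>\<Delta>\<^esub> A = \<zero>\<^bsub>\<Delta>\<^esub>" if "A \<in> carrier \<Delta>" for A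
      using that by (rule neg)
  qed (auto elim!: carrier_DeltaE simp: a_ac)
  show "monoid \<Delta>"
    by (rule monoidI)
       (auto elim!: carrier_DeltaE simp: l_distr r_distr m_assoc a_ac z_left_commute)
qed (auto elim!: carrier_DeltaE simp: l_distr r_distr a_ac)

text \<open>A left module over the Morita ring is a pair of \<open>R\<close>-modules with maps \<open>f\<close>, \<open>g\<close> between them
  whose two composites are multiplication by \<open>z\<close>.\<close>

definition z_factorization ::
    "('a, 'x, 'm) module_scheme \<Rightarrow> ('a, 'y, 'n) module_scheme \<Rightarrow> ('x \<Rightarrow> 'y) \<Rightarrow> ('y \<Rightarrow> 'x) \<Rightarrow> bool" where
  "z_factorization X Y f g \<longleftrightarrow> fg_module R X \<and> fg_module R Y \<and>
     f \<in> linear_maps R X Y \<and> g \<in> linear_maps R Y X \<and>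
     (\<forall>x\<in>carrier X. g (f x) = z \<odot>\<^bsub>X\<^esub> x) \<and> (\<forall>y\<in>carrier Y. f (g y) = z \<odot>\<^bsub>Y\<^esub> y)"

definition pair_module ::
    "('a, 'x, 'm) module_scheme \<Rightarrow> ('a, 'y, 'n) module_scheme \<Rightarrow> ('x \<Rightarrow> 'y) \<Rightarrow> ('y \<Rightarrow> 'x)
      \<Rightarrow> ('a matrix2, 'x \<times> 'y) module" where
  "pair_module X Y f g =
     \<lparr>carrier = carrier X \<times> carrier Y, mult = undefined, one = undefined,
      zero = (\<zero>\<^bsub>X\<^esub>, \<zero>\<^bsub>Y\<^esub>), add = (\<lambda>(x, y) (x', y'). (x \<oplus>\<^bsub>X\<^esub> x', y \<oplus>\<^bsub>Y\<^esub> y')),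
      smult = (\<lambda>A (x, y). case A of Matrix2 a n m b \<Rightarrow>
        (a \<odot>\<^bsub>X\<^esub> x \<oplus>\<^bsub>X\<^esub> n \<odot>\<^bsub>X\<^esub> g y, b \<odot>\<^bsub>Y\<^esub> y \<oplus>\<^bsub>Y\<^esub> m \<odot>\<^bsub>Y\<^esub> f x))\<rparr>"

lemma pair_module_simps [simp]:
  "carrier (pair_module X Y f g) = carrier X \<times> carrier Y"
  "\<zero>\<^bsub>pair_module X Y f g\<^esub> = (\<zero>\<^bsub>X\<^esub>, \<zero>\<^bsub>Y\<^esub>)"
  "(x, y) \<oplus>\<^bsub>pair_module X Y f g\<^esub> (x', y') = (x \<oplus>\<^bsub>X\<^esub> x', y \<oplus>\<^bsub>Y\<^esub> y')"
  "Matrix2 a n m b \<odot>\<^bsub>pair_module X Y f g\<^esub> (x, y) =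
    (a \<odot>\<^bsub>X\<^esub> x \<oplus>\<^bsub>X\<^esub> n \<odot>\<^bsub>X\<^esub> g y, b \<odot>\<^bsub>Y\<^esub> y \<oplus>\<^bsub>Y\<^esub> m \<odot>\<^bsub>Y\<^esub> f x)"
  by (simp_all add: pair_module_def)

lemma z_factorizationD:
  assumes "z_factorization X Y f g"
  shows "fg_module R X" "fg_module R Y" "left_module R X" "left_module R Y"
    "f \<in> linear_maps R X Y" "g \<in> linear_maps R Y X"
    "x \<in> carrier X \<Longrightarrow> g (f x) = z \<odot>\<^bsub>X\<^esub> x" "y \<in> carrier Y \<Longrightarrow> f (g y) = z \<odot>\<^bsub>Y\<^esub> y"
  using assms by (auto simp: z_factorization_def fg_module_def)

lemma fg_pair_module:
  assumes F: "z_factorization X Y f g"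
  shows "fg_module \<Delta> (pair_module X Y f g)"
proof -
  let ?P = "pair_module X Y f g"
  note D = z_factorizationD[OF F]
  interpret X: left_module R X by (rule D)
  interpret Y: left_module R Y by (rule D)
  note fD = linear_mapsD[OF D(5)] and gD = linear_mapsD[OF D(6)]
  have f0 [simp]: "f \<zero>\<^bsub>X\<^esub> = \<zero>\<^bsub>Y\<^esub>" and g0 [simp]: "g \<zero>\<^bsub>Y\<^esub> = \<zero>\<^bsub>X\<^esub>"
    using linear_maps_zero D by metis+
  have ab: "abelian_group ?P"
    by (rule abelian_groupI)
       (auto simp: X.M.a_ac Y.M.a_ac X.M.l_neg Y.M.l_neg intro!: bexI[of _ "(\<ominus>\<^bsub>X\<^esub> _, \<ominus>\<^bsub>Y\<^esub> _)"])
  have zX: "r \<odot>\<^bsub>X\<^esub> (z \<odot>\<^bsub>X\<^esub> x) = z \<odot>\<^bsub>X\<^esub> (r \<odot>\<^bsub>X\<^esub> x)" if "r \<in> carrier R" "x \<in> carrier X" for r x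
    using that by (metis X.smult_assoc1 z_central z_closed)
  have zY: "r \<odot>\<^bsub>Y\<^esub> (z \<odot>\<^bsub>Y\<^esub> y) = z \<odot>\<^bsub>Y\<^esub> (r \<odot>\<^bsub>Y\<^esub> y)" if "r \<in> carrier R" "y \<in> carrier Y" for r y
    using that by (metis Y.smult_assoc1 z_central z_closed)
  have mod: "left_module \<Delta> ?P"
  proof (intro left_module.intro left_module_axioms.intro ab ring_Delta)
    fix A v assume "A \<in> carrier \<Delta>" "v \<in> carrier ?P"
    then show "A \<odot>\<^bsub>?P\<^esub> v \<in> carrier ?P"
      by (auto elim!: carrier_DeltaE simp: fD gD)
  next
    fix A B v assume "A \<in> carrier \<Delta>" "B \<in> carrier \<Delta>" "v \<in> carrier ?P"
    then show "(A \<oplus>\<^bsub>\<Delta>\<^esub> B) \<odot>\<^bsub>?P\<^esub> v =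
        A \<odot>\<^bsub>?P\<^esub> v \<oplus>\<^bsub>?P\<^esub> B \<odot>\<^bsub>?P\<^esub> v"
      by (auto elim!: carrier_DeltaE
          simp: fD gD X.smult_l_distr Y.smult_l_distr X.M.a_ac Y.M.a_ac)
  next
    fix A v w assume "A \<in> carrier \<Delta>"
      "v \<in> carrier ?P" "w \<in> carrier ?P"
    then show "A \<odot>\<^bsub>?P\<^esub> (v \<oplus>\<^bsub>?P\<^esub> w) =
        A \<odot>\<^bsub>?P\<^esub> v \<oplus>\<^bsub>?P\<^esub> A \<odot>\<^bsub>?P\<^esub> w"
      by (auto elim!: carrier_DeltaE
          simp: fD gD X.smult_r_distr Y.smult_r_distr X.M.a_ac Y.M.a_ac)
  next
    fix A B v assume "A \<in> carrier \<Delta>" "B \<in> carrier \<Delta>" "v \<in> carrier ?P"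
    then show "(A \<otimes>\<^bsub>\<Delta>\<^esub> B) \<odot>\<^bsub>?P\<^esub> v =
        A \<odot>\<^bsub>?P\<^esub> (B \<odot>\<^bsub>?P\<^esub> v)"
      by (auto elim!: carrier_DeltaE
          simp: fD gD X.smult_r_distr Y.smult_r_distr X.smult_l_distr Y.smult_l_distr X.smult_assoc1
            Y.smult_assoc1 X.M.a_ac Y.M.a_ac D zX zY)
  next
    fix v assume "v \<in> carrier ?P"
    then show "\<one>\<^bsub>\<Delta>\<^esub> \<odot>\<^bsub>?P\<^esub> v = v" by (auto simp: fD gD)
  qed
  have "finitely_generated \<Delta> ?P"
  proof (rule finitely_generated_product[of R X Y])
    fix L assume L: "submodule L \<Delta> ?P"
    interpret L: submodule L \<Delta> ?P by fact
    have add: "(x, y) \<in> L \<Longrightarrow> (x', y') \<in> L \<Longrightarrow> (x \<oplus>\<^bsub>X\<^esub> x', y \<oplus>\<^bsub>Y\<^esub> y') \<in> L" for x y x' y'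
      using L.m_closed[of "(x, y)" "(x', y')"] by simp
    have smult: "(x, y) \<in> L \<Longrightarrow> r \<in> carrier R \<Longrightarrow> (r \<odot>\<^bsub>X\<^esub> x, r \<odot>\<^bsub>Y\<^esub> y) \<in> L" for r x y
      using L.smult_closed[of "Matrix2 r \<zero> \<zero> r" "(x, y)"] subsetD[OF L.subset, of "(x, y)"]
      by (simp add: fD gD)
    have zero: "(\<zero>\<^bsub>X\<^esub>, \<zero>\<^bsub>Y\<^esub>) \<in> L" using L.one_closed by simp
    show "submodule {x \<in> carrier X. (x, \<zero>\<^bsub>Y\<^esub>) \<in> L} R X"
    proof (rule X.submodule_closureI)
      fix r x assume "r \<in> carrier R" "x \<in> {x \<in> carrier X. (x, \<zero>\<^bsub>Y\<^esub>) \<in> L}"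
      then show "r \<odot>\<^bsub>X\<^esub> x \<in> {x \<in> carrier X. (x, \<zero>\<^bsub>Y\<^esub>) \<in> L}" using smult[of x "\<zero>\<^bsub>Y\<^esub>" r] by simp
    next
      fix x x' assume "x \<in> {x \<in> carrier X. (x, \<zero>\<^bsub>Y\<^esub>) \<in> L}" "x' \<in> {x \<in> carrier X. (x, \<zero>\<^bsub>Y\<^esub>) \<in> L}"
      then show "x \<oplus>\<^bsub>X\<^esub> x' \<in> {x \<in> carrier X. (x, \<zero>\<^bsub>Y\<^esub>) \<in> L}"
        using add[of x "\<zero>\<^bsub>Y\<^esub>" x' "\<zero>\<^bsub>Y\<^esub>"] by simp
    qed (use zero in auto)
    show "submodule {y \<in> carrier Y. (\<zero>\<^bsub>X\<^esub>, y) \<in> L} R Y"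
    proof (rule Y.submodule_closureI)
      fix r y assume "r \<in> carrier R" "y \<in> {y \<in> carrier Y. (\<zero>\<^bsub>X\<^esub>, y) \<in> L}"
      then show "r \<odot>\<^bsub>Y\<^esub> y \<in> {y \<in> carrier Y. (\<zero>\<^bsub>X\<^esub>, y) \<in> L}" using smult[of "\<zero>\<^bsub>X\<^esub>" y r] by simp
    next
      fix y y' assume "y \<in> {y \<in> carrier Y. (\<zero>\<^bsub>X\<^esub>, y) \<in> L}" "y' \<in> {y \<in> carrier Y. (\<zero>\<^bsub>X\<^esub>, y) \<in> L}"
      then show "y \<oplus>\<^bsub>Y\<^esub> y' \<in> {y \<in> carrier Y. (\<zero>\<^bsub>X\<^esub>, y) \<in> L}"
        using add[of "\<zero>\<^bsub>X\<^esub>" y "\<zero>\<^bsub>X\<^esub>" y'] by simp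
    qed (use zero in auto)
  qed (use D in \<open>auto simp: fg_module_def\<close>)
  with mod show ?thesis by (simp add: fg_module_def)
qed

lemmas left_module_pair_module = fg_moduleD[OF fg_pair_module]

lemma pair_module_map:
  assumes F: "z_factorization X Y f g" and F': "z_factorization X' Y' f' g'"
    and h: "h \<in> linear_maps R X X'" and k: "k \<in> linear_maps R Y Y'"
    and fh: "\<And>x. x \<in> carrier X \<Longrightarrow> k (f x) = f' (h x)"
    and gk: "\<And>y. y \<in> carrier Y \<Longrightarrow> h (g y) = g' (k y)"
  shows "map_prod h k \<in> linear_maps \<Delta> (pair_module X Y f g) (pair_module X' Y' f' g')"
proof -
  note D = z_factorizationD[OF F]
  interpret X: left_module R X by (rule D)
  interpret Y: left_module R Y by (rule D)
  note lin = linear_mapsD[OF h] linear_mapsD[OF k] linear_mapsD[OF D(5)] linear_mapsD[OF D(6)]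
  show ?thesis
    by (rule linear_mapsI) (auto elim!: carrier_DeltaE simp: lin fh gk)
qed

text \<open>The two diagonal idempotents force a \<open>\<Delta>\<close>-linear map to respect the two components, and the
  off-diagonal units force it to commute with the structure maps.\<close>

lemma pair_module_map_cases:
  assumes F: "z_factorization X Y f g" and F': "z_factorization X' Y' f' g'"
    and H: "H \<in> linear_maps \<Delta> (pair_module X Y f g) (pair_module X' Y' f' g')"
  obtains h k where "h \<in> linear_maps R X X'" "k \<in> linear_maps R Y Y'"
    "\<And>x. x \<in> carrier X \<Longrightarrow> k (f x) = f' (h x)" "\<And>y. y \<in> carrier Y \<Longrightarrow> h (g y) = g' (k y)"
    "\<And>x y. x \<in> carrier X \<Longrightarrow> y \<in> carrier Y \<Longrightarrow> H (x, y) = (h x, k y)"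
proof -
  note D = z_factorizationD[OF F] and D' = z_factorizationD[OF F']
  interpret X: left_module R X by (rule D)
  interpret Y: left_module R Y by (rule D)
  interpret X': left_module R X' by (rule D')
  interpret Y': left_module R Y' by (rule D')
  note fgD = linear_mapsD[OF D(5)] linear_mapsD[OF D(6)] linear_mapsD[OF D'(5)] linear_mapsD[OF D'(6)]
  note HD = linear_mapsD[OF H]
  have [simp]: "f \<zero>\<^bsub>X\<^esub> = \<zero>\<^bsub>Y\<^esub>" "g \<zero>\<^bsub>Y\<^esub> = \<zero>\<^bsub>X\<^esub>" "f' \<zero>\<^bsub>X'\<^esub> = \<zero>\<^bsub>Y'\<^esub>" "g' \<zero>\<^bsub>Y'\<^esub> = \<zero>\<^bsub>X'\<^esub>"
    using linear_maps_zero D D' by metis+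
  define h where "h x = fst (H (x, \<zero>\<^bsub>Y\<^esub>))" for x
  define k where "k y = snd (H (\<zero>\<^bsub>X\<^esub>, y))" for y
  have hc: "h x \<in> carrier X'" and Hx: "H (x, \<zero>\<^bsub>Y\<^esub>) = (h x, \<zero>\<^bsub>Y'\<^esub>)" if x: "x \<in> carrier X" for x
  proof -
    obtain x' y' where xy: "H (x, \<zero>\<^bsub>Y\<^esub>) = (x', y')" "x' \<in> carrier X'" "y' \<in> carrier Y'"
      using HD(1)[of "(x, \<zero>\<^bsub>Y\<^esub>)"] x by (cases "H (x, \<zero>\<^bsub>Y\<^esub>)") auto
    moreover have "H (x, \<zero>\<^bsub>Y\<^esub>) = Matrix2 \<one> \<zero> \<zero> \<zero> \<odot>\<^bsub>pair_module X' Y' f' g'\<^esub> H (x, \<zero>\<^bsub>Y\<^esub>)"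
      using HD(3)[of "Matrix2 \<one> \<zero> \<zero> \<zero>" "(x, \<zero>\<^bsub>Y\<^esub>)"] x by (simp add: fgD)
    ultimately show "h x \<in> carrier X'" "H (x, \<zero>\<^bsub>Y\<^esub>) = (h x, \<zero>\<^bsub>Y'\<^esub>)" by (simp_all add: h_def fgD)
  qed
  have kc: "k y \<in> carrier Y'" and Hy: "H (\<zero>\<^bsub>X\<^esub>, y) = (\<zero>\<^bsub>X'\<^esub>, k y)" if y: "y \<in> carrier Y" for y
  proof -
    obtain x' y' where xy: "H (\<zero>\<^bsub>X\<^esub>, y) = (x', y')" "x' \<in> carrier X'" "y' \<in> carrier Y'"
      using HD(1)[of "(\<zero>\<^bsub>X\<^esub>, y)"] y by (cases "H (\<zero>\<^bsub>X\<^esub>, y)") auto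
    moreover have "H (\<zero>\<^bsub>X\<^esub>, y) = Matrix2 \<zero> \<zero> \<zero> \<one> \<odot>\<^bsub>pair_module X' Y' f' g'\<^esub> H (\<zero>\<^bsub>X\<^esub>, y)"
      using HD(3)[of "Matrix2 \<zero> \<zero> \<zero> \<one>" "(\<zero>\<^bsub>X\<^esub>, y)"] y by (simp add: fgD)
    ultimately show "k y \<in> carrier Y'" "H (\<zero>\<^bsub>X\<^esub>, y) = (\<zero>\<^bsub>X'\<^esub>, k y)" by (simp_all add: k_def fgD)
  qed
  show ?thesis
  proof (rule that[of h k])
    show "h \<in> linear_maps R X X'"
    proof (rule linear_mapsI)
      show "h (x \<oplus>\<^bsub>X\<^esub> y) = h x \<oplus>\<^bsub>X'\<^esub> h y" if "x \<in> carrier X" "y \<in> carrier X" for x y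
        using HD(2)[of "(x, \<zero>\<^bsub>Y\<^esub>)" "(y, \<zero>\<^bsub>Y\<^esub>)"] that by (simp add: Hx hc)
      show "h (r \<odot>\<^bsub>X\<^esub> x) = r \<odot>\<^bsub>X'\<^esub> h x" if "r \<in> carrier R" "x \<in> carrier X" for r x
        using HD(3)[of "Matrix2 r \<zero> \<zero> \<zero>" "(x, \<zero>\<^bsub>Y\<^esub>)"] that by (simp add: Hx hc fgD)
    qed (rule hc)
    show "k \<in> linear_maps R Y Y'"
    proof (rule linear_mapsI)
      show "k (x \<oplus>\<^bsub>Y\<^esub> y) = k x \<oplus>\<^bsub>Y'\<^esub> k y" if "x \<in> carrier Y" "y \<in> carrier Y" for x y
        using HD(2)[of "(\<zero>\<^bsub>X\<^esub>, x)" "(\<zero>\<^bsub>X\<^esub>, y)"] that by (simp add: Hy kc)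
      show "k (r \<odot>\<^bsub>Y\<^esub> x) = r \<odot>\<^bsub>Y'\<^esub> k x" if "r \<in> carrier R" "x \<in> carrier Y" for r x
        using HD(3)[of "Matrix2 \<zero> \<zero> \<zero> r" "(\<zero>\<^bsub>X\<^esub>, x)"] that by (simp add: Hy kc fgD)
    qed (rule kc)
    show "k (f x) = f' (h x)" if "x \<in> carrier X" for x
      using HD(3)[of "Matrix2 \<zero> \<zero> \<one> \<zero>" "(x, \<zero>\<^bsub>Y\<^esub>)"] that by (simp add: Hx Hy hc kc fgD)
    show "h (g y) = g' (k y)" if "y \<in> carrier Y" for y
      using HD(3)[of "Matrix2 \<zero> \<one> \<zero> \<zero>" "(\<zero>\<^bsub>X\<^esub>, y)"] that by (simp add: Hx Hy hc kc fgD)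
    show "H (x, y) = (h x, k y)" if "x \<in> carrier X" "y \<in> carrier Y" for x y
      using HD(2)[of "(x, \<zero>\<^bsub>Y\<^esub>)" "(\<zero>\<^bsub>X\<^esub>, y)"] that by (simp add: Hx Hy hc kc)
  qed
qed

lemma pair_module_iso_components:
  assumes F: "z_factorization X Y f g" and F': "z_factorization X' Y' f' g'"
    and iso: "module_iso \<Delta> (pair_module X Y f g) (pair_module X' Y' f' g')"
  shows "module_iso R X X'" "module_iso R Y Y'"
proof -
  note D = z_factorizationD[OF F] and D' = z_factorizationD[OF F']
  interpret X: left_module R X by (rule D)
  interpret Y: left_module R Y by (rule D)
  interpret X': left_module R X' by (rule D')
  interpret Y': left_module R Y' by (rule D')
  obtain H K where HK: "H \<in> linear_maps \<Delta> (pair_module X Y f g) (pair_module X' Y' f' g')"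
    "K \<in> linear_maps \<Delta> (pair_module X' Y' f' g') (pair_module X Y f g)"
    "\<And>x. x \<in> carrier (pair_module X Y f g) \<Longrightarrow> K (H x) = x"
    "\<And>y. y \<in> carrier (pair_module X' Y' f' g') \<Longrightarrow> H (K y) = y"
    by (rule module_isoE[OF iso left_module_pair_module[OF F] left_module_pair_module[OF F']]) (rule that)
  obtain h k where h: "h \<in> linear_maps R X X'" "k \<in> linear_maps R Y Y'"
    "\<And>x y. x \<in> carrier X \<Longrightarrow> y \<in> carrier Y \<Longrightarrow> H (x, y) = (h x, k y)"
    by (rule pair_module_map_cases[OF F F' HK(1)]) (rule that)
  obtain h' k' where h': "h' \<in> linear_maps R X' X" "k' \<in> linear_maps R Y' Y"
    "\<And>x y. x \<in> carrier X' \<Longrightarrow> y \<in> carrier Y' \<Longrightarrow> K (x, y) = (h' x, k' y)"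
    by (rule pair_module_map_cases[OF F' F HK(2)]) (rule that)
  note c = linear_mapsD(1)[OF h(1)] linear_mapsD(1)[OF h(2)]
    linear_mapsD(1)[OF h'(1)] linear_mapsD(1)[OF h'(2)]
  have "h' (h x) = x \<and> k' (k y) = y" if "x \<in> carrier X" "y \<in> carrier Y" for x y
    using HK(3)[of "(x, y)"] that by (simp add: h h' c)
  moreover have "h (h' x) = x \<and> k (k' y) = y" if "x \<in> carrier X'" "y \<in> carrier Y'" for x y
    using HK(4)[of "(x, y)"] that by (simp add: h h' c)
  ultimately show "module_iso R X X'" "module_iso R Y Y'"
    using module_isoI[OF h(1), of h'] module_isoI[OF h(2), of k'] c
      X.M.zero_closed Y.M.zero_closed X'.M.zero_closed Y'.M.zero_closed
    by (metis funcsetI)+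
qed

text \<open>The form \<open>Matrix2 a n m b \<mapsto> n + m\<close> makes the Morita ring a Frobenius extension of \<open>R\<close>; this
  is the resulting description of \<open>\<Delta>\<close>-dual elements by \<open>R\<close>-dual elements of the components, read
  off from the off-diagonal entries.\<close>

lemma pair_module_dualI:
  assumes F: "z_factorization X Y f g"
    and h: "h \<in> functionals R X" and k: "k \<in> functionals R Y"
  shows "(\<lambda>(x, y). Matrix2 (k (f x)) (h x) (k y) (h (g y)))
    \<in> functionals \<Delta> (pair_module X Y f g)"
proof -
  note D = z_factorizationD[OF F]
  interpret X: left_module R X by (rule D)
  interpret Y: left_module R Y by (rule D)
  note fgD = linear_mapsD[OF D(5)] linear_mapsD[OF D(6)]
  have hD: "h x \<in> carrier R" "h (x \<oplus>\<^bsub>X\<^esub> x') = h x \<oplus> h x'" "r \<in> carrier R \<Longrightarrow> h (r \<odot>\<^bsub>X\<^esub> x) = r \<otimes> h x"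
    if "x \<in> carrier X" "x' \<in> carrier X" for x x' r using linear_mapsD[OF h] that by auto
  have kD: "k x \<in> carrier R" "k (x \<oplus>\<^bsub>Y\<^esub> x') = k x \<oplus> k x'" "r \<in> carrier R \<Longrightarrow> k (r \<odot>\<^bsub>Y\<^esub> x) = r \<otimes> k x"
    if "x \<in> carrier Y" "x' \<in> carrier Y" for x x' r using linear_mapsD[OF k] that by auto
  show ?thesis
    by (rule linear_mapsI)
       (auto elim!: carrier_DeltaE simp: fgD hD kD D(7,8) z_left_commute a_ac)
qed

lemma pair_module_dualE:
  assumes F: "z_factorization X Y f g"
    and H: "H \<in> functionals \<Delta> (pair_module X Y f g)"
  obtains h k where "h \<in> functionals R X" "k \<in> functionals R Y"
    "\<And>x y. x \<in> carrier X \<Longrightarrow> y \<in> carrier Y \<Longrightarrow>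
      H (x, y) = Matrix2 (k (f x)) (h x) (k y) (h (g y))"
proof -
  note D = z_factorizationD[OF F]
  interpret X: left_module R X by (rule D)
  interpret Y: left_module R Y by (rule D)
  note fgD = linear_mapsD[OF D(5)] linear_mapsD[OF D(6)]
  note HD = linear_mapsD[OF H]
  have [simp]: "f \<zero>\<^bsub>X\<^esub> = \<zero>\<^bsub>Y\<^esub>" "g \<zero>\<^bsub>Y\<^esub> = \<zero>\<^bsub>X\<^esub>"
    using linear_maps_zero D by metis+
  have "\<exists>a n. a \<in> carrier R \<and> n \<in> carrier R \<and> H (x, \<zero>\<^bsub>Y\<^esub>) = Matrix2 a n \<zero> \<zero>" if x: "x \<in> carrier X" for x
  proof -
    have "H (x, \<zero>\<^bsub>Y\<^esub>) \<in> carrier \<Delta>" using HD(1)[of "(x, \<zero>\<^bsub>Y\<^esub>)"] x by simp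
    then obtain a n m b where *: "H (x, \<zero>\<^bsub>Y\<^esub>) = Matrix2 a n m b"
      "a \<in> carrier R" "n \<in> carrier R" "m \<in> carrier R" "b \<in> carrier R" by (rule carrier_DeltaE)
    have "H (x, \<zero>\<^bsub>Y\<^esub>) = Matrix2 \<one> \<zero> \<zero> \<zero> \<otimes>\<^bsub>\<Delta>\<^esub> H (x, \<zero>\<^bsub>Y\<^esub>)"
      using HD(3)[of "Matrix2 \<one> \<zero> \<zero> \<zero>" "(x, \<zero>\<^bsub>Y\<^esub>)"] x by (simp add: fgD)
    with * show ?thesis by auto
  qed
  then obtain p h where ph: "\<And>x. x \<in> carrier X \<Longrightarrow> p x \<in> carrier R"
    "\<And>x. x \<in> carrier X \<Longrightarrow> h x \<in> carrier R"
    "\<And>x. x \<in> carrier X \<Longrightarrow> H (x, \<zero>\<^bsub>Y\<^esub>) = Matrix2 (p x) (h x) \<zero> \<zero>" by metis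
  have "\<exists>m b. m \<in> carrier R \<and> b \<in> carrier R \<and> H (\<zero>\<^bsub>X\<^esub>, y) = Matrix2 \<zero> \<zero> m b" if y: "y \<in> carrier Y" for y
  proof -
    have "H (\<zero>\<^bsub>X\<^esub>, y) \<in> carrier \<Delta>" using HD(1)[of "(\<zero>\<^bsub>X\<^esub>, y)"] y by simp
    then obtain a n m b where *: "H (\<zero>\<^bsub>X\<^esub>, y) = Matrix2 a n m b"
      "a \<in> carrier R" "n \<in> carrier R" "m \<in> carrier R" "b \<in> carrier R" by (rule carrier_DeltaE)
    have "H (\<zero>\<^bsub>X\<^esub>, y) = Matrix2 \<zero> \<zero> \<zero> \<one> \<otimes>\<^bsub>\<Delta>\<^esub> H (\<zero>\<^bsub>X\<^esub>, y)"
      using HD(3)[of "Matrix2 \<zero> \<zero> \<zero> \<one>" "(\<zero>\<^bsub>X\<^esub>, y)"] y by (simp add: fgD)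
    with * show ?thesis by auto
  qed
  then obtain k q where kq: "\<And>y. y \<in> carrier Y \<Longrightarrow> k y \<in> carrier R"
    "\<And>y. y \<in> carrier Y \<Longrightarrow> q y \<in> carrier R"
    "\<And>y. y \<in> carrier Y \<Longrightarrow> H (\<zero>\<^bsub>X\<^esub>, y) = Matrix2 \<zero> \<zero> (k y) (q y)" by metis
  show ?thesis
  proof (rule that[of h k])
    show "h \<in> functionals R X"
    proof (rule linear_mapsI)
      show "h (x \<oplus>\<^bsub>X\<^esub> y) = h x \<oplus>\<^bsub>regular_module R\<^esub> h y" if "x \<in> carrier X" "y \<in> carrier X" for x y
        using HD(2)[of "(x, \<zero>\<^bsub>Y\<^esub>)" "(y, \<zero>\<^bsub>Y\<^esub>)"] that by (simp add: ph)
      show "h (r \<odot>\<^bsub>X\<^esub> x) = r \<odot>\<^bsub>regular_module R\<^esub> h x" if "r \<in> carrier R" "x \<in> carrier X" for r x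
        using HD(3)[of "Matrix2 r \<zero> \<zero> \<zero>" "(x, \<zero>\<^bsub>Y\<^esub>)"] that by (simp add: ph fgD)
    qed (simp add: ph)
    show "k \<in> functionals R Y"
    proof (rule linear_mapsI)
      show "k (x \<oplus>\<^bsub>Y\<^esub> y) = k x \<oplus>\<^bsub>regular_module R\<^esub> k y" if "x \<in> carrier Y" "y \<in> carrier Y" for x y
        using HD(2)[of "(\<zero>\<^bsub>X\<^esub>, x)" "(\<zero>\<^bsub>X\<^esub>, y)"] that by (simp add: kq)
      show "k (r \<odot>\<^bsub>Y\<^esub> x) = r \<odot>\<^bsub>regular_module R\<^esub> k x" if "r \<in> carrier R" "x \<in> carrier Y" for r x
        using HD(3)[of "Matrix2 \<zero> \<zero> \<zero> r" "(\<zero>\<^bsub>X\<^esub>, x)"] that by (simp add: kq fgD)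
    qed (simp add: kq)
    fix x y assume xy: "x \<in> carrier X" "y \<in> carrier Y"
    have "p x = k (f x)"
      using HD(3)[of "Matrix2 \<zero> \<zero> \<one> \<zero>" "(x, \<zero>\<^bsub>Y\<^esub>)"] xy by (simp add: ph kq fgD)
    moreover have "q y = h (g y)"
      using HD(3)[of "Matrix2 \<zero> \<one> \<zero> \<zero>" "(\<zero>\<^bsub>X\<^esub>, y)"] xy by (simp add: ph kq fgD)
    ultimately show "H (x, y) = Matrix2 (k (f x)) (h x) (k y) (h (g y))"
      using HD(2)[of "(x, \<zero>\<^bsub>Y\<^esub>)" "(\<zero>\<^bsub>X\<^esub>, y)"] xy by (simp add: ph kq fgD)
  qed
qed

end

section \<open>Modules over the Morita ring as pairs\<close>

definition corner_module ::
    "('t, 'b, 'm) module_scheme \<Rightarrow> ('a \<Rightarrow> 't) \<Rightarrow> 't \<Rightarrow> ('a, 'b) module" where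
  "corner_module M \<rho> e =
     \<lparr>carrier = {x \<in> carrier M. e \<odot>\<^bsub>M\<^esub> x = x}, mult = undefined, one = undefined,
      zero = \<zero>\<^bsub>M\<^esub>, add = add M, smult = (\<lambda>r x. \<rho> r \<odot>\<^bsub>M\<^esub> x)\<rparr>"

lemma corner_module_simps [simp]:
  "x \<in> carrier (corner_module M \<rho> e) \<longleftrightarrow> x \<in> carrier M \<and> e \<odot>\<^bsub>M\<^esub> x = x"
  "\<zero>\<^bsub>corner_module M \<rho> e\<^esub> = \<zero>\<^bsub>M\<^esub>"
  "x \<oplus>\<^bsub>corner_module M \<rho> e\<^esub> y = x \<oplus>\<^bsub>M\<^esub> y"
  "r \<odot>\<^bsub>corner_module M \<rho> e\<^esub> x = \<rho> r \<odot>\<^bsub>M\<^esub> x"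
  by (simp_all add: corner_module_def)

text \<open>The corner \<open>e M\<close> is generated by \<open>e a\<close> and \<open>u a\<close> for generators \<open>a\<close> of \<open>M\<close> when the row
  \<open>e T\<close> is spanned by \<open>e\<close> and \<open>u\<close>, an element of that row.\<close>

lemma fg_corner_module:
  assumes R: "ring R" and M: "fg_module T M"
    and \<rho>: "\<And>r. r \<in> carrier R \<Longrightarrow> \<rho> r \<in> carrier T"
      "\<And>r s. r \<in> carrier R \<Longrightarrow> s \<in> carrier R \<Longrightarrow> \<rho> (r \<oplus>\<^bsub>R\<^esub> s) = \<rho> r \<oplus>\<^bsub>T\<^esub> \<rho> s"
      "\<And>r s. r \<in> carrier R \<Longrightarrow> s \<in> carrier R \<Longrightarrow> \<rho> (r \<otimes>\<^bsub>R\<^esub> s) = \<rho> r \<otimes>\<^bsub>T\<^esub> \<rho> s"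
    and e: "e = \<rho> \<one>\<^bsub>R\<^esub>"
    and u: "u \<in> carrier T" "e \<otimes>\<^bsub>T\<^esub> u = u"
    and row: "\<And>A. A \<in> carrier T \<Longrightarrow> \<exists>s\<in>carrier R. \<exists>t\<in>carrier R. e \<otimes>\<^bsub>T\<^esub> A = \<rho> s \<otimes>\<^bsub>T\<^esub> e \<oplus>\<^bsub>T\<^esub> \<rho> t \<otimes>\<^bsub>T\<^esub> u"
      "\<And>A. A \<in> carrier T \<Longrightarrow> \<exists>s\<in>carrier R. \<exists>t\<in>carrier R. u \<otimes>\<^bsub>T\<^esub> A = \<rho> s \<otimes>\<^bsub>T\<^esub> e \<oplus>\<^bsub>T\<^esub> \<rho> t \<otimes>\<^bsub>T\<^esub> u"
  shows "fg_module R (corner_module M \<rho> e)"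
proof -
  let ?C = "corner_module M \<rho> e"
  interpret R: ring R by fact
  interpret M: left_module T M using M by (rule fg_moduleD)
  have ec: "e \<in> carrier T" by (simp add: e \<rho>)
  have e\<rho>: "e \<odot>\<^bsub>M\<^esub> (\<rho> r \<odot>\<^bsub>M\<^esub> x) = \<rho> r \<odot>\<^bsub>M\<^esub> x" if "r \<in> carrier R" "x \<in> carrier M" for r x
  proof -
    have "e \<otimes>\<^bsub>T\<^esub> \<rho> r = \<rho> r" using \<rho>(3)[of "\<one>\<^bsub>R\<^esub>" r] that by (simp add: e)
    then show ?thesis using that M.smult_assoc1[of e "\<rho> r" x] ec \<rho>(1) by simp
  qed
  have eeu: "e \<odot>\<^bsub>M\<^esub> (e \<odot>\<^bsub>M\<^esub> x) = e \<odot>\<^bsub>M\<^esub> x" "e \<odot>\<^bsub>M\<^esub> (u \<odot>\<^bsub>M\<^esub> x) = u \<odot>\<^bsub>M\<^esub> x" if "x \<in> carrier M" for x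
    using e\<rho>[of "\<one>\<^bsub>R\<^esub>" x] M.smult_assoc1[of e u x] that ec u by (simp_all add: e)
  have em: "e \<odot>\<^bsub>M\<^esub> (\<ominus>\<^bsub>M\<^esub> x) = \<ominus>\<^bsub>M\<^esub> x" if "x \<in> carrier M" "e \<odot>\<^bsub>M\<^esub> x = x" for x
    using that M.smult_r_distr[OF ec, of "\<ominus>\<^bsub>M\<^esub> x" x] ec
    by (metis M.M.a_inv_closed M.M.l_neg M.M.minus_equality M.smult_closed M.smult_r_null)
  have neg: "\<exists>y\<in>carrier ?C. y \<oplus>\<^bsub>?C\<^esub> x = \<zero>\<^bsub>?C\<^esub>"
    if "x \<in> carrier ?C" for x
    using that em by (intro bexI[of _ "\<ominus>\<^bsub>M\<^esub> x"]) (auto simp: M.M.l_neg)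
  have ab: "abelian_group ?C"
  proof (rule abelian_groupI)
    fix x assume "x \<in> carrier ?C"
    then show "\<exists>y\<in>carrier ?C. y \<oplus>\<^bsub>?C\<^esub> x = \<zero>\<^bsub>?C\<^esub>"
      by (rule neg)
  qed (auto simp: M.M.a_ac M.smult_r_distr ec)
  have mod: "left_module R ?C"
    by (intro left_module.intro left_module_axioms.intro ab R)
       (auto simp: \<rho> e\<rho> M.smult_l_distr M.smult_r_distr M.smult_assoc1 e[symmetric])
  interpret C: left_module R ?C by (rule mod)
  obtain G where G: "finite G" "G \<subseteq> carrier M"
    and gen: "\<And>L. submodule L T M \<Longrightarrow> G \<subseteq> L \<Longrightarrow> L = carrier M"
    using M by (auto simp: fg_module_def finitely_generated_def)
  have "L = carrier ?C"
    if L: "submodule L R ?C"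
      and LG: "(\<lambda>a. e \<odot>\<^bsub>M\<^esub> a) ` G \<union> (\<lambda>a. u \<odot>\<^bsub>M\<^esub> a) ` G \<subseteq> L" for L
  proof -
    interpret L: submodule L R ?C by fact
    have Ladd: "x \<in> L \<Longrightarrow> y \<in> L \<Longrightarrow> x \<oplus>\<^bsub>M\<^esub> y \<in> L" for x y using L.m_closed[of x y] by simp
    have Lsmult: "r \<in> carrier R \<Longrightarrow> x \<in> L \<Longrightarrow> \<rho> r \<odot>\<^bsub>M\<^esub> x \<in> L" for r x
      using L.smult_closed[of r x] by simp
    have mult: "v \<odot>\<^bsub>M\<^esub> (A \<odot>\<^bsub>M\<^esub> x) \<in> L"
      if "v \<in> carrier T" "A \<in> carrier T" "x \<in> carrier M" "e \<odot>\<^bsub>M\<^esub> x \<in> L" "u \<odot>\<^bsub>M\<^esub> x \<in> L"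
      and combination: "\<exists>s\<in>carrier R. \<exists>t\<in>carrier R.
        v \<otimes>\<^bsub>T\<^esub> A = \<rho> s \<otimes>\<^bsub>T\<^esub> e \<oplus>\<^bsub>T\<^esub> \<rho> t \<otimes>\<^bsub>T\<^esub> u" for v A x
    proof -
      obtain s t where st: "s \<in> carrier R" "t \<in> carrier R" "v \<otimes>\<^bsub>T\<^esub> A = \<rho> s \<otimes>\<^bsub>T\<^esub> e \<oplus>\<^bsub>T\<^esub> \<rho> t \<otimes>\<^bsub>T\<^esub> u"
        using combination by blast
      have "v \<odot>\<^bsub>M\<^esub> (A \<odot>\<^bsub>M\<^esub> x) = (v \<otimes>\<^bsub>T\<^esub> A) \<odot>\<^bsub>M\<^esub> x" using that by (simp add: M.smult_assoc1)
      also have "\<dots> = \<rho> s \<odot>\<^bsub>M\<^esub> (e \<odot>\<^bsub>M\<^esub> x) \<oplus>\<^bsub>M\<^esub> \<rho> t \<odot>\<^bsub>M\<^esub> (u \<odot>\<^bsub>M\<^esub> x)"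
        using that st ec u \<rho>(1) by (simp add: M.smult_l_distr M.smult_assoc1)
      finally show ?thesis using Ladd Lsmult st(1,2) that(4,5) by simp
    qed
    have "submodule {x \<in> carrier M. e \<odot>\<^bsub>M\<^esub> x \<in> L \<and> u \<odot>\<^bsub>M\<^esub> x \<in> L} T M"
    proof (rule M.submodule_closureI)
      show "\<zero>\<^bsub>M\<^esub> \<in> {x \<in> carrier M. e \<odot>\<^bsub>M\<^esub> x \<in> L \<and> u \<odot>\<^bsub>M\<^esub> x \<in> L}"
        using L.one_closed ec u by simp
    next
      fix x y assume "x \<in> {x \<in> carrier M. e \<odot>\<^bsub>M\<^esub> x \<in> L \<and> u \<odot>\<^bsub>M\<^esub> x \<in> L}"
        "y \<in> {x \<in> carrier M. e \<odot>\<^bsub>M\<^esub> x \<in> L \<and> u \<odot>\<^bsub>M\<^esub> x \<in> L}"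
      then show "x \<oplus>\<^bsub>M\<^esub> y \<in> {x \<in> carrier M. e \<odot>\<^bsub>M\<^esub> x \<in> L \<and> u \<odot>\<^bsub>M\<^esub> x \<in> L}"
        using ec u Ladd by (simp add: M.smult_r_distr)
    next
      fix A x assume "A \<in> carrier T" "x \<in> {x \<in> carrier M. e \<odot>\<^bsub>M\<^esub> x \<in> L \<and> u \<odot>\<^bsub>M\<^esub> x \<in> L}"
      then show "A \<odot>\<^bsub>M\<^esub> x \<in> {x \<in> carrier M. e \<odot>\<^bsub>M\<^esub> x \<in> L \<and> u \<odot>\<^bsub>M\<^esub> x \<in> L}"
        using mult[OF ec _ _ _ _ row(1)] mult[OF u(1) _ _ _ _ row(2)] by simp
    qed auto
    from gen[OF this] have "{x \<in> carrier M. e \<odot>\<^bsub>M\<^esub> x \<in> L \<and> u \<odot>\<^bsub>M\<^esub> x \<in> L} = carrier M"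
      using G(2) LG by blast
    then have "x \<in> L" if "x \<in> carrier ?C" for x
    proof -
      have "x \<in> carrier M" "e \<odot>\<^bsub>M\<^esub> x = x" using that by simp_all
      moreover have "e \<odot>\<^bsub>M\<^esub> x \<in> L"
        using \<open>x \<in> carrier M\<close> \<open>{x \<in> carrier M. e \<odot>\<^bsub>M\<^esub> x \<in> L \<and> u \<odot>\<^bsub>M\<^esub> x \<in> L} = carrier M\<close> by blast
      ultimately show ?thesis by simp
    qed
    then show ?thesis using L.subset by auto
  qed
  then have "finitely_generated R ?C"
    unfolding finitely_generated_def
    by (intro exI[of _ "(\<lambda>a. e \<odot>\<^bsub>M\<^esub> a) ` G \<union> (\<lambda>a. u \<odot>\<^bsub>M\<^esub> a) ` G"])
       (use G ec u eeu in auto)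
  with mod show ?thesis by (simp add: fg_module_def)
qed

context central_morita
begin

text \<open>The Peirce decomposition with respect to the two diagonal idempotents.\<close>

lemma module_as_pair:
  fixes M :: "('a matrix2, 'b, 'm) module_scheme"
  assumes M: "fg_module \<Delta> M"
  obtains X Y :: "('a, 'b) module" and f g
  where "z_factorization X Y f g" "module_iso \<Delta> M (pair_module X Y f g)"
proof -
  interpret M: left_module \<Delta> M using M by (rule fg_moduleD)
  define act where "act a n m b x = Matrix2 a n m b \<odot>\<^bsub>M\<^esub> x" for a n m b x
  define X where "X = corner_module M (\<lambda>r. Matrix2 r \<zero> \<zero> \<zero>) (Matrix2 \<one> \<zero> \<zero> \<zero>)"
  define Y where "Y = corner_module M (\<lambda>r. Matrix2 \<zero> \<zero> \<zero> r) (Matrix2 \<zero> \<zero> \<zero> \<one>)"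
  define f where "f = act \<zero> \<zero> \<one> \<zero>"
  define g where "g = act \<zero> \<one> \<zero> \<zero>"
  have act_closed [simp]: "act a n m b x \<in> carrier M"
    if "{a, n, m, b} \<subseteq> carrier R" "x \<in> carrier M" for a n m b x
    using that by (simp add: act_def)
  have act_add: "act a n m b (x \<oplus>\<^bsub>M\<^esub> y) = act a n m b x \<oplus>\<^bsub>M\<^esub> act a n m b y"
    if "{a, n, m, b} \<subseteq> carrier R" "x \<in> carrier M" "y \<in> carrier M"
    for a n m b x y using that by (simp add: act_def M.smult_r_distr)
  have act_act: "act a n m b (act a' n' m' b' x) =
      act (a \<otimes> a' \<oplus> z \<otimes> (n \<otimes> m')) (a \<otimes> n' \<oplus> n \<otimes> b') (m \<otimes> a' \<oplus> b \<otimes> m') (b \<otimes> b' \<oplus> z \<otimes> (m \<otimes> n')) x"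
    if "{a, n, m, b, a', n', m', b'} \<subseteq> carrier R" "x \<in> carrier M"
    for a n m b a' n' m' b' x
    using that M.smult_assoc1[of "Matrix2 a n m b" "Matrix2 a' n' m' b'" x] by (simp add: act_def)
  have act_plus: "act a n m b x \<oplus>\<^bsub>M\<^esub> act a' n' m' b' x = act (a \<oplus> a') (n \<oplus> n') (m \<oplus> m') (b \<oplus> b') x"
    if "{a, n, m, b, a', n', m', b'} \<subseteq> carrier R" "x \<in> carrier M"
    for a n m b a' n' m' b' x
    using that M.smult_l_distr[of "Matrix2 a n m b" "Matrix2 a' n' m' b'" x] by (simp add: act_def)
  have act_zero: "act \<zero> \<zero> \<zero> \<zero> x = \<zero>\<^bsub>M\<^esub>" and act_one: "act \<one> \<zero> \<zero> \<one> x = x"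
    if "x \<in> carrier M" for x
    using that M.smult_l_null[of x] M.smult_one[of x] by (simp_all add: act_def)
  have X: "fg_module R X"
    unfolding X_def
  proof (rule fg_corner_module[where T = \<Delta> and u = "Matrix2 \<zero> \<one> \<zero> \<zero>"])
    fix A assume "A \<in> carrier \<Delta>"
    then obtain a n m b where A: "A = Matrix2 a n m b"
      "a \<in> carrier R" "n \<in> carrier R" "m \<in> carrier R" "b \<in> carrier R" by (rule carrier_DeltaE)
    show "\<exists>s\<in>carrier R. \<exists>t\<in>carrier R. Matrix2 \<one> \<zero> \<zero> \<zero> \<otimes>\<^bsub>\<Delta>\<^esub> A =
        Matrix2 s \<zero> \<zero> \<zero> \<otimes>\<^bsub>\<Delta>\<^esub> Matrix2 \<one> \<zero> \<zero> \<zero> \<oplus>\<^bsub>\<Delta>\<^esub> Matrix2 t \<zero> \<zero> \<zero> \<otimes>\<^bsub>\<Delta>\<^esub> Matrix2 \<zero> \<one> \<zero> \<zero>"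
      using A by (intro bexI[of _ a] bexI[of _ n]) simp_all
    show "\<exists>s\<in>carrier R. \<exists>t\<in>carrier R. Matrix2 \<zero> \<one> \<zero> \<zero> \<otimes>\<^bsub>\<Delta>\<^esub> A =
        Matrix2 s \<zero> \<zero> \<zero> \<otimes>\<^bsub>\<Delta>\<^esub> Matrix2 \<one> \<zero> \<zero> \<zero> \<oplus>\<^bsub>\<Delta>\<^esub> Matrix2 t \<zero> \<zero> \<zero> \<otimes>\<^bsub>\<Delta>\<^esub> Matrix2 \<zero> \<one> \<zero> \<zero>"
      using A by (intro bexI[of _ "z \<otimes> m"] bexI[of _ b]) simp_all
  qed (use M R.ring_axioms in simp_all)
  have Y: "fg_module R Y"
    unfolding Y_def
  proof (rule fg_corner_module[where T = \<Delta> and u = "Matrix2 \<zero> \<zero> \<one> \<zero>"])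
    fix A assume "A \<in> carrier \<Delta>"
    then obtain a n m b where A: "A = Matrix2 a n m b"
      "a \<in> carrier R" "n \<in> carrier R" "m \<in> carrier R" "b \<in> carrier R" by (rule carrier_DeltaE)
    show "\<exists>s\<in>carrier R. \<exists>t\<in>carrier R. Matrix2 \<zero> \<zero> \<zero> \<one> \<otimes>\<^bsub>\<Delta>\<^esub> A =
        Matrix2 \<zero> \<zero> \<zero> s \<otimes>\<^bsub>\<Delta>\<^esub> Matrix2 \<zero> \<zero> \<zero> \<one> \<oplus>\<^bsub>\<Delta>\<^esub> Matrix2 \<zero> \<zero> \<zero> t \<otimes>\<^bsub>\<Delta>\<^esub> Matrix2 \<zero> \<zero> \<one> \<zero>"
      using A by (intro bexI[of _ b] bexI[of _ m]) simp_all
    show "\<exists>s\<in>carrier R. \<exists>t\<in>carrier R. Matrix2 \<zero> \<zero> \<one> \<zero> \<otimes>\<^bsub>\<Delta>\<^esub> A =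
        Matrix2 \<zero> \<zero> \<zero> s \<otimes>\<^bsub>\<Delta>\<^esub> Matrix2 \<zero> \<zero> \<zero> \<one> \<oplus>\<^bsub>\<Delta>\<^esub> Matrix2 \<zero> \<zero> \<zero> t \<otimes>\<^bsub>\<Delta>\<^esub> Matrix2 \<zero> \<zero> \<one> \<zero>"
      using A by (intro bexI[of _ "z \<otimes> n"] bexI[of _ a]) simp_all
  qed (use M R.ring_axioms in simp_all)
  have Xc: "x \<in> carrier X \<longleftrightarrow> x \<in> carrier M \<and> act \<one> \<zero> \<zero> \<zero> x = x"
    and Xadd: "x \<oplus>\<^bsub>X\<^esub> y = x \<oplus>\<^bsub>M\<^esub> y" and Xsmult: "r \<odot>\<^bsub>X\<^esub> x = act r \<zero> \<zero> \<zero> x" for x y r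
    by (simp_all add: X_def act_def)
  have Yc: "x \<in> carrier Y \<longleftrightarrow> x \<in> carrier M \<and> act \<zero> \<zero> \<zero> \<one> x = x"
    and Yadd: "x \<oplus>\<^bsub>Y\<^esub> y = x \<oplus>\<^bsub>M\<^esub> y" and Ysmult: "r \<odot>\<^bsub>Y\<^esub> x = act \<zero> \<zero> \<zero> r x" for x y r
    by (simp_all add: Y_def act_def)
  have actX: "act a n m b x = act a \<zero> m \<zero> x"
    if "{a, n, m, b} \<subseteq> carrier R" "x \<in> carrier X" for a n m b x
    using that act_act[of a n m b \<one> \<zero> \<zero> \<zero> x] by (simp add: Xc)
  have actY: "act a n m b y = act \<zero> n \<zero> b y"
    if "{a, n, m, b} \<subseteq> carrier R" "y \<in> carrier Y" for a n m b y
    using that act_act[of a n m b \<zero> \<zero> \<zero> \<one> y] by (simp add: Yc)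
  have fact: "z_factorization X Y f g"
    unfolding z_factorization_def
  proof (intro conjI ballI)
    show "f \<in> linear_maps R X Y" unfolding f_def
      by (rule linear_mapsI) (auto simp: Xc Yc Xadd Yadd Xsmult Ysmult act_add act_act)
    show "g \<in> linear_maps R Y X" unfolding g_def
      by (rule linear_mapsI) (auto simp: Xc Yc Xadd Yadd Xsmult Ysmult act_add act_act)
    show "g (f x) = z \<odot>\<^bsub>X\<^esub> x" if "x \<in> carrier X" for x
      using that by (simp add: f_def g_def Xc Xsmult act_act)
    show "f (g y) = z \<odot>\<^bsub>Y\<^esub> y" if "y \<in> carrier Y" for y
      using that by (simp add: f_def g_def Yc Ysmult act_act)
  qed (rule X Y)+
  have "module_iso \<Delta> (pair_module X Y f g) M"
  proof (rule module_isoI[where h = "\<lambda>(x, y). x \<oplus>\<^bsub>M\<^esub> y" and k = "\<lambda>w. (act \<one> \<zero> \<zero> \<zero> w, act \<zero> \<zero> \<zero> \<one> w)"])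
    show "(\<lambda>(x, y). x \<oplus>\<^bsub>M\<^esub> y) \<in> linear_maps \<Delta> (pair_module X Y f g) M"
    proof (rule linear_mapsI)
      fix A v assume "A \<in> carrier \<Delta>" and "v \<in> carrier (pair_module X Y f g)"
      then obtain a n m b x y where A: "A = Matrix2 a n m b"
        "a \<in> carrier R" "n \<in> carrier R" "m \<in> carrier R" "b \<in> carrier R"
        and v: "v = (x, y)" "x \<in> carrier X" "y \<in> carrier Y" by (auto elim!: carrier_DeltaE)
      have xy: "x \<in> carrier M" "y \<in> carrier M" using v by (auto simp: Xc Yc)
      have 1: "a \<odot>\<^bsub>X\<^esub> x \<oplus>\<^bsub>X\<^esub> n \<odot>\<^bsub>X\<^esub> g y = act a \<zero> \<zero> \<zero> x \<oplus>\<^bsub>M\<^esub> act \<zero> n \<zero> \<zero> y"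
        using A xy by (simp add: Xadd Xsmult g_def act_act)
      have 2: "b \<odot>\<^bsub>Y\<^esub> y \<oplus>\<^bsub>Y\<^esub> m \<odot>\<^bsub>Y\<^esub> f x = act \<zero> \<zero> \<zero> b y \<oplus>\<^bsub>M\<^esub> act \<zero> \<zero> m \<zero> x"
        using A xy by (simp add: Yadd Ysmult f_def act_act)
      have 3: "act a n m b x = act a \<zero> \<zero> \<zero> x \<oplus>\<^bsub>M\<^esub> act \<zero> \<zero> m \<zero> x"
        using A v xy by (simp add: actX[of a n m b x] act_plus)
      have 4: "act a n m b y = act \<zero> n \<zero> \<zero> y \<oplus>\<^bsub>M\<^esub> act \<zero> \<zero> \<zero> b y"
        using A v xy by (simp add: actY[of a n m b y] act_plus)
      have "A \<odot>\<^bsub>M\<^esub> (x \<oplus>\<^bsub>M\<^esub> y) = act a n m b x \<oplus>\<^bsub>M\<^esub> act a n m b y"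
        using A xy by (simp add: act_add[symmetric]) (simp add: act_def)
      then show "(\<lambda>(x, y). x \<oplus>\<^bsub>M\<^esub> y) (A \<odot>\<^bsub>pair_module X Y f g\<^esub> v) = A \<odot>\<^bsub>M\<^esub> (\<lambda>(x, y). x \<oplus>\<^bsub>M\<^esub> y) v"
        using A xy by (simp add: v A(1) 1 2 3 4 M.M.a_ac)
    qed (auto simp: Xc Yc Xadd Yadd M.M.a_ac)
    show "(\<lambda>w. (act \<one> \<zero> \<zero> \<zero> w, act \<zero> \<zero> \<zero> \<one> w)) \<in> carrier M \<rightarrow> carrier (pair_module X Y f g)"
      by (auto simp: Xc Yc act_act)
    have "act \<one> \<zero> \<zero> \<zero> y = \<zero>\<^bsub>M\<^esub>" if "y \<in> carrier Y" for y
      using actY[of \<one> \<zero> \<zero> \<zero> y] that by (simp add: act_zero Yc)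
    moreover have "act \<zero> \<zero> \<zero> \<one> x = \<zero>\<^bsub>M\<^esub>" if "x \<in> carrier X" for x
      using actX[of \<zero> \<zero> \<zero> \<one> x] that by (simp add: act_zero Xc)
    ultimately show "(act \<one> \<zero> \<zero> \<zero> (case v of (x, y) \<Rightarrow> x \<oplus>\<^bsub>M\<^esub> y), act \<zero> \<zero> \<zero> \<one> (case v of (x, y) \<Rightarrow> x \<oplus>\<^bsub>M\<^esub> y)) = v"
      if "v \<in> carrier (pair_module X Y f g)" for v
      using that by (auto simp: Xc Yc act_add)
    show "(case (act \<one> \<zero> \<zero> \<zero> w, act \<zero> \<zero> \<zero> \<one> w) of (x, y) \<Rightarrow> x \<oplus>\<^bsub>M\<^esub> y) = w" if "w \<in> carrier M" for w
      using that by (simp add: act_plus act_one)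
  qed
  then have "module_iso \<Delta> M (pair_module X Y f g)"
    by (rule module_iso_sym[OF _ left_module_pair_module[OF fact] M.left_module_axioms])
  with fact show ?thesis by (rule that)
qed


lemma smult_z_linear:
  assumes "left_module R B"
  shows "(\<lambda>y. z \<odot>\<^bsub>B\<^esub> y) \<in> linear_maps R B B"
proof -
  interpret B: left_module R B by fact
  show ?thesis
    by (rule linear_mapsI) (auto simp: B.smult_r_distr B.smult_assoc1[symmetric] z_central)
qed

section \<open>Projective modules over the Morita ring\<close>

text \<open>The pair \<open>(B, B, z, 1)\<close> is coinduced from the first corner, so lifting a map from \<open>X\<close> to \<open>B\<close>
  is the same as lifting a map from the pair; \<open>(B, B, 1, z)\<close> does the same for the second corner.\<close>

lemma projective_pair_fst:
  assumes F: "z_factorization X Y f g" and P: "projective_module \<Delta> (pair_module X Y f g)"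
  shows "projective_module R X"
  unfolding projective_module_def
proof (intro conjI allI impI)
  note D = z_factorizationD[OF F]
  show "fg_module R X" by (rule D)
  interpret X: left_module R X by (rule D)
  interpret Y: left_module R Y by (rule D)
  fix A B :: "'a small_module" and s h
  assume *: "fg_module R A \<and> fg_module R B \<and> s \<in> linear_maps R A B \<and> s ` carrier A = carrier B
    \<and> h \<in> linear_maps R X B"
  then have s: "s \<in> linear_maps R A B" "s ` carrier A = carrier B" and h: "h \<in> linear_maps R X B"
    by auto
  have A: "z_factorization A A (\<lambda>y. z \<odot>\<^bsub>A\<^esub> y) (\<lambda>y. y)" and B: "z_factorization B B (\<lambda>y. z \<odot>\<^bsub>B\<^esub> y) (\<lambda>y. y)"
    using * by (simp_all add: z_factorization_def smult_z_linear fg_moduleD)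
  have p: "map_prod s s \<in> linear_maps \<Delta> (pair_module A A (\<lambda>y. z \<odot>\<^bsub>A\<^esub> y) (\<lambda>y. y))
      (pair_module B B (\<lambda>y. z \<odot>\<^bsub>B\<^esub> y) (\<lambda>y. y))"
    by (rule pair_module_map[OF A B s(1) s(1)]) (simp_all add: linear_mapsD(3)[OF s(1)])
  have hg: "(\<lambda>y. h (g y)) \<in> linear_maps R Y B" by (rule linear_maps_compose[OF D(6) h])
  have H: "map_prod h (\<lambda>y. h (g y)) \<in> linear_maps \<Delta> (pair_module X Y f g)
      (pair_module B B (\<lambda>y. z \<odot>\<^bsub>B\<^esub> y) (\<lambda>y. y))"
    by (rule pair_module_map[OF F B h hg]) (simp_all add: D(7) linear_mapsD(3)[OF h])
  have "map_prod s s ` (carrier A \<times> carrier A) = carrier B \<times> carrier B"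
    using s(2) by (simp add: map_prod_surj_on)
  then obtain K where K: "K \<in> linear_maps \<Delta> (pair_module X Y f g) (pair_module A A (\<lambda>y. z \<odot>\<^bsub>A\<^esub> y) (\<lambda>y. y))"
    "\<forall>v\<in>carrier (pair_module X Y f g). map_prod s s (K v) = map_prod h (\<lambda>y. h (g y)) v"
    using projective_module_lift[OF P fg_pair_module[OF A] fg_pair_module[OF B] p _ H] by auto
  obtain k l where k: "k \<in> linear_maps R X A"
    "\<And>x y. x \<in> carrier X \<Longrightarrow> y \<in> carrier Y \<Longrightarrow> K (x, y) = (k x, l y)"
    by (rule pair_module_map_cases[OF F A K(1)]) (rule that)
  have "s (k x) = h x" if "x \<in> carrier X" for x
    using K(2)[rule_format, of "(x, \<zero>\<^bsub>Y\<^esub>)"] that by (simp add: k(2))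
  then show "\<exists>k\<in>linear_maps R X A. \<forall>x\<in>carrier X. s (k x) = h x" by (intro bexI[OF _ k(1)]) auto
qed

lemma projective_pair_snd:
  assumes F: "z_factorization X Y f g" and P: "projective_module \<Delta> (pair_module X Y f g)"
  shows "projective_module R Y"
  unfolding projective_module_def
proof (intro conjI allI impI)
  note D = z_factorizationD[OF F]
  show "fg_module R Y" by (rule D)
  interpret X: left_module R X by (rule D)
  interpret Y: left_module R Y by (rule D)
  fix A B :: "'a small_module" and s h
  assume *: "fg_module R A \<and> fg_module R B \<and> s \<in> linear_maps R A B \<and> s ` carrier A = carrier B
    \<and> h \<in> linear_maps R Y B"
  then have s: "s \<in> linear_maps R A B" "s ` carrier A = carrier B" and h: "h \<in> linear_maps R Y B"
    by auto
  have A: "z_factorization A A (\<lambda>y. y) (\<lambda>y. z \<odot>\<^bsub>A\<^esub> y)" and B: "z_factorization B B (\<lambda>y. y) (\<lambda>y. z \<odot>\<^bsub>B\<^esub> y)"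
    using * by (simp_all add: z_factorization_def smult_z_linear fg_moduleD)
  have p: "map_prod s s \<in> linear_maps \<Delta> (pair_module A A (\<lambda>y. y) (\<lambda>y. z \<odot>\<^bsub>A\<^esub> y))
      (pair_module B B (\<lambda>y. y) (\<lambda>y. z \<odot>\<^bsub>B\<^esub> y))"
    by (rule pair_module_map[OF A B s(1) s(1)]) (simp_all add: linear_mapsD(3)[OF s(1)])
  have hf: "(\<lambda>x. h (f x)) \<in> linear_maps R X B" by (rule linear_maps_compose[OF D(5) h])
  have H: "map_prod (\<lambda>x. h (f x)) h \<in> linear_maps \<Delta> (pair_module X Y f g)
      (pair_module B B (\<lambda>y. y) (\<lambda>y. z \<odot>\<^bsub>B\<^esub> y))"
    by (rule pair_module_map[OF F B hf h]) (simp_all add: D(8) linear_mapsD(3)[OF h])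
  have "map_prod s s ` (carrier A \<times> carrier A) = carrier B \<times> carrier B"
    using s(2) by (simp add: map_prod_surj_on)
  then obtain K where K: "K \<in> linear_maps \<Delta> (pair_module X Y f g) (pair_module A A (\<lambda>y. y) (\<lambda>y. z \<odot>\<^bsub>A\<^esub> y))"
    "\<forall>v\<in>carrier (pair_module X Y f g). map_prod s s (K v) = map_prod (\<lambda>x. h (f x)) h v"
    using projective_module_lift[OF P fg_pair_module[OF A] fg_pair_module[OF B] p _ H] by auto
  obtain k l where k: "l \<in> linear_maps R Y A"
    "\<And>x y. x \<in> carrier X \<Longrightarrow> y \<in> carrier Y \<Longrightarrow> K (x, y) = (k x, l y)"
    by (rule pair_module_map_cases[OF F A K(1)]) (rule that)
  have "s (l y) = h y" if "y \<in> carrier Y" for y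
    using K(2)[rule_format, of "(\<zero>\<^bsub>X\<^esub>, y)"] that by (simp add: k(2))
  then show "\<exists>k\<in>linear_maps R Y A. \<forall>x\<in>carrier Y. s (k x) = h x" by (intro bexI[OF _ k(1)]) auto
qed

text \<open>Inducing \<open>A\<close> from the first corner gives the pair \<open>(A, A, 1, z)\<close> and inducing \<open>B\<close> from the second
  gives \<open>(B, B, z, 1)\<close>; the structure maps below are those of the direct sum of the two.\<close>

definition induced_f where "induced_f B = (\<lambda>(a, b). (a, z \<odot>\<^bsub>B\<^esub> b))"
definition induced_g where "induced_g A = (\<lambda>(a, b). (z \<odot>\<^bsub>A\<^esub> a, b))"

abbreviation induced_module where
  "induced_module A B \<equiv>
     pair_module (direct_sum A B) (direct_sum A B) (induced_f B) (induced_g A)"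

lemma z_factorization_induced:
  assumes "fg_module R A" "fg_module R B"
  shows "z_factorization (direct_sum A B) (direct_sum A B) (induced_f B) (induced_g A)"
proof -
  interpret A: left_module R A using assms(1) by (rule fg_moduleD)
  interpret B: left_module R B using assms(2) by (rule fg_moduleD)
  note z = linear_mapsD[OF smult_z_linear[OF A.left_module_axioms]]
    linear_mapsD[OF smult_z_linear[OF B.left_module_axioms]]
  have "induced_f B \<in> linear_maps R (direct_sum A B) (direct_sum A B)"
    "induced_g A \<in> linear_maps R (direct_sum A B) (direct_sum A B)"
    by (auto intro!: linear_mapsI simp: induced_f_def induced_g_def z)
  then show ?thesis
    unfolding z_factorization_def using fg_module_direct_sum[OF assms]
    by (auto simp: induced_f_def induced_g_def)
qed

text \<open>A map out of the induced module is determined by its values on the copy of \<open>A\<close> in the first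
  component and on the copy of \<open>B\<close> in the second, where it can be chosen freely; these two
  restrictions are lifted separately.\<close>

lemma projective_induced_module:
  assumes A: "projective_module R A" and B: "projective_module R B"
  shows "projective_module \<Delta> (induced_module A B)"
  unfolding projective_module_def
proof (intro conjI allI impI)
  note fg = projective_moduleD[OF A] projective_moduleD[OF B]
  note U = z_factorization_induced[OF fg]
  show "fg_module \<Delta> (induced_module A B)" by (rule fg_pair_module[OF U])
  interpret A: left_module R A using fg(1) by (rule fg_moduleD)
  interpret B: left_module R B using fg(2) by (rule fg_moduleD)
  note mod = A.left_module_axioms B.left_module_axioms
  fix E F :: "('a matrix2) small_module" and p H
  assume "fg_module \<Delta> E \<and> fg_module \<Delta> F \<and> p \<in> linear_maps \<Delta> E F \<and> p ` carrier E = carrier F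
    \<and> H \<in> linear_maps \<Delta> (induced_module A B) F"
  then have E: "fg_module \<Delta> E" and F: "fg_module \<Delta> F" and p: "p \<in> linear_maps \<Delta> E F"
    and surj: "p ` carrier E = carrier F" and H: "H \<in> linear_maps \<Delta> (induced_module A B) F" by auto
  obtain E1 E2 :: "('a, (nat \<Rightarrow> 'a matrix2) set) module" and fE gE
    where E12: "z_factorization E1 E2 fE gE" "module_iso \<Delta> E (pair_module E1 E2 fE gE)"
    by (rule module_as_pair[OF E]) (rule that)
  obtain F1 F2 :: "('a, (nat \<Rightarrow> 'a matrix2) set) module" and fF gF
    where F12: "z_factorization F1 F2 fF gF" "module_iso \<Delta> F (pair_module F1 F2 fF gF)"
    by (rule module_as_pair[OF F]) (rule that)
  obtain e e' where e: "e \<in> linear_maps \<Delta> E (pair_module E1 E2 fE gE)" "e' \<in> linear_maps \<Delta> (pair_module E1 E2 fE gE) E"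
    "\<And>x. x \<in> carrier E \<Longrightarrow> e' (e x) = x" "\<And>y. y \<in> carrier (pair_module E1 E2 fE gE) \<Longrightarrow> e (e' y) = y"
    by (rule module_isoE[OF E12(2) fg_moduleD[OF E] left_module_pair_module[OF E12(1)]]) (rule that)
  obtain c c' where c: "c \<in> linear_maps \<Delta> F (pair_module F1 F2 fF gF)" "c' \<in> linear_maps \<Delta> (pair_module F1 F2 fF gF) F"
    "\<And>x. x \<in> carrier F \<Longrightarrow> c' (c x) = x" "\<And>y. y \<in> carrier (pair_module F1 F2 fF gF) \<Longrightarrow> c (c' y) = y"
    by (rule module_isoE[OF F12(2) fg_moduleD[OF F] left_module_pair_module[OF F12(1)]]) (rule that)
  have "(\<lambda>v. c (p (e' v))) \<in> linear_maps \<Delta> (pair_module E1 E2 fE gE) (pair_module F1 F2 fF gF)"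
    by (rule linear_maps_compose[OF e(2) linear_maps_compose[OF p c(1)]])
  then obtain p1 p2 where p12: "p1 \<in> linear_maps R E1 F1" "p2 \<in> linear_maps R E2 F2"
    "\<And>x. x \<in> carrier E1 \<Longrightarrow> p2 (fE x) = fF (p1 x)" "\<And>y. y \<in> carrier E2 \<Longrightarrow> p1 (gE y) = gF (p2 y)"
    "\<And>x y. x \<in> carrier E1 \<Longrightarrow> y \<in> carrier E2 \<Longrightarrow> c (p (e' (x, y))) = (p1 x, p2 y)"
    by (rule pair_module_map_cases[OF E12(1) F12(1)]) (rule that)
  have "(\<lambda>v. c (H v)) \<in> linear_maps \<Delta> (induced_module A B) (pair_module F1 F2 fF gF)"
    by (rule linear_maps_compose[OF H c(1)])
  then obtain h1 h2 where h: "h1 \<in> linear_maps R (direct_sum A B) F1" "h2 \<in> linear_maps R (direct_sum A B) F2"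
    "\<And>x. x \<in> carrier (direct_sum A B) \<Longrightarrow> h2 (induced_f B x) = fF (h1 x)"
    "\<And>y. y \<in> carrier (direct_sum A B) \<Longrightarrow> h1 (induced_g A y) = gF (h2 y)"
    "\<And>x y. x \<in> carrier (direct_sum A B) \<Longrightarrow> y \<in> carrier (direct_sum A B) \<Longrightarrow> c (H (x, y)) = (h1 x, h2 y)"
    by (rule pair_module_map_cases[OF U F12(1)]) (rule that)
  note ED = z_factorizationD[OF E12(1)] and FD = z_factorizationD[OF F12(1)]
  interpret E1: left_module R E1 by (rule ED)
  interpret E2: left_module R E2 by (rule ED)
  interpret F1: left_module R F1 by (rule FD)
  interpret F2: left_module R F2 by (rule FD)
  have pairs: "\<exists>x\<in>carrier E1. \<exists>y\<in>carrier E2. p1 x = u \<and> p2 y = v" if "u \<in> carrier F1" "v \<in> carrier F2" for u v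
  proof -
    have "c' (u, v) \<in> p ` carrier E" using that surj linear_mapsD(1)[OF c(2), of "(u, v)"] by simp
    then obtain w where w: "w \<in> carrier E" "p w = c' (u, v)" by auto
    obtain x y where xy: "e w = (x, y)" "x \<in> carrier E1" "y \<in> carrier E2"
      using linear_mapsD(1)[OF e(1) w(1)] by (cases "e w") auto
    have "(p1 x, p2 y) = c (p (e' (e w)))" using p12(5)[OF xy(2,3)] by (simp add: xy(1))
    also have "\<dots> = (u, v)" using w c(4)[of "(u, v)"] that by (simp add: e(3))
    finally show ?thesis using xy by auto
  qed
  have s1: "p1 ` carrier E1 = carrier F1"
  proof (intro equalityI subsetI)
    fix u assume "u \<in> carrier F1"
    with pairs[of u "\<zero>\<^bsub>F2\<^esub>"] show "u \<in> p1 ` carrier E1" by auto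
  qed (use linear_mapsD(1)[OF p12(1)] in auto)
  have s2: "p2 ` carrier E2 = carrier F2"
  proof (intro equalityI subsetI)
    fix v assume "v \<in> carrier F2"
    with pairs[of "\<zero>\<^bsub>F1\<^esub>" v] show "v \<in> p2 ` carrier E2" by auto
  qed (use linear_mapsD(1)[OF p12(2)] in auto)
  obtain \<alpha> where \<alpha>: "\<alpha> \<in> linear_maps R A E1" "\<forall>a\<in>carrier A. p1 (\<alpha> a) = h1 (a, \<zero>\<^bsub>B\<^esub>)"
    using projective_module_lift[OF A ED(1) FD(1) p12(1) s1 linear_maps_compose[OF direct_sum_inl[OF mod] h(1)]]
    by auto
  obtain \<beta> where \<beta>: "\<beta> \<in> linear_maps R B E2" "\<forall>b\<in>carrier B. p2 (\<beta> b) = h2 (\<zero>\<^bsub>A\<^esub>, b)"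
    using projective_module_lift[OF B ED(2) FD(2) p12(2) s2 linear_maps_compose[OF direct_sum_inr[OF mod] h(2)]]
    by auto
  define k1 where "k1 v = \<alpha> (fst v) \<oplus>\<^bsub>E1\<^esub> gE (\<beta> (snd v))" for v
  define k2 where "k2 v = fE (\<alpha> (fst v)) \<oplus>\<^bsub>E2\<^esub> \<beta> (snd v)" for v
  note lin = linear_mapsD[OF \<alpha>(1)] linear_mapsD[OF \<beta>(1)] linear_mapsD[OF ED(5)] linear_mapsD[OF ED(6)]
  have k1: "k1 \<in> linear_maps R (direct_sum A B) E1"
    unfolding k1_def
    by (rule linear_maps_add[OF ED(3) linear_maps_compose[OF direct_sum_fst[OF mod] \<alpha>(1)]
        linear_maps_compose[OF direct_sum_snd[OF mod] linear_maps_compose[OF \<beta>(1) ED(6)]]])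
  have k2: "k2 \<in> linear_maps R (direct_sum A B) E2"
    unfolding k2_def
    by (rule linear_maps_add[OF ED(4) linear_maps_compose[OF direct_sum_fst[OF mod] linear_maps_compose[OF \<alpha>(1) ED(5)]]
        linear_maps_compose[OF direct_sum_snd[OF mod] \<beta>(1)]])
  have K: "map_prod k1 k2 \<in> linear_maps \<Delta> (induced_module A B) (pair_module E1 E2 fE gE)"
  proof (rule pair_module_map[OF U E12(1) k1 k2])
    show "k2 (induced_f B x) = fE (k1 x)" if "x \<in> carrier (direct_sum A B)" for x
      using that by (auto simp: k1_def k2_def induced_f_def lin ED(8))
    show "k1 (induced_g A x) = gE (k2 x)" if "x \<in> carrier (direct_sum A B)" for x
      using that by (auto simp: k1_def k2_def induced_g_def lin ED(7))
  qed
  have h1: "p1 (k1 x) = h1 x" if "x \<in> carrier (direct_sum A B)" for x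
  proof -
    obtain a b where x: "x = (a, b)" "a \<in> carrier A" "b \<in> carrier B" using \<open>x \<in> _\<close> by auto
    have "p1 (k1 x) = h1 (a, \<zero>\<^bsub>B\<^esub>) \<oplus>\<^bsub>F1\<^esub> gF (h2 (\<zero>\<^bsub>A\<^esub>, b))"
      using x \<alpha>(2) \<beta>(2) by (simp add: k1_def linear_mapsD[OF p12(1)] lin p12(4))
    also have "gF (h2 (\<zero>\<^bsub>A\<^esub>, b)) = h1 (\<zero>\<^bsub>A\<^esub>, b)"
      using h(4)[of "(\<zero>\<^bsub>A\<^esub>, b)"] x by (simp add: induced_g_def)
    also have "h1 (a, \<zero>\<^bsub>B\<^esub>) \<oplus>\<^bsub>F1\<^esub> h1 (\<zero>\<^bsub>A\<^esub>, b) = h1 x"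
      using linear_mapsD(2)[OF h(1), of "(a, \<zero>\<^bsub>B\<^esub>)" "(\<zero>\<^bsub>A\<^esub>, b)"] x by simp
    finally show ?thesis .
  qed
  have h2: "p2 (k2 x) = h2 x" if "x \<in> carrier (direct_sum A B)" for x
  proof -
    obtain a b where x: "x = (a, b)" "a \<in> carrier A" "b \<in> carrier B" using \<open>x \<in> _\<close> by auto
    have "p2 (k2 x) = fF (h1 (a, \<zero>\<^bsub>B\<^esub>)) \<oplus>\<^bsub>F2\<^esub> h2 (\<zero>\<^bsub>A\<^esub>, b)"
      using x \<alpha>(2) \<beta>(2) by (simp add: k2_def linear_mapsD[OF p12(2)] lin p12(3))
    also have "fF (h1 (a, \<zero>\<^bsub>B\<^esub>)) = h2 (a, \<zero>\<^bsub>B\<^esub>)"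
      using h(3)[of "(a, \<zero>\<^bsub>B\<^esub>)"] x by (simp add: induced_f_def)
    also have "h2 (a, \<zero>\<^bsub>B\<^esub>) \<oplus>\<^bsub>F2\<^esub> h2 (\<zero>\<^bsub>A\<^esub>, b) = h2 x"
      using linear_mapsD(2)[OF h(2), of "(a, \<zero>\<^bsub>B\<^esub>)" "(\<zero>\<^bsub>A\<^esub>, b)"] x by simp
    finally show ?thesis .
  qed
  have "p (e' (map_prod k1 k2 v)) = H v" if "v \<in> carrier (induced_module A B)" for v
  proof -
    have "v \<in> carrier (direct_sum A B) \<times> carrier (direct_sum A B)"
      using that by (simp only: pair_module_simps)
    then obtain x y where v: "v = (x, y)" "x \<in> carrier (direct_sum A B)" "y \<in> carrier (direct_sum A B)"
      by (rule SigmaE)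
    have "c (p (e' (map_prod k1 k2 v))) = c (H v)"
      using v linear_mapsD(1)[OF k1 v(2)] linear_mapsD(1)[OF k2 v(3)]
      by (simp add: p12(5) h(5) h1 h2 del: direct_sum_simps)
    moreover have "map_prod k1 k2 v \<in> carrier (pair_module E1 E2 fE gE)" "H v \<in> carrier F"
      using linear_mapsD(1)[OF K that] linear_mapsD(1)[OF H that] by simp_all
    ultimately show ?thesis
      using c(3) linear_mapsD(1)[OF p] linear_mapsD(1)[OF e(2)] by metis
  qed
  then show "\<exists>K\<in>linear_maps \<Delta> (induced_module A B) E. \<forall>v\<in>carrier (induced_module A B). p (K v) = H v"
    by (intro bexI[OF _ linear_maps_compose[OF K e(2)]]) auto
qed


section \<open>Exact sequences over the Morita ring are pairs of exact sequences\<close>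

text \<open>Exactness of a sequence of pairs can be checked on components, and by the description of the
  \<open>\<Delta>\<close>-dual so can the extension of maps to the ring.  Projectivity behaves differently: it passes
  from a pair to its components, but has to be assumed for the pair.\<close>

lemma dual_exact_pairI:
  assumes N: "z_factorization N1 N2 fN gN" and P: "z_factorization P1 P2 fP gP"
    and X: "z_factorization X Y f g"
    and proj: "projective_module \<Delta> (pair_module P1 P2 fP gP)"
    and ses1: "dual_exact R N1 P1 X i1 p1" and ses2: "dual_exact R N2 P2 Y i2 p2"
    and i: "\<And>x. x \<in> carrier N1 \<Longrightarrow> i2 (fN x) = fP (i1 x)" "\<And>y. y \<in> carrier N2 \<Longrightarrow> i1 (gN y) = gP (i2 y)"
    and p: "\<And>x. x \<in> carrier P1 \<Longrightarrow> p2 (fP x) = f (p1 x)" "\<And>y. y \<in> carrier P2 \<Longrightarrow> p1 (gP y) = g (p2 y)"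
  shows "dual_exact \<Delta> (pair_module N1 N2 fN gN) (pair_module P1 P2 fP gP) (pair_module X Y f g)
    (map_prod i1 i2) (map_prod p1 p2)"
proof -
  note D1 = dual_exactD[OF ses1] and D2 = dual_exactD[OF ses2]
  show ?thesis
    unfolding dual_exact_def
  proof (intro conjI ballI)
    show "fg_module \<Delta> (pair_module N1 N2 fN gN)" "projective_module \<Delta> (pair_module P1 P2 fP gP)"
      "fg_module \<Delta> (pair_module X Y f g)" using N X proj by (simp_all add: fg_pair_module)
    show "map_prod i1 i2 \<in> linear_maps \<Delta> (pair_module N1 N2 fN gN) (pair_module P1 P2 fP gP)"
      by (rule pair_module_map[OF N P D1(7) D2(7) i])
    show "map_prod p1 p2 \<in> linear_maps \<Delta> (pair_module P1 P2 fP gP) (pair_module X Y f g)"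
      by (rule pair_module_map[OF P X D1(8) D2(8) p])
    show "inj_on (map_prod i1 i2) (carrier (pair_module N1 N2 fN gN))"
      using D1(9) D2(9) by (auto simp: inj_on_def)
    have "map_prod i1 i2 ` (carrier N1 \<times> carrier N2) = map_kernel P1 X p1 \<times> map_kernel P2 Y p2"
      by (rule map_prod_surj_on[OF D1(10) D2(10)])
    then show "map_prod i1 i2 ` carrier (pair_module N1 N2 fN gN) =
        map_kernel (pair_module P1 P2 fP gP) (pair_module X Y f g) (map_prod p1 p2)"
      by (auto simp: map_kernel_def)
    show "map_prod p1 p2 ` carrier (pair_module P1 P2 fP gP) = carrier (pair_module X Y f g)"
      by (simp add: map_prod_surj_on[OF D1(11) D2(11)])
    fix H assume "H \<in> functionals \<Delta> (pair_module N1 N2 fN gN)"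
    then obtain h k where hk: "h \<in> functionals R N1" "k \<in> functionals R N2"
      "\<And>x y. x \<in> carrier N1 \<Longrightarrow> y \<in> carrier N2 \<Longrightarrow>
        H (x, y) = Matrix2 (k (fN x)) (h x) (k y) (h (gN y))"
      by (rule pair_module_dualE[OF N]) (rule that)
    obtain h' where h': "h' \<in> functionals R P1" "\<forall>x\<in>carrier N1. h' (i1 x) = h x"
      using D1(12)[OF hk(1)] by blast
    obtain k' where k': "k' \<in> functionals R P2" "\<forall>x\<in>carrier N2. k' (i2 x) = k x"
      using D2(12)[OF hk(2)] by blast
    show "\<exists>K\<in>functionals \<Delta> (pair_module P1 P2 fP gP).
        \<forall>v\<in>carrier (pair_module N1 N2 fN gN). K (map_prod i1 i2 v) = H v"
      using z_factorizationD(5,6)[OF N]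
      by (intro bexI[OF _ pair_module_dualI[OF P h'(1) k'(1)]])
         (auto simp: hk(3) h'(2) k'(2) i[symmetric] linear_mapsD(1))
  qed
qed

lemma dual_exact_pairD:
  assumes N: "z_factorization N1 N2 fN gN" and P: "z_factorization P1 P2 fP gP"
    and X: "z_factorization X Y f g"
    and ses: "dual_exact \<Delta> (pair_module N1 N2 fN gN) (pair_module P1 P2 fP gP) (pair_module X Y f g) i p"
  shows "\<exists>i1 p1. dual_exact R N1 P1 X i1 p1" and "\<exists>i2 p2. dual_exact R N2 P2 Y i2 p2"
proof -
  note D = dual_exactD[OF ses]
  note ND = z_factorizationD[OF N] and PD = z_factorizationD[OF P] and XD = z_factorizationD[OF X]
  interpret N1: left_module R N1 by (rule ND)
  interpret N2: left_module R N2 by (rule ND)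
  interpret P1: left_module R P1 by (rule PD)
  interpret P2: left_module R P2 by (rule PD)
  interpret X: left_module R X by (rule XD)
  interpret Y: left_module R Y by (rule XD)
  obtain i1 i2 where i: "i1 \<in> linear_maps R N1 P1" "i2 \<in> linear_maps R N2 P2"
    "\<And>x y. x \<in> carrier N1 \<Longrightarrow> y \<in> carrier N2 \<Longrightarrow> i (x, y) = (i1 x, i2 y)"
    by (rule pair_module_map_cases[OF N P D(7)]) (rule that)
  obtain p1 p2 where p: "p1 \<in> linear_maps R P1 X" "p2 \<in> linear_maps R P2 Y"
    "\<And>x y. x \<in> carrier P1 \<Longrightarrow> y \<in> carrier P2 \<Longrightarrow> p (x, y) = (p1 x, p2 y)"
    by (rule pair_module_map_cases[OF P X D(8)]) (rule that)
  have i0: "i1 \<zero>\<^bsub>N1\<^esub> = \<zero>\<^bsub>P1\<^esub>" "i2 \<zero>\<^bsub>N2\<^esub> = \<zero>\<^bsub>P2\<^esub>"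
    using linear_maps_zero i ND PD by metis+
  have "i ` (carrier N1 \<times> carrier N2) = map_prod i1 i2 ` (carrier N1 \<times> carrier N2)"
    by (intro image_cong) (auto simp: i)
  then have im: "(i1 ` carrier N1) \<times> (i2 ` carrier N2) = map_kernel P1 X p1 \<times> map_kernel P2 Y p2"
    using D(10) by (auto simp: map_prod_surj_on map_kernel_def p)
  have "\<zero>\<^bsub>P1\<^esub> \<in> i1 ` carrier N1" "\<zero>\<^bsub>P2\<^esub> \<in> i2 ` carrier N2"
    using i0 N1.M.zero_closed N2.M.zero_closed by (metis imageI)+
  then have ker: "i1 ` carrier N1 = map_kernel P1 X p1" "i2 ` carrier N2 = map_kernel P2 Y p2"
    using im by (metis empty_iff times_eq_iff)+
  have "p ` (carrier P1 \<times> carrier P2) = map_prod p1 p2 ` (carrier P1 \<times> carrier P2)"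
    by (intro image_cong) (auto simp: p)
  then have "(p1 ` carrier P1) \<times> (p2 ` carrier P2) = carrier X \<times> carrier Y"
    using D(11) by (simp add: map_prod_surj_on)
  then have surj: "p1 ` carrier P1 = carrier X" "p2 ` carrier P2 = carrier Y"
    using X.M.zero_closed Y.M.zero_closed by (metis empty_iff times_eq_iff)+
  have inj: "inj_on i1 (carrier N1)" "inj_on i2 (carrier N2)"
  proof -
    show "inj_on i1 (carrier N1)"
    proof (rule inj_onI)
      fix x y assume "x \<in> carrier N1" "y \<in> carrier N1" "i1 x = i1 y"
      then show "x = y" using inj_onD[OF D(9), of "(x, \<zero>\<^bsub>N2\<^esub>)" "(y, \<zero>\<^bsub>N2\<^esub>)"] by (simp add: i)
    qed
    show "inj_on i2 (carrier N2)"
    proof (rule inj_onI)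
      fix x y assume "x \<in> carrier N2" "y \<in> carrier N2" "i2 x = i2 y"
      then show "x = y" using inj_onD[OF D(9), of "(\<zero>\<^bsub>N1\<^esub>, x)" "(\<zero>\<^bsub>N1\<^esub>, y)"] by (simp add: i)
    qed
  qed
  have zero_lin: "(\<lambda>_. \<zero>) \<in> functionals R M" for M :: "('a, 'q, 'r) module_scheme"
    by (rule linear_mapsI) auto
  have ext: "\<exists>h'\<in>functionals R P1. \<exists>k'\<in>functionals R P2.
      (\<forall>x\<in>carrier N1. h' (i1 x) = h x) \<and> (\<forall>y\<in>carrier N2. k' (i2 y) = k y)"
    if h: "h \<in> functionals R N1" and k: "k \<in> functionals R N2" for h k
  proof -
    obtain K where K: "K \<in> functionals \<Delta> (pair_module P1 P2 fP gP)"
      "\<forall>v\<in>carrier (pair_module N1 N2 fN gN). K (i v) =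
        (\<lambda>(x, y). Matrix2 (k (fN x)) (h x) (k y) (h (gN y))) v"
      using D(12)[OF pair_module_dualI[OF N h k]] by blast
    obtain h' k' where hk: "h' \<in> functionals R P1" "k' \<in> functionals R P2"
      "\<And>x y. x \<in> carrier P1 \<Longrightarrow> y \<in> carrier P2 \<Longrightarrow>
        K (x, y) = Matrix2 (k' (fP x)) (h' x) (k' y) (h' (gP y))"
      by (rule pair_module_dualE[OF P K(1)]) (rule that)
    have "h' (i1 x) = h x \<and> k' (i2 y) = k y" if "x \<in> carrier N1" "y \<in> carrier N2" for x y
      using K(2)[rule_format, of "(x, y)"] that
      by (simp add: i hk(3) linear_mapsD(1)[OF i(1)] linear_mapsD(1)[OF i(2)])
    then have "(\<forall>x\<in>carrier N1. h' (i1 x) = h x) \<and> (\<forall>y\<in>carrier N2. k' (i2 y) = k y)"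
      using N1.M.zero_closed N2.M.zero_closed by blast
    with hk(1,2) show ?thesis by blast
  qed
  have "dual_exact R N1 P1 X i1 p1"
    unfolding dual_exact_def
  proof (intro conjI ballI ND XD projective_pair_fst[OF P D(2)] i p inj ker surj)
    fix h assume "h \<in> functionals R N1"
    from ext[OF this zero_lin] show "\<exists>h'\<in>functionals R P1. \<forall>x\<in>carrier N1. h' (i1 x) = h x"
      by auto
  qed
  then show "\<exists>i1 p1. dual_exact R N1 P1 X i1 p1" by blast
  have "dual_exact R N2 P2 Y i2 p2"
    unfolding dual_exact_def
  proof (intro conjI ballI ND XD projective_pair_snd[OF P D(2)] i p inj ker surj)
    fix k assume "k \<in> functionals R N2"
    from ext[OF zero_lin this] show "\<exists>k'\<in>functionals R P2. \<forall>x\<in>carrier N2. k' (i2 x) = k x"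
      by auto
  qed
  then show "\<exists>i2 p2. dual_exact R N2 P2 Y i2 p2" by blast
qed

end

lemma dual_exact_middle:
  assumes ses: "dual_exact R N P M i p" and P': "left_module R P'"
    and a: "a \<in> linear_maps R P P'" "a' \<in> linear_maps R P' P"
      "\<And>x. x \<in> carrier P \<Longrightarrow> a' (a x) = x" "\<And>y. y \<in> carrier P' \<Longrightarrow> a (a' y) = y"
  shows "dual_exact R N P' M (\<lambda>x. a (i x)) (\<lambda>x. p (a' x))"
  by (rule dual_exact_transport[OF ses _ P' _ linear_maps_id linear_maps_id _ _ a
        linear_maps_id linear_maps_id])
     (use dual_exactD[OF ses] in auto)

text \<open>Swapping and shearing the middle term adjust the direct sums of exact sequences so that they
  commute with the structure maps of pairs.\<close>

lemma dual_exact_swap: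
  assumes ses: "dual_exact R N (direct_sum A B) M i p" and A: "left_module R A" and B: "left_module R B"
  shows "dual_exact R N (direct_sum B A) M (\<lambda>x. prod.swap (i x)) (\<lambda>v. p (prod.swap v))"
  by (rule dual_exact_middle[OF ses left_module_direct_sum[OF B A]])
     (auto intro!: linear_mapsI)

lemma dual_exact_shear:
  assumes ses: "dual_exact R N (direct_sum A B) M i p" and A: "left_module R A" and B: "left_module R B"
    and k: "k \<in> linear_maps R B A"
  shows "dual_exact R N (direct_sum A B) M (\<lambda>x. case i x of (a, b) \<Rightarrow> (a \<oplus>\<^bsub>A\<^esub> k b, b))
    (\<lambda>v. p (case v of (a, b) \<Rightarrow> (a \<oplus>\<^bsub>A\<^esub> \<ominus>\<^bsub>A\<^esub> k b, b)))"
proof -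
  interpret A: left_module R A by fact
  interpret B: left_module R B by fact
  note kD = linear_mapsD[OF k] and mD = linear_mapsD[OF linear_maps_uminus[OF A k]]
  have "(\<lambda>(a, b). (a \<oplus>\<^bsub>A\<^esub> k b, b)) \<in> linear_maps R (direct_sum A B) (direct_sum A B)"
    by (rule linear_mapsI) (auto simp: kD A.smult_r_distr A.M.a_ac)
  moreover have "(\<lambda>(a, b). (a \<oplus>\<^bsub>A\<^esub> \<ominus>\<^bsub>A\<^esub> k b, b)) \<in> linear_maps R (direct_sum A B) (direct_sum A B)"
    by (rule linear_mapsI) (auto simp: kD(1) mD A.smult_r_distr A.M.a_ac)
  ultimately show ?thesis
    by (rule dual_exact_middle[OF ses left_module_direct_sum[OF A B]])
       (auto simp: kD A.M.a_assoc A.M.l_neg A.M.r_neg)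
qed

context central_morita
begin

text \<open>Kernels and cokernels of maps of pairs inherit structure maps from the middle pair, and the
  two composites are still multiplication by \<open>z\<close>.\<close>

lemma z_factorization_sub:
  assumes P: "z_factorization P1 P2 F G"
    and N: "fg_module R N1" "fg_module R N2"
    and i1: "i1 \<in> linear_maps R N1 P1" "inj_on i1 (carrier N1)"
    and i2: "i2 \<in> linear_maps R N2 P2" "inj_on i2 (carrier N2)"
    and F: "\<And>x. x \<in> carrier N1 \<Longrightarrow> F (i1 x) \<in> i2 ` carrier N2"
    and G: "\<And>y. y \<in> carrier N2 \<Longrightarrow> G (i2 y) \<in> i1 ` carrier N1"
  obtains f g where "z_factorization N1 N2 f g"
    "\<And>x. x \<in> carrier N1 \<Longrightarrow> i2 (f x) = F (i1 x)" "\<And>y. y \<in> carrier N2 \<Longrightarrow> i1 (g y) = G (i2 y)"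
proof -
  note PD = z_factorizationD[OF P] and mod = N[THEN fg_moduleD]
  interpret N1: left_module R N1 by (rule mod)
  interpret N2: left_module R N2 by (rule mod)
  obtain f where f: "f \<in> linear_maps R N1 N2" "\<forall>x\<in>carrier N1. i2 (f x) = F (i1 x)"
    using linear_maps_factor_inj[OF mod(2,1) i2 linear_maps_compose[OF i1(1) PD(5)]] F by auto
  obtain g where g: "g \<in> linear_maps R N2 N1" "\<forall>y\<in>carrier N2. i1 (g y) = G (i2 y)"
    using linear_maps_factor_inj[OF mod i1 linear_maps_compose[OF i2(1) PD(6)]] G by auto
  note c = linear_mapsD[OF f(1)] linear_mapsD[OF g(1)] linear_mapsD[OF i1(1)] linear_mapsD[OF i2(1)]
  have "g (f x) = z \<odot>\<^bsub>N1\<^esub> x" if "x \<in> carrier N1" for x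
    by (rule inj_onD[OF i1(2)]) (use that f(2) g(2) in \<open>simp_all add: c PD(7)\<close>)
  moreover have "f (g y) = z \<odot>\<^bsub>N2\<^esub> y" if "y \<in> carrier N2" for y
    by (rule inj_onD[OF i2(2)]) (use that f(2) g(2) in \<open>simp_all add: c PD(8)\<close>)
  ultimately have "z_factorization N1 N2 f g" using N f g by (simp add: z_factorization_def)
  with f g that show ?thesis by simp
qed

lemma z_factorization_quotient:
  assumes P: "z_factorization P1 P2 F G"
    and N: "fg_module R N1" "fg_module R N2"
    and s1: "s1 \<in> linear_maps R P1 N1" "s1 ` carrier P1 = carrier N1"
    and s2: "s2 \<in> linear_maps R P2 N2" "s2 ` carrier P2 = carrier N2"
    and F: "\<And>x. x \<in> carrier P1 \<Longrightarrow> s1 x = \<zero>\<^bsub>N1\<^esub> \<Longrightarrow> s2 (F x) = \<zero>\<^bsub>N2\<^esub>"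
    and G: "\<And>y. y \<in> carrier P2 \<Longrightarrow> s2 y = \<zero>\<^bsub>N2\<^esub> \<Longrightarrow> s1 (G y) = \<zero>\<^bsub>N1\<^esub>"
  obtains f g where "z_factorization N1 N2 f g"
    "\<And>x. x \<in> carrier P1 \<Longrightarrow> s2 (F x) = f (s1 x)" "\<And>y. y \<in> carrier P2 \<Longrightarrow> s1 (G y) = g (s2 y)"
proof -
  note PD = z_factorizationD[OF P] and mod = N[THEN fg_moduleD]
  obtain f where f: "f \<in> linear_maps R N1 N2" "\<forall>x\<in>carrier P1. f (s1 x) = s2 (F x)"
    using linear_maps_factor_surj[OF PD(3) mod s1 linear_maps_compose[OF PD(5) s2(1)]] F by auto
  obtain g where g: "g \<in> linear_maps R N2 N1" "\<forall>y\<in>carrier P2. g (s2 y) = s1 (G y)"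
    using linear_maps_factor_surj[OF PD(4) mod(2,1) s2 linear_maps_compose[OF PD(6) s1(1)]] G by auto
  note c = linear_mapsD[OF PD(5)] linear_mapsD[OF PD(6)] linear_mapsD[OF s1(1)] linear_mapsD[OF s2(1)]
  have "g (f y) = z \<odot>\<^bsub>N1\<^esub> y" if "y \<in> carrier N1" for y
  proof -
    have "y \<in> s1 ` carrier P1" using that s1(2) by simp
    then obtain x where "x \<in> carrier P1" "y = s1 x" by auto
    then show ?thesis using f(2) g(2) by (simp add: c PD(7))
  qed
  moreover have "f (g y) = z \<odot>\<^bsub>N2\<^esub> y" if "y \<in> carrier N2" for y
  proof -
    have "y \<in> s2 ` carrier P2" using that s2(2) by simp
    then obtain x where "x \<in> carrier P2" "y = s2 x" by auto
    then show ?thesis using f(2) g(2) by (simp add: c PD(8))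
  qed
  ultimately have "z_factorization N1 N2 f g" using N f g by (simp add: z_factorization_def)
  with f g that show ?thesis by simp
qed


section \<open>Syzygies and cosyzygies of pairs\<close>

text \<open>The induced module covers the pair by \<open>(a, b) \<mapsto> p a + g (q b)\<close> in the first component and
  \<open>(a, b) \<mapsto> f (p a) + q b\<close> in the second.  As \<open>Q\<close> is projective, \<open>g q\<close> factors through \<open>p\<close>, and the
  corresponding shear turns the first map into \<open>(a, b) \<mapsto> p a\<close>, with kernel \<open>N \<oplus> Q\<close>; the second
  component is symmetric.\<close>

lemma pair_module_syzygy:
  fixes X :: "('a, 'x, 'm) module_scheme" and Y :: "('a, 'y, 'n) module_scheme"
  assumes F: "z_factorization X Y f g"
    and X: "gorenstein_projective R X" and Y: "gorenstein_projective R Y"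
  obtains N1 N2 :: "('a, (nat \<Rightarrow> 'a) set \<times> (nat \<Rightarrow> 'a) set) module" and fN gN
    and P Q :: "'a small_module" and i p
  where "z_factorization N1 N2 fN gN" "gorenstein_projective R N1" "gorenstein_projective R N2"
    "dual_exact \<Delta> (pair_module N1 N2 fN gN) (induced_module P Q) (pair_module X Y f g) i p"
proof -
  note D = z_factorizationD[OF F]
  obtain N P :: "'a small_module" and i p
    where N: "gorenstein_projective R N" and ses: "dual_exact R N P X i p"
    by (rule gorenstein_projective_syzygy[OF X]) (rule that)
  obtain N' Q :: "'a small_module" and j q
    where N': "gorenstein_projective R N'" and ses': "dual_exact R N' Q Y j q"
    by (rule gorenstein_projective_syzygy[OF Y]) (rule that)
  note E = dual_exactD[OF ses] and E' = dual_exactD[OF ses']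
  interpret P: left_module R P by (rule E)
  interpret Q: left_module R Q by (rule E')
  interpret X: left_module R X by (rule D)
  interpret Y: left_module R Y by (rule D)
  \<comment> \<open>The signs make up for the subtraction in the inverse of the shear.\<close>
  obtain k where k: "k \<in> linear_maps R Q P" "\<forall>b\<in>carrier Q. p (k b) = \<ominus>\<^bsub>X\<^esub> g (q b)"
    using projective_module_lift[OF E'(2) projective_moduleD[OF E(2)] E(3) E(8) E(11)
        linear_maps_uminus[OF E(6) linear_maps_compose[OF E'(8) D(6)]]] by auto
  obtain l where l: "l \<in> linear_maps R P Q" "\<forall>a\<in>carrier P. q (l a) = \<ominus>\<^bsub>Y\<^esub> f (p a)"
    using projective_module_lift[OF E(2) projective_moduleD[OF E'(2)] E'(3) E'(8) E'(11)
        linear_maps_uminus[OF E'(6) linear_maps_compose[OF E(8) D(5)]]] by auto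
  note c = linear_mapsD[OF k(1)] linear_mapsD[OF l(1)] linear_mapsD[OF E(8)] linear_mapsD[OF E'(8)]
    linear_mapsD[OF D(5)] linear_mapsD[OF D(6)]
    linear_maps_minus[OF E(5,6,8)] linear_maps_minus[OF E'(5,6,8)]
  let ?PQ = "direct_sum P Q"
  define N1 where "N1 = direct_sum N Q"
  define N2 where "N2 = direct_sum N' P"
  obtain i1 p1 where ses1: "dual_exact R N1 ?PQ X i1 p1"
    and p1: "\<And>a b. a \<in> carrier P \<Longrightarrow> b \<in> carrier Q \<Longrightarrow> p1 (a, b) = p a \<oplus>\<^bsub>X\<^esub> g (q b)"
    by (rule that[OF dual_exact_shear[OF dual_exact_add_left[OF ses E'(2)] E(5) E'(5) k(1), folded N1_def]])
       (use k(2) in \<open>simp add: c\<close>)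
  obtain i2 p2 where ses2: "dual_exact R N2 ?PQ Y i2 p2"
    and p2: "\<And>a b. a \<in> carrier P \<Longrightarrow> b \<in> carrier Q \<Longrightarrow> p2 (a, b) = f (p a) \<oplus>\<^bsub>Y\<^esub> q b"
    by (rule that[OF dual_exact_swap[OF dual_exact_shear[OF dual_exact_add_left[OF ses' E(2)] E'(5) E(5) l(1)]
          E'(5) E(5), folded N2_def]])
       (use l(2) in \<open>simp add: c Y.M.a_ac\<close>)
  note D1 = dual_exactD[OF ses1] and D2 = dual_exactD[OF ses2]
  note U = z_factorization_induced[OF projective_moduleD[OF E(2)] projective_moduleD[OF E'(2)]]
  note UD = z_factorizationD[OF U]
  have pf: "p2 (induced_f Q v) = f (p1 v)" if "v \<in> carrier ?PQ" for v
    using that by (auto simp: p1 p2 induced_f_def c D(8))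
  have pg: "p1 (induced_g P v) = g (p2 v)" if "v \<in> carrier ?PQ" for v
    using that by (auto simp: p1 p2 induced_g_def c D(7))
  have kerF: "induced_f Q (i1 x) \<in> i2 ` carrier N2" if "x \<in> carrier N1" for x
    using that linear_mapsD(1)[OF D1(7)] linear_mapsD(1)[OF UD(5)] dual_exact_comp_zero[OF ses1]
      linear_maps_zero[OF D(3,4,5)]
    by (simp add: D2(10) map_kernel_def pf del: direct_sum_simps)
  have kerG: "induced_g P (i2 x) \<in> i1 ` carrier N1" if "x \<in> carrier N2" for x
    using that linear_mapsD(1)[OF D2(7)] linear_mapsD(1)[OF UD(6)] dual_exact_comp_zero[OF ses2]
      linear_maps_zero[OF D(4,3,6)]
    by (simp add: D1(10) map_kernel_def pg del: direct_sum_simps)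
  obtain fN gN where FN: "z_factorization N1 N2 fN gN"
    "\<And>x. x \<in> carrier N1 \<Longrightarrow> i2 (fN x) = induced_f Q (i1 x)"
    "\<And>y. y \<in> carrier N2 \<Longrightarrow> i1 (gN y) = induced_g P (i2 y)"
    by (rule z_factorization_sub[OF U D1(1) D2(1) D1(7,9) D2(7,9)])
      (erule kerF, erule kerG, rule that)
  have "gorenstein_projective R N1" "gorenstein_projective R N2"
    unfolding N1_def N2_def
    by (rule gorenstein_projective_direct_sum[OF N E'(2)] gorenstein_projective_direct_sum[OF N' E(2)])+
  from that[OF FN(1) this dual_exact_pairI[OF FN(1) U F projective_induced_module[OF E(2) E'(2)]
      ses1 ses2 FN(2,3) pf pg]]
  show ?thesis .
qed

text \<open>Dually, the pair embeds into the induced module by \<open>x \<mapsto> (j' (f x), j x)\<close> and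
  \<open>y \<mapsto> (j' y, j (g y))\<close>.  Here the shear comes from extending \<open>j' f : X \<rightarrow> J\<close> along \<open>j : X \<rightarrow> I\<close>, which
  is possible because \<open>J\<close> is projective and the sequence is dual exact.\<close>

lemma pair_module_cosyzygy:
  fixes X :: "('a, 'x, 'm) module_scheme" and Y :: "('a, 'y, 'n) module_scheme"
  assumes F: "z_factorization X Y f g"
    and X: "gorenstein_projective R X" and Y: "gorenstein_projective R Y"
  obtains N1 N2 :: "('a, (nat \<Rightarrow> 'a) set \<times> (nat \<Rightarrow> 'a) set) module" and fN gN
    and J I :: "'a small_module" and i p
  where "z_factorization N1 N2 fN gN" "gorenstein_projective R N1" "gorenstein_projective R N2"
    "dual_exact \<Delta> (pair_module X Y f g) (induced_module J I) (pair_module N1 N2 fN gN) i p"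
proof -
  note D = z_factorizationD[OF F]
  obtain C I :: "'a small_module" and j p
    where C: "gorenstein_projective R C" and ses: "dual_exact R X I C j p"
    by (rule gorenstein_projective_cosyzygy[OF X]) (rule that)
  obtain C' J :: "'a small_module" and j' p'
    where C': "gorenstein_projective R C'" and ses': "dual_exact R Y J C' j' p'"
    by (rule gorenstein_projective_cosyzygy[OF Y]) (rule that)
  note E = dual_exactD[OF ses] and E' = dual_exactD[OF ses']
  interpret I: left_module R I by (rule E)
  interpret J: left_module R J by (rule E')
  interpret X: left_module R X by (rule D)
  interpret Y: left_module R Y by (rule D)
  obtain k where k: "k \<in> linear_maps R I J" "\<forall>x\<in>carrier X. k (j x) = j' (f x)"
    using dual_exact_extend[OF ses E'(2) linear_maps_compose[OF D(5) E'(7)]] by auto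
  obtain l where l: "l \<in> linear_maps R J I" "\<forall>y\<in>carrier Y. l (j' y) = j (g y)"
    using dual_exact_extend[OF ses' E(2) linear_maps_compose[OF D(6) E(7)]] by auto
  note c = linear_mapsD[OF k(1)] linear_mapsD[OF l(1)] linear_mapsD[OF E(7)] linear_mapsD[OF E'(7)]
    linear_mapsD[OF D(5)] linear_mapsD[OF D(6)]
  let ?JI = "direct_sum J I"
  define N1 where "N1 = direct_sum C J"
  define N2 where "N2 = direct_sum C' I"
  obtain i1 p1 where ses1: "dual_exact R X ?JI N1 i1 p1"
    and i1: "\<And>x. x \<in> carrier X \<Longrightarrow> i1 x = (j' (f x), j x)"
    by (rule that[OF dual_exact_shear[OF dual_exact_swap[OF dual_exact_add_right[OF ses E'(2)] E(5) E'(5)]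
          E'(5) E(5) k(1), folded N1_def]])
       (use k(2) in \<open>simp add: c\<close>)
  obtain i2 p2 where ses2: "dual_exact R Y ?JI N2 i2 p2"
    and i2: "\<And>y. y \<in> carrier Y \<Longrightarrow> i2 y = (j' y, j (g y))"
    by (rule that[OF dual_exact_swap[OF dual_exact_shear[OF dual_exact_swap[OF
          dual_exact_add_right[OF ses' E(2)] E'(5) E(5)] E(5) E'(5) l(1)] E(5) E'(5), folded N2_def]])
       (use l(2) in \<open>simp add: c\<close>)
  note D1 = dual_exactD[OF ses1] and D2 = dual_exactD[OF ses2]
  note U = z_factorization_induced[OF projective_moduleD[OF E'(2)] projective_moduleD[OF E(2)]]
  have fi: "i2 (f x) = induced_f I (i1 x)" if "x \<in> carrier X" for x
    using that by (simp add: i1 i2 induced_f_def c D(7))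
  have gi: "i1 (g y) = induced_g J (i2 y)" if "y \<in> carrier Y" for y
    using that by (simp add: i1 i2 induced_g_def c D(8))
  have cokF: "p2 (induced_f I v) = \<zero>\<^bsub>N2\<^esub>" if v: "v \<in> carrier ?JI" "p1 v = \<zero>\<^bsub>N1\<^esub>" for v
  proof -
    have "v \<in> i1 ` carrier X" using v by (simp add: D1(10) map_kernel_def)
    then obtain x where "x \<in> carrier X" "v = i1 x" by auto
    then show ?thesis using dual_exact_comp_zero[OF ses2, of "f x"] fi[of x] by (simp add: c)
  qed
  have cokG: "p1 (induced_g J v) = \<zero>\<^bsub>N1\<^esub>" if v: "v \<in> carrier ?JI" "p2 v = \<zero>\<^bsub>N2\<^esub>" for v
  proof -
    have "v \<in> i2 ` carrier Y" using v by (simp add: D2(10) map_kernel_def)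
    then obtain y where "y \<in> carrier Y" "v = i2 y" by auto
    then show ?thesis using dual_exact_comp_zero[OF ses1, of "g y"] gi[of y] by (simp add: c)
  qed
  obtain fN gN where FN: "z_factorization N1 N2 fN gN"
    "\<And>x. x \<in> carrier ?JI \<Longrightarrow> p2 (induced_f I x) = fN (p1 x)"
    "\<And>y. y \<in> carrier ?JI \<Longrightarrow> p1 (induced_g J y) = gN (p2 y)"
    by (rule z_factorization_quotient[OF U D1(3) D2(3) D1(8,11) D2(8,11)])
      (erule (1) cokF, erule (1) cokG, rule that)
  have "gorenstein_projective R N1" "gorenstein_projective R N2"
    unfolding N1_def N2_def
    by (rule gorenstein_projective_direct_sum[OF C E'(2)] gorenstein_projective_direct_sum[OF C' E(2)])+
  from that[OF FN(1) this dual_exact_pairI[OF F U FN(1) projective_induced_module[OF E'(2) E(2)]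
      ses1 ses2 fi gi FN(2,3)]]
  show ?thesis .
qed

lemma pair_module_small:
  fixes X :: "('a, 'x, 'm) module_scheme" and Y :: "('a, 'y, 'n) module_scheme"
  assumes F: "z_factorization X Y f g"
  obtains X' Y' :: "'a small_module" and f' g'
  where "z_factorization X' Y' f' g'" "module_iso R X X'" "module_iso R Y Y'"
    "module_iso \<Delta> (pair_module X Y f g) (pair_module X' Y' f' g')"
proof -
  note D = z_factorizationD[OF F]
  obtain X' :: "'a small_module" where X': "fg_module R X'" "module_iso R X X'"
    using fg_module_small[OF D(1)] by blast
  obtain Y' :: "'a small_module" where Y': "fg_module R Y'" "module_iso R Y Y'"
    using fg_module_small[OF D(2)] by blast
  obtain a a' where a: "a \<in> linear_maps R X X'" "a' \<in> linear_maps R X' X"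
    "\<And>x. x \<in> carrier X \<Longrightarrow> a' (a x) = x" "\<And>y. y \<in> carrier X' \<Longrightarrow> a (a' y) = y"
    by (rule module_isoE[OF X'(2) D(3) fg_moduleD[OF X'(1)]]) (rule that)
  obtain b b' where b: "b \<in> linear_maps R Y Y'" "b' \<in> linear_maps R Y' Y"
    "\<And>x. x \<in> carrier Y \<Longrightarrow> b' (b x) = x" "\<And>y. y \<in> carrier Y' \<Longrightarrow> b (b' y) = y"
    by (rule module_isoE[OF Y'(2) D(4) fg_moduleD[OF Y'(1)]]) (rule that)
  note c = linear_mapsD[OF a(1)] linear_mapsD[OF b(1)] linear_mapsD[OF a(2)] linear_mapsD[OF b(2)]
    linear_mapsD[OF D(5)] linear_mapsD[OF D(6)]
  define f' where "f' x = b (f (a' x))" for x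
  define g' where "g' y = a (g (b' y))" for y
  have F': "z_factorization X' Y' f' g'"
    unfolding z_factorization_def
  proof (intro conjI ballI X' Y')
    show "f' \<in> linear_maps R X' Y'" unfolding f'_def
      by (rule linear_maps_compose[OF a(2) linear_maps_compose[OF D(5) b(1)]])
    show "g' \<in> linear_maps R Y' X'" unfolding g'_def
      by (rule linear_maps_compose[OF b(2) linear_maps_compose[OF D(6) a(1)]])
  qed (simp_all add: f'_def g'_def c a b D)
  have "map_prod a b \<in> linear_maps \<Delta> (pair_module X Y f g) (pair_module X' Y' f' g')"
    by (rule pair_module_map[OF F F' a(1) b(1)]) (simp_all add: f'_def g'_def a b)
  then have "module_iso \<Delta> (pair_module X Y f g) (pair_module X' Y' f' g')"
    by (rule module_isoI[where k = "map_prod a' b'"]) (auto simp: a b c)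
  with F' X'(2) Y'(2) show ?thesis by (rule that)
qed

lemma gorenstein_projective_pair_module:
  fixes X :: "('a, 'x, 'm) module_scheme" and Y :: "('a, 'y, 'n) module_scheme"
  assumes F: "z_factorization X Y f g"
    and X: "gorenstein_projective R X" and Y: "gorenstein_projective R Y"
  shows "gorenstein_projective \<Delta> (pair_module X Y f g)"
proof -
  define C where "C M \<longleftrightarrow> (\<exists>(X :: 'a small_module) (Y :: 'a small_module) f g. z_factorization X Y f g \<and>
      gorenstein_projective R X \<and> gorenstein_projective R Y \<and> M = pair_module X Y f g)" for M
  have small: "\<exists>M. C M \<and> left_module \<Delta> M \<and> module_iso \<Delta> (pair_module X Y f g) M"
    if F: "z_factorization X Y f g" and X: "gorenstein_projective R X" and Y: "gorenstein_projective R Y"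
    for X :: "('a, 'u, 'v) module_scheme" and Y :: "('a, 'w, 'k) module_scheme" and f g
  proof -
    obtain X' Y' :: "'a small_module" and f' g'
      where F': "z_factorization X' Y' f' g'" "module_iso R X X'" "module_iso R Y Y'"
        "module_iso \<Delta> (pair_module X Y f g) (pair_module X' Y' f' g')"
      by (rule pair_module_small[OF F]) (rule that)
    have "C (pair_module X' Y' f' g')" unfolding C_def
      using F'(1) gorenstein_projective_iso[OF X z_factorizationD(3)[OF F'(1)] F'(2)]
        gorenstein_projective_iso[OF Y z_factorizationD(4)[OF F'(1)] F'(3)] by blast
    with F'(4) left_module_pair_module[OF F'(1)] show ?thesis by blast
  qed
  obtain M where M: "C M" "left_module \<Delta> M" "module_iso \<Delta> (pair_module X Y f g) M"
    using small[OF F X Y] by blast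
  have "gorenstein_projective \<Delta> M"
  proof (rule gorenstein_projective_coinduct[where C = C])
    fix M assume "C M"
    then obtain X Y :: "'a small_module" and f g
      where F: "z_factorization X Y f g" "gorenstein_projective R X" "gorenstein_projective R Y"
        and M: "M = pair_module X Y f g" unfolding C_def by blast
    obtain N1 N2 :: "('a, (nat \<Rightarrow> 'a) set \<times> (nat \<Rightarrow> 'a) set) module" and fN gN
      and P Q :: "'a small_module" and i p
      where N: "z_factorization N1 N2 fN gN" "gorenstein_projective R N1" "gorenstein_projective R N2"
        and ses: "dual_exact \<Delta> (pair_module N1 N2 fN gN) (induced_module P Q) (pair_module X Y f g) i p"
      by (rule pair_module_syzygy[OF F]) (rule that)
    obtain N where N': "C N" "left_module \<Delta> N" "module_iso \<Delta> (pair_module N1 N2 fN gN) N"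
      using small[OF N] by blast
    obtain i' p' where "dual_exact \<Delta> N (induced_module P Q) (pair_module X Y f g) i' p'"
      by (rule dual_exact_iso[OF ses N'(3,2) module_iso_refl dual_exactD(5)[OF ses]
          module_iso_refl dual_exactD(6)[OF ses]]) (rule that)
    with N'(1) M show "\<exists>N (P :: ('a matrix2, ((nat \<Rightarrow> 'a) set \<times> (nat \<Rightarrow> 'a) set) \<times> (nat \<Rightarrow> 'a) set \<times> (nat \<Rightarrow> 'a) set) module) i p.
        C N \<and> dual_exact \<Delta> N P M i p" by blast
  next
    fix M assume "C M"
    then obtain X Y :: "'a small_module" and f g
      where F: "z_factorization X Y f g" "gorenstein_projective R X" "gorenstein_projective R Y"
        and M: "M = pair_module X Y f g" unfolding C_def by blast
    obtain N1 N2 :: "('a, (nat \<Rightarrow> 'a) set \<times> (nat \<Rightarrow> 'a) set) module" and fN gN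
      and J I :: "'a small_module" and i p
      where N: "z_factorization N1 N2 fN gN" "gorenstein_projective R N1" "gorenstein_projective R N2"
        and ses: "dual_exact \<Delta> (pair_module X Y f g) (induced_module J I) (pair_module N1 N2 fN gN) i p"
      by (rule pair_module_cosyzygy[OF F]) (rule that)
    obtain N where N': "C N" "left_module \<Delta> N" "module_iso \<Delta> (pair_module N1 N2 fN gN) N"
      using small[OF N] by blast
    obtain i' p' where "dual_exact \<Delta> (pair_module X Y f g) (induced_module J I) N i' p'"
      by (rule dual_exact_iso[OF ses module_iso_refl dual_exactD(4)[OF ses]
          module_iso_refl dual_exactD(5)[OF ses] N'(3,2)]) (rule that)
    with N'(1) M show "\<exists>N (P :: ('a matrix2, ((nat \<Rightarrow> 'a) set \<times> (nat \<Rightarrow> 'a) set) \<times> (nat \<Rightarrow> 'a) set \<times> (nat \<Rightarrow> 'a) set) module) i p.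
        C N \<and> dual_exact \<Delta> M P N i p" by blast
  qed (rule M)
  then show ?thesis
    by (rule gorenstein_projective_iso[OF _ left_module_pair_module[OF F]
        module_iso_sym[OF M(3) left_module_pair_module[OF F] M(2)]])
qed

text \<open>Conversely, restriction to a corner carries a totally acyclic \<open>\<Delta>\<close>-complex to a totally acyclic
  \<open>R\<close>-complex, one short exact piece at a time.\<close>

lemma gorenstein_projective_components:
  fixes X :: "('a, 'x, 'm) module_scheme" and Y :: "('a, 'y, 'n) module_scheme"
  assumes F: "z_factorization X Y f g" and GP: "gorenstein_projective \<Delta> (pair_module X Y f g)"
  shows "gorenstein_projective R X" and "gorenstein_projective R Y"
proof -
  define C :: "('a, (nat \<Rightarrow> 'a matrix2) set) module \<Rightarrow> bool" where
    "C A \<longleftrightarrow> (\<exists>X Y f g. z_factorization X Y f g \<and> gorenstein_projective \<Delta> (pair_module X Y f g) \<and>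
      (A = X \<or> A = Y))" for A
  have gp: "gorenstein_projective R A" if "C A" for A
  proof (rule gorenstein_projective_coinduct[where C = C])
    fix A assume "C A"
    then obtain X Y f g
      where F: "z_factorization X Y f g" "gorenstein_projective \<Delta> (pair_module X Y f g)"
        and A: "A = X \<or> A = Y" unfolding C_def by blast
    obtain N P :: "('a matrix2) small_module" and i p
      where N: "gorenstein_projective \<Delta> N" and ses: "dual_exact \<Delta> N P (pair_module X Y f g) i p"
      by (rule gorenstein_projective_syzygy[OF F(2)]) (rule that)
    obtain N1 N2 :: "('a, (nat \<Rightarrow> 'a matrix2) set) module" and fN gN
      where N12: "z_factorization N1 N2 fN gN" "module_iso \<Delta> N (pair_module N1 N2 fN gN)"
      by (rule module_as_pair[OF dual_exactD(1)[OF ses]]) (rule that)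
    obtain P1 P2 :: "('a, (nat \<Rightarrow> 'a matrix2) set) module" and fP gP
      where P12: "z_factorization P1 P2 fP gP" "module_iso \<Delta> P (pair_module P1 P2 fP gP)"
      by (rule module_as_pair[OF projective_moduleD[OF dual_exactD(2)[OF ses]]]) (rule that)
    obtain i' p' where ses': "dual_exact \<Delta> (pair_module N1 N2 fN gN) (pair_module P1 P2 fP gP)
        (pair_module X Y f g) i' p'"
      by (rule dual_exact_iso[OF ses N12(2) left_module_pair_module[OF N12(1)]
          P12(2) left_module_pair_module[OF P12(1)] module_iso_refl dual_exactD(6)[OF ses]]) (rule that)
    have "C N1" "C N2"
      using N12(1) gorenstein_projective_iso[OF N left_module_pair_module[OF N12(1)] N12(2)]
      unfolding C_def by blast+
    then show "\<exists>N (P :: ('a, (nat \<Rightarrow> 'a matrix2) set) module) i p. C N \<and> dual_exact R N P A i p"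
      using A dual_exact_pairD[OF N12(1) P12(1) F(1) ses'] by blast
  next
    fix A assume "C A"
    then obtain X Y f g
      where F: "z_factorization X Y f g" "gorenstein_projective \<Delta> (pair_module X Y f g)"
        and A: "A = X \<or> A = Y" unfolding C_def by blast
    obtain N P :: "('a matrix2) small_module" and i p
      where N: "gorenstein_projective \<Delta> N" and ses: "dual_exact \<Delta> (pair_module X Y f g) P N i p"
      by (rule gorenstein_projective_cosyzygy[OF F(2)]) (rule that)
    obtain N1 N2 :: "('a, (nat \<Rightarrow> 'a matrix2) set) module" and fN gN
      where N12: "z_factorization N1 N2 fN gN" "module_iso \<Delta> N (pair_module N1 N2 fN gN)"
      by (rule module_as_pair[OF dual_exactD(3)[OF ses]]) (rule that)
    obtain P1 P2 :: "('a, (nat \<Rightarrow> 'a matrix2) set) module" and fP gP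
      where P12: "z_factorization P1 P2 fP gP" "module_iso \<Delta> P (pair_module P1 P2 fP gP)"
      by (rule module_as_pair[OF projective_moduleD[OF dual_exactD(2)[OF ses]]]) (rule that)
    obtain i' p' where ses': "dual_exact \<Delta> (pair_module X Y f g) (pair_module P1 P2 fP gP)
        (pair_module N1 N2 fN gN) i' p'"
      by (rule dual_exact_iso[OF ses module_iso_refl dual_exactD(4)[OF ses]
          P12(2) left_module_pair_module[OF P12(1)] N12(2) left_module_pair_module[OF N12(1)]]) (rule that)
    have "C N1" "C N2"
      using N12(1) gorenstein_projective_iso[OF N left_module_pair_module[OF N12(1)] N12(2)]
      unfolding C_def by blast+
    then show "\<exists>N (P :: ('a, (nat \<Rightarrow> 'a matrix2) set) module) i p. C N \<and> dual_exact R A P N i p"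
      using A dual_exact_pairD[OF F(1) P12(1) N12(1) ses'] by blast
  qed (rule that)
  note D = z_factorizationD[OF F]
  obtain M :: "('a matrix2) small_module"
    where M: "fg_module \<Delta> M" "module_iso \<Delta> (pair_module X Y f g) M"
    using fg_module_small[OF fg_pair_module[OF F]] by blast
  obtain X' Y' :: "('a, (nat \<Rightarrow> 'a matrix2) set) module" and f' g'
    where F': "z_factorization X' Y' f' g'" "module_iso \<Delta> M (pair_module X' Y' f' g')"
    by (rule module_as_pair[OF M(1)]) (rule that)
  note D' = z_factorizationD[OF F'(1)]
  have iso: "module_iso \<Delta> (pair_module X Y f g) (pair_module X' Y' f' g')"
    using module_iso_trans[OF M(2) F'(2)] .
  have "C X'" "C Y'"
    using F'(1) gorenstein_projective_iso[OF GP left_module_pair_module[OF F'(1)] iso]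
    unfolding C_def by blast+
  note GP' = this[THEN gp]
  show "gorenstein_projective R X"
    by (rule gorenstein_projective_iso[OF GP'(1) D(3)
        module_iso_sym[OF pair_module_iso_components(1)[OF F F'(1) iso] D(3) D'(3)]])
  show "gorenstein_projective R Y"
    by (rule gorenstein_projective_iso[OF GP'(2) D(4)
        module_iso_sym[OF pair_module_iso_components(2)[OF F F'(1) iso] D(4) D'(4)]])
qed

end


section \<open>Linear maps out of \<open>R \<otimes> N\<close>\<close>

lemma tensor_null_subgroup:
  assumes R: "ring R" and N: "left_module R N"
  shows "subgroup (tensor_null R (right_regular_module R) N) (free_Abelian_group (carrier R \<times> carrier N))"
proof -
  interpret R: ring R by fact
  interpret N: left_module R N by fact
  have diff: "Poly_Mapping.keys (u - v) \<subseteq> carrier R \<times> carrier N"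
    if "Poly_Mapping.keys u \<subseteq> carrier R \<times> carrier N" "Poly_Mapping.keys v \<subseteq> carrier R \<times> carrier N" for u v
    using keys_diff[of u v] that by blast
  have "Poly_Mapping.keys w \<subseteq> carrier R \<times> carrier N"
    if "w \<in> tensor_relations R (right_regular_module R) N" for w
    by (insert that, unfold tensor_relations_def, elim UnE CollectE exE conjE; erule ssubst; intro diff)
       (simp_all add: regular_module_def opposite_ring_def)
  then have "tensor_relations R (right_regular_module R) N \<subseteq> carrier (free_Abelian_group (carrier R \<times> carrier N))"
    by auto
  then have "subgroup (generate (free_Abelian_group (carrier R \<times> carrier N))
      (tensor_relations R (right_regular_module R) N)) (free_Abelian_group (carrier R \<times> carrier N))"
    by (intro group.generate_is_subgroup group_free_Abelian_group)
  then show ?thesis by (simp add: tensor_null_def regular_module_def opposite_ring_def)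
qed

lemma tensor_class_eqI:
  assumes R: "ring R" and N: "left_module R N"
    and u: "Poly_Mapping.keys u \<subseteq> carrier R \<times> carrier N"
    and uv: "u - v \<in> tensor_null R (right_regular_module R) N"
  shows "tensor_class R (right_regular_module R) N u = tensor_class R (right_regular_module R) N v"
proof -
  let ?G = "free_Abelian_group (carrier R \<times> carrier N)"
  let ?H = "tensor_null R (right_regular_module R) N"
  note H = tensor_null_subgroup[OF R N]
  have "v - u \<in> ?H"
    using subgroup.m_inv_closed[OF H uv] subgroup.subset[OF H] uv by (auto simp: subset_iff)
  moreover have "v = (v - u) \<otimes>\<^bsub>?G\<^esub> u" by simp
  ultimately have "v \<in> ?H #>\<^bsub>?G\<^esub> u" unfolding r_coset_def by blast
  then have "?H #>\<^bsub>?G\<^esub> u = ?H #>\<^bsub>?G\<^esub> v"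
    by (rule group.repr_independence[OF group_free_Abelian_group]) (use u H in auto)
  then show ?thesis by (simp add: tensor_class_def regular_module_def opposite_ring_def)
qed

lemma tensor_null_relation:
  "w \<in> tensor_relations R M N \<Longrightarrow> w \<in> tensor_null R M N"
  by (simp add: tensor_null_def generate.incl)

text \<open>Left multiplication on the first factor respects the defining relations, so the action on
  \<open>R \<otimes> N\<close> is the expected one on pure tensors.\<close>

lemma tensor_endo_lmult:
  assumes R: "ring R" and N: "left_module R N" and r: "r \<in> carrier R" and s: "s \<in> carrier R" and y: "y \<in> carrier N"
  shows "tensor_endo R (right_regular_module R) N (\<lambda>s. r \<otimes>\<^bsub>R\<^esub> s) (\<lambda>y. y) (rtensor R N s y) =
    rtensor R N (r \<otimes>\<^bsub>R\<^esub> s) y"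
proof -
  interpret R: ring R by fact
  interpret N: left_module R N by fact
  let ?M = "right_regular_module R"
  let ?G = "free_Abelian_group (carrier R \<times> carrier N)"
  let ?H = "tensor_null R ?M N"
  let ?E = "frag_extend (\<lambda>(x, y). frag_of (r \<otimes>\<^bsub>R\<^esub> x, y))"
  note H = tensor_null_subgroup[OF R N]
  have Gdef: "free_Abelian_group (carrier ?M \<times> carrier N) = ?G"
    by (simp add: regular_module_def opposite_ring_def)
  have Erel: "?E w \<in> tensor_relations R ?M N" if "w \<in> tensor_relations R ?M N" for w
    by (insert that r, unfold tensor_relations_def, elim UnE CollectE exE conjE)
       (simp add: frag_extend_diff regular_module_def opposite_ring_def R.r_distr R.m_assoc[symmetric],
         blast)+
  have Enull: "?E w \<in> ?H" if "w \<in> ?H" for w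
  proof -
    have rel: "Poly_Mapping.keys h \<subseteq> carrier R \<times> carrier N" if "h \<in> tensor_relations R ?M N" for h
      using subgroup.subset[OF H] tensor_null_relation[OF that] by (auto simp: subset_iff)
    from that have "w \<in> generate ?G (tensor_relations R ?M N)" by (simp only: tensor_null_def Gdef)
    then show ?thesis
    proof (induction rule: generate.induct)
      case one
      then show ?case using subgroup.one_closed[OF H] by simp
    next
      case (incl h)
      then show ?case by (intro tensor_null_relation Erel)
    next
      case (inv h)
      have Eh: "?E h \<in> ?H" using inv by (intro tensor_null_relation Erel)
      have "inv\<^bsub>?G\<^esub> (?E h) \<in> ?H" using subgroup.m_inv_closed[OF H Eh] .
      then show ?case using rel[OF inv] rel[OF Erel[OF inv]] by (simp add: frag_extend_minus)
    next
      case (eng h1 h2)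
      then show ?case using subgroup.m_closed[OF H] by (simp add: frag_extend_add)
    qed
  qed
  have "tensor_class R ?M N (?E w) = rtensor R N (r \<otimes>\<^bsub>R\<^esub> s) y" if w: "w \<in> rtensor R N s y" for w
  proof -
    obtain h where h: "h \<in> ?H" "w = h + frag_of (s, y)"
      using w unfolding tensor_def tensor_class_def Gdef by (auto simp: r_coset_def)
    have "tensor_class R ?M N (frag_of (r \<otimes>\<^bsub>R\<^esub> s, y)) = tensor_class R ?M N (?E w)"
    proof (rule tensor_class_eqI[OF R N])
      have "- ?E h \<in> ?H"
        using subgroup.m_inv_closed[OF H Enull[OF h(1)]] subgroup.subset[OF H] Enull[OF h(1)]
        by (auto simp: subset_iff)
      then show "frag_of (r \<otimes>\<^bsub>R\<^esub> s, y) - ?E w \<in> ?H" by (simp add: h(2) frag_extend_add)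
    qed (use r s y in auto)
    then show ?thesis by (simp add: tensor_def)
  qed
  moreover have "frag_of (s, y) \<in> rtensor R N s y"
    unfolding tensor_def tensor_class_def Gdef
    by (rule group.rcos_self[OF group_free_Abelian_group]) (use s y H in auto)
  ultimately show ?thesis unfolding tensor_endo_def by blast
qed

text \<open>Since \<open>s \<otimes> y = s (1 \<otimes> y) = 1 \<otimes> s y\<close>, a linear map out of \<open>R \<otimes> N\<close> is governed by its values on the
  tensors \<open>1 \<otimes> y\<close>.\<close>

lemma regular_tensor_linear_maps:
  assumes R: "ring R" and N: "left_module R N"
    and h: "h \<in> linear_maps R (regular_tensor R N) Q"
  shows "s \<in> carrier R \<Longrightarrow> y \<in> carrier N \<Longrightarrow> h (rtensor R N s y) = s \<odot>\<^bsub>Q\<^esub> h (rtensor R N \<one>\<^bsub>R\<^esub> y)"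
    and "(\<lambda>y. h (rtensor R N \<one>\<^bsub>R\<^esub> y)) \<in> linear_maps R N Q"
proof -
  interpret R: ring R by fact
  interpret N: left_module R N by fact
  let ?M = "right_regular_module R"
  let ?G = "free_Abelian_group (carrier R \<times> carrier N)"
  let ?H = "tensor_null R ?M N"
  note H = tensor_null_subgroup[OF R N]
  have Gdef: "free_Abelian_group (carrier ?M \<times> carrier N) = ?G"
    by (simp add: regular_module_def opposite_ring_def)
  have normal: "normal ?H ?G"
    using comm_group.subgroup_imp_normal[OF abelian_free_Abelian_group H] .
  have carr: "rtensor R N s y \<in> carrier (regular_tensor R N)" if "s \<in> carrier R" "y \<in> carrier N" for s y
    using that unfolding regular_tensor_def tensor_module_def tensor_group_def tensor_def
      tensor_class_def Gdef FactGroup_def RCOSETS_def by auto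
  have add: "rtensor R N s (y \<oplus>\<^bsub>N\<^esub> y') = rtensor R N s y \<oplus>\<^bsub>regular_tensor R N\<^esub> rtensor R N s y'"
    if "s \<in> carrier R" "y \<in> carrier N" "y' \<in> carrier N" for s y y'
  proof -
    have "frag_of (s, y \<oplus>\<^bsub>N\<^esub> y') - frag_of (s, y) - frag_of (s, y') \<in> ?H"
      by (rule tensor_null_relation)
         (use that in \<open>auto simp: tensor_relations_def regular_module_def opposite_ring_def\<close>)
    then have "frag_of (s, y \<oplus>\<^bsub>N\<^esub> y') - (frag_of (s, y) + frag_of (s, y')) \<in> ?H"
      by (simp add: algebra_simps)
    then have "rtensor R N s (y \<oplus>\<^bsub>N\<^esub> y') = tensor_class R ?M N (frag_of (s, y) + frag_of (s, y'))"
      unfolding tensor_def by (intro tensor_class_eqI[OF R N]) (use that in auto)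
    also have "\<dots> = rtensor R N s y <#>\<^bsub>?G\<^esub> rtensor R N s y'"
      unfolding tensor_def tensor_class_def Gdef
      using that by (subst normal.rcos_sum[OF normal]) auto
    finally show ?thesis
      unfolding regular_tensor_def tensor_module_def tensor_group_def Gdef FactGroup_def by simp
  qed
  have bal: "rtensor R N \<one>\<^bsub>R\<^esub> (s \<odot>\<^bsub>N\<^esub> y) = rtensor R N s y" if "s \<in> carrier R" "y \<in> carrier N" for s y
  proof -
    have "frag_of (\<one>\<^bsub>R\<^esub> \<otimes>\<^bsub>R\<^esub> s, y) - frag_of (\<one>\<^bsub>R\<^esub>, s \<odot>\<^bsub>N\<^esub> y) \<in> ?H"
      by (rule tensor_null_relation, unfold tensor_relations_def, rule UnI2, rule CollectI,
          intro exI[of _ s] exI[of _ "\<one>\<^bsub>R\<^esub>"] exI[of _ y] conjI)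
         (use that in \<open>simp_all add: regular_module_def opposite_ring_def\<close>)
    then have "tensor_class R ?M N (frag_of (s, y)) = tensor_class R ?M N (frag_of (\<one>\<^bsub>R\<^esub>, s \<odot>\<^bsub>N\<^esub> y))"
      by (intro tensor_class_eqI[OF R N]) (use that in auto)
    then show ?thesis by (simp add: tensor_def)
  qed
  have pure: "h (rtensor R N s y) = s \<odot>\<^bsub>Q\<^esub> h (rtensor R N \<one>\<^bsub>R\<^esub> y)"
    if "s \<in> carrier R" "y \<in> carrier N" for s y
  proof -
    have "rtensor R N s y = s \<odot>\<^bsub>regular_tensor R N\<^esub> rtensor R N \<one>\<^bsub>R\<^esub> y"
      using tensor_endo_lmult[OF R N that(1) R.one_closed that(2)] that
      by (simp add: regular_tensor_def tensor_module_def)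
    then show ?thesis using linear_mapsD(3)[OF h that(1) carr[OF R.one_closed that(2)]] by simp
  qed
  then show "s \<in> carrier R \<Longrightarrow> y \<in> carrier N \<Longrightarrow>
      h (rtensor R N s y) = s \<odot>\<^bsub>Q\<^esub> h (rtensor R N \<one>\<^bsub>R\<^esub> y)" .
  show "(\<lambda>y. h (rtensor R N \<one>\<^bsub>R\<^esub> y)) \<in> linear_maps R N Q"
  proof (rule linear_mapsI)
    fix s y assume "s \<in> carrier R" "y \<in> carrier N"
    then show "h (rtensor R N \<one>\<^bsub>R\<^esub> (s \<odot>\<^bsub>N\<^esub> y)) = s \<odot>\<^bsub>Q\<^esub> h (rtensor R N \<one>\<^bsub>R\<^esub> y)"
      using pure[of s y] by (simp add: bal)
  qed (simp_all add: linear_mapsD(1)[OF h carr] linear_mapsD(2)[OF h carr carr] add)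
qed

text \<open>Balancing gives \<open>\<phi>(1 \<otimes> n) = n z\<close>, and the associativity condition at \<open>m = n = 1\<close> then reads
  \<open>z m' = m' z\<close>.\<close>

lemma central_morita_datum:
  assumes R: "ring R" and \<phi>: "morita_datum R \<phi>"
  shows "central_morita R \<phi> (\<phi> (rtensor R (regular_module R) \<one>\<^bsub>R\<^esub> \<one>\<^bsub>R\<^esub>))"
proof -
  interpret R: ring R by fact
  define z where "z = \<phi> (rtensor R (regular_module R) \<one>\<^bsub>R\<^esub> \<one>\<^bsub>R\<^esub>)"
  have lin: "\<phi> \<in> functionals R (regular_tensor R (regular_module R))"
    and assoc: "\<And>m n m'. m \<in> carrier R \<Longrightarrow> n \<in> carrier R \<Longrightarrow> m' \<in> carrier R \<Longrightarrow>
      \<phi> (rtensor R (regular_module R) m n) \<otimes>\<^bsub>R\<^esub> m' = m \<otimes>\<^bsub>R\<^esub> \<phi> (rtensor R (regular_module R) n m')"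
    using \<phi> by (auto simp: morita_datum_def bimodule_maps_def)
  note T = regular_tensor_linear_maps[OF R left_module_regular[OF R] lin]
  have zc: "z \<in> carrier R" using linear_mapsD(1)[OF T(2)] by (simp add: z_def)
  have one: "\<phi> (rtensor R (regular_module R) \<one>\<^bsub>R\<^esub> n) = n \<otimes>\<^bsub>R\<^esub> z" if "n \<in> carrier R" for n
    using linear_mapsD(3)[OF T(2) that, of "\<one>\<^bsub>R\<^esub>"] that by (simp add: z_def)
  have central: "z \<otimes>\<^bsub>R\<^esub> n = n \<otimes>\<^bsub>R\<^esub> z" if "n \<in> carrier R" for n
    using assoc[of "\<one>\<^bsub>R\<^esub>" "\<one>\<^bsub>R\<^esub>" n] that zc by (simp add: one z_def[symmetric])
  have "\<phi> (rtensor R (regular_module R) m n) = z \<otimes>\<^bsub>R\<^esub> (m \<otimes>\<^bsub>R\<^esub> n)" if "m \<in> carrier R" "n \<in> carrier R" for m n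
    using T(1)[of m n] that zc by (simp add: one central R.m_assoc)
  then show ?thesis
    unfolding z_def[symmetric] by unfold_locales (simp_all add: zc central)
qed

lemma (in central_morita) morita_tuple_pair:
  assumes T: "morita_tuple R \<phi> X Y f g"
  defines "f' \<equiv> \<lambda>x. f (rtensor R X \<one> x)" and "g' \<equiv> \<lambda>y. g (rtensor R Y \<one> y)"
  shows "z_factorization X Y f' g'"
    and "left_module \<Delta> (morita_module R X Y f g)"
    and "module_iso \<Delta> (morita_module R X Y f g) (pair_module X Y f' g')"
proof -
  have fg: "fg_module R X" "fg_module R Y"
    and f: "f \<in> linear_maps R (regular_tensor R X) Y" and g: "g \<in> linear_maps R (regular_tensor R Y) X"
    using T by (auto simp: morita_tuple_def)
  note X = fg_moduleD[OF fg(1)] and Y = fg_moduleD[OF fg(2)]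
  interpret X: left_module R X by (rule X)
  interpret Y: left_module R Y by (rule Y)
  note Tf = regular_tensor_linear_maps[OF R.ring_axioms X f, folded f'_def]
    and Tg = regular_tensor_linear_maps[OF R.ring_axioms Y g, folded g'_def]
  have fs: "f (rtensor R X m x) = m \<odot>\<^bsub>Y\<^esub> f' x" if "m \<in> carrier R" "x \<in> carrier X" for m x
    using Tf(1)[OF that] by (simp add: f'_def)
  have gs: "g (rtensor R Y m y) = m \<odot>\<^bsub>X\<^esub> g' y" if "m \<in> carrier R" "y \<in> carrier Y" for m y
    using Tg(1)[OF that] by (simp add: g'_def)
  have phi1: "\<phi> (rtensor R (regular_module R) \<one> \<one>) = z" by (simp add: phi_tensor)
  have "g' (f' x) = z \<odot>\<^bsub>X\<^esub> x" if "x \<in> carrier X" for x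
    using T that phi1 by (auto simp: morita_tuple_def f'_def g'_def)
  moreover have "f' (g' y) = z \<odot>\<^bsub>Y\<^esub> y" if "y \<in> carrier Y" for y
    using T that phi1 by (auto simp: morita_tuple_def f'_def g'_def)
  ultimately show F: "z_factorization X Y f' g'"
    using fg Tf(2) Tg(2) by (simp add: z_factorization_def)
  interpret P: left_module \<Delta> "pair_module X Y f' g'" by (rule left_module_pair_module[OF F])
  have carr: "carrier (morita_module R X Y f g) = carrier (pair_module X Y f' g')"
    and zero: "\<zero>\<^bsub>morita_module R X Y f g\<^esub> = \<zero>\<^bsub>pair_module X Y f' g'\<^esub>"
    and add: "v \<oplus>\<^bsub>morita_module R X Y f g\<^esub> w = v \<oplus>\<^bsub>pair_module X Y f' g'\<^esub> w" for v w
    by (simp_all add: morita_module_def pair_module_def)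
  have smult: "A \<odot>\<^bsub>morita_module R X Y f g\<^esub> v = A \<odot>\<^bsub>pair_module X Y f' g'\<^esub> v"
    if "A \<in> carrier \<Delta>" "v \<in> carrier (pair_module X Y f' g')" for A v
    using that by (auto elim!: carrier_DeltaE simp: morita_module_def pair_module_def fs gs)
  have "abelian_group (morita_module R X Y f g)"
  proof (rule abelian_groupI; unfold carr zero add)
    fix v assume "v \<in> carrier (pair_module X Y f' g')"
    then show "\<exists>w\<in>carrier (pair_module X Y f' g'). w \<oplus>\<^bsub>pair_module X Y f' g'\<^esub> v = \<zero>\<^bsub>pair_module X Y f' g'\<^esub>"
      by (intro bexI[of _ "\<ominus>\<^bsub>pair_module X Y f' g'\<^esub> v"] P.M.l_neg P.M.a_inv_closed)
  qed (simp_all only: P.M.a_ac P.M.l_zero P.M.r_zero P.M.a_closed P.M.zero_closed)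
  then show mod: "left_module \<Delta> (morita_module R X Y f g)"
    by (intro left_module.intro left_module_axioms.intro ring_Delta)
       (simp_all only: carr add smult P.smult_l_distr P.smult_r_distr P.smult_assoc1 P.smult_one
          P.smult_closed P.M.a_closed P.R.add.m_closed P.R.m_closed P.R.one_closed)
  show "module_iso \<Delta> (morita_module R X Y f g) (pair_module X Y f' g')"
    by (rule module_isoI[of "\<lambda>v. v" _ _ _ "\<lambda>v. v"], rule linear_mapsI) (simp_all only: carr add smult, auto)
qed

theorem corollary6p6:
  fixes K :: "('k, 'e) ring_scheme"
    and \<Lambda> :: "('k, 'a, 's) module_scheme"
    and \<phi> :: "('a \<times> 'a \<Rightarrow>\<^sub>0 int) set \<Rightarrow> 'a"
    and X :: "('a, 'x, 'm) module_scheme"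
    and Y :: "('a, 'y, 'n) module_scheme"
    and f :: "('a \<times> 'x \<Rightarrow>\<^sub>0 int) set \<Rightarrow> 'y"
    and g :: "('a \<times> 'y \<Rightarrow>\<^sub>0 int) set \<Rightarrow> 'x"
  assumes "artin_algebra K \<Lambda>"
    and "gorenstein_ring \<Lambda>"
    and "morita_datum \<Lambda> \<phi>"
    and "morita_tuple \<Lambda> \<phi> X Y f g"
  shows "gorenstein_projective (morita_ring \<Lambda> \<phi>) (morita_module \<Lambda> X Y f g) \<longleftrightarrow>
         gorenstein_projective \<Lambda> X \<and> gorenstein_projective \<Lambda> Y"
proof -
  have ring: "ring \<Lambda>" using assms(1) by (simp add: artin_algebra_def)
  interpret central_morita \<Lambda> \<phi> "\<phi> (rtensor \<Lambda> (regular_module \<Lambda>) \<one>\<^bsub>\<Lambda>\<^esub> \<one>\<^bsub>\<Lambda>\<^esub>)"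
    by (rule central_morita_datum[OF ring assms(3)])
  note T = morita_tuple_pair[OF assms(4)]
  have pair: "left_module \<Delta> (pair_module X Y (\<lambda>x. f (rtensor \<Lambda> X \<one>\<^bsub>\<Lambda>\<^esub> x)) (\<lambda>y. g (rtensor \<Lambda> Y \<one>\<^bsub>\<Lambda>\<^esub> y)))"
    by (rule left_module_pair_module[OF T(1)])
  have "gorenstein_projective \<Delta> (morita_module \<Lambda> X Y f g) \<longleftrightarrow>
      gorenstein_projective \<Delta> (pair_module X Y (\<lambda>x. f (rtensor \<Lambda> X \<one>\<^bsub>\<Lambda>\<^esub> x)) (\<lambda>y. g (rtensor \<Lambda> Y \<one>\<^bsub>\<Lambda>\<^esub> y)))"
    using gorenstein_projective_iso[OF _ pair T(3)]
      gorenstein_projective_iso[OF _ T(2) module_iso_sym[OF T(3,2) pair]] by blast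
  then show ?thesis
    using gorenstein_projective_components[OF T(1)] gorenstein_projective_pair_module[OF T(1)] by blast
qed

end
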